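(* Let $V$ be a $K$-point of $\mathbf{Hilb}_{p(t)}^{n}$, and set $V_1:=\mathrm{vs}(\mathbf{in}(V))$ and $V_2:=\mathrm{vs}(\mathbf{gin}(V))$. Then the Hilbert polynomial of $I_{V_1}$ and $I_{V_2}$ is $p(t)$, and $$I_{V_1}=\mathrm{in}(I_V)=(\mathrm{in}(I_V)^{\mathrm{sat}})_{\ge m},\qquad I_{V_2}=\mathrm{gin}(I_V)=(\mathrm{gin}(I_V)^{\mathrm{sat}})_{\ge m}.$$
   Context: $K$ is an infinite field, $S=K[x_0,\dots,x_n]$ with the standard grading, $S_m$ is its degree $m$ component, a term is a monic monomial, $\prec$ is a term order on $S$ with $x_0\prec\dots\prec x_n$. $\mathbf{Hilb}_{p(t)}^{n}$ is the Hilbert scheme of closed subschemes of $\mathbb P^n_K$ with Hilbert polynomial $p(t)$; $r$ is the Gotzmann number of $p(t)$ (the smallest integer such that the saturated ideals of all such subschemes are $r$-regular). Fix $m\ge r$, $q=\binom{n+m}{n}-p(m)$. $\mathbf{Hilb}_{p(t)}^{n}$ is regarded as a closed subscheme of the Grassmannian $\mathbf{Gr}_{S_m}^{q}$ of $q$-dimensional subspaces of $S_m$ by sending a subscheme with saturated ideal $I$ to $I_m$; the Grassmannian is embedded in $\mathbb P(\wedge^qS_m)$ by Plücker. For a $K$-point $V\subseteq S_m$ of the Grassmannian, $I_V$ is the ideal of $S$ generated by $V$. The Hilbert polynomial of an ideal $I$ means that of $S/I$. $I^{\mathrm{sat}}=\bigcup_k(I:(x_0,\dots,x_n)^k)$,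 and $I_{\ge m}$ is the ideal $\bigoplus_{t\ge m}I_t$. $\mathbf T_{S_m}^{q}$ is the set of $\tau_1\wedge\dots\wedge\tau_q$ with $\tau_i$ terms in $S_m$, $\tau_1\succ\dots\succ\tau_q$, totally ordered by: $\tau_1\wedge\dots\wedge\tau_q\prec\sigma_1\wedge\dots\wedge\sigma_q$ iff for some $j$, $\tau_i=\sigma_i$ for $i<j$ and $\tau_j\prec\sigma_j$. For $L=\tau_1\wedge\dots\wedge\tau_q$, $U_L\subseteq\mathbf{Gr}_{S_m}^{q}$ is the open set where the Plücker coordinate $\Delta_L$ is invertible, $\mathrm{vs}(L)=\langle\tau_1,\dots,\tau_q\rangle$. $\mathrm{GL}=\mathrm{GL}_K(n+1)$ acts on $S$ by $g(f)=f(\sum_j g_{0j}x_j,\dots,\sum_j g_{nj}x_j)$ and correspondingly on $\mathbf{Gr}_{S_m}^{q}$; $\mathcal O(V)=\{g(V):g\in\mathrm{GL}\}$. $\mathbf{in}(V):=\max_\prec\{L\in\mathbf T_{S_m}^{q}:V\in U_L\}$ and $\mathbf{gin}(V):=\max_\prec\{L\in\mathbf T_{S_m}^{q}:U_L\cap\mathcal O(V)\ne\emptyset\}$. For a homogeneous ideal $I$, $\mathrm{in}(I)$ is its initial ideal with respect to $\prec$, and $\mathrm{gin}(I)$ is its generic initial ideal, i.e. the constant value of $\mathrm{in}(g(I))$ for $g$ in a suitable non-empty open subset of $\mathrm{GL}$. *)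

theory Defs
  imports
    "HOL-Analysis.Determinants"
    "HOL-Library.Poly_Mapping"
    "HOL-Computational_Algebra.Polynomial"
    "Jordan_Normal_Form.Matrix_Kernel"
begin

section \<open>The polynomial ring\<close>

text \<open>
  The variables are indexed by a finite linearly ordered type \<open>'v\<close> with \<open>n + 1\<close> elements, in the
  order \<open>x\<^sub>0, \<dots>, x\<^sub>n\<close>. A term is identified with its exponent vector of type \<open>'v \<Rightarrow>\<^sub>0 nat\<close>, so
  multiplication of terms is addition of exponent vectors.
\<close>

type_synonym 'v tm = "'v \<Rightarrow>\<^sub>0 nat"
type_synonym ('v, 'k) mpoly = "'v tm \<Rightarrow>\<^sub>0 'k"

abbreviation coeff_of :: "('v, 'k::zero) mpoly \<Rightarrow> 'v tm \<Rightarrow> 'k" where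
  "coeff_of \<equiv> Poly_Mapping.lookup"

definition tm_of_var :: "'v \<Rightarrow> 'v tm" where
  "tm_of_var i = Poly_Mapping.single i 1"

definition mono_poly :: "'v tm \<Rightarrow> ('v, 'k::zero_neq_one) mpoly" where
  "mono_poly t = Poly_Mapping.single t 1"

definition const_poly :: "'k::zero \<Rightarrow> ('v, 'k) mpoly" where
  "const_poly c = Poly_Mapping.single 0 c"

definition tdeg :: "'v::finite tm \<Rightarrow> nat" where
  "tdeg t = (\<Sum>i\<in>UNIV. Poly_Mapping.lookup t i)"

definition hom_part :: "nat \<Rightarrow> ('v::finite, 'k::zero) mpoly set" where
  "hom_part d = {f. \<forall>t \<in> Poly_Mapping.keys f. tdeg t = d}"

definition mscale :: "'k::field \<Rightarrow> ('v, 'k) mpoly \<Rightarrow> ('v, 'k) mpoly" where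
  "mscale c f = const_poly c * f"

text \<open>\<open>mpoly.span\<close>, \<open>mpoly.dim\<close>, etc. refer to \<open>K\<close>-subspaces of \<open>S\<close>;
  \<open>ideal.subspace\<close> and \<open>ideal.span\<close> are \<open>being an ideal\<close> and \<open>generated ideal\<close>.\<close>

global_interpretation mpoly: Vector_Spaces.vector_space "mscale :: 'k::field \<Rightarrow> ('v, 'k) mpoly \<Rightarrow> ('v, 'k) mpoly"
  by unfold_locales
    (simp_all add: mscale_def const_poly_def single_add algebra_simps
      mult.assoc[symmetric] mult_single)

global_interpretation ideal: Modules.module "(*) :: 'a::comm_ring_1 \<Rightarrow> 'a \<Rightarrow> 'a"
  by unfold_locales (simp_all add: algebra_simps)


section \<open>Homogeneous ideals, saturation, Hilbert polynomials\<close>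

definition homogeneous_ideal :: "('v::finite, 'k::field) mpoly set \<Rightarrow> bool" where
  "homogeneous_ideal I \<longleftrightarrow> (\<exists>B \<subseteq> (\<Union>d. hom_part d). I = ideal.span B)"

definition truncate_ge :: "nat \<Rightarrow> ('v::finite, 'k::field) mpoly set \<Rightarrow> ('v, 'k) mpoly set" where
  "truncate_ge m I = mpoly.span (\<Union>t\<in>{m..}. I \<inter> hom_part t)"

definition irrelevant_ideal :: "('v, 'k::field) mpoly set" where
  "irrelevant_ideal = ideal.span (range (\<lambda>i. mono_poly (tm_of_var i)))"

primrec ideal_power :: "'a::comm_ring_1 set \<Rightarrow> nat \<Rightarrow> 'a set" where
  "ideal_power J 0 = UNIV"
| "ideal_power J (Suc k) = ideal.span {a * b |a b. a \<in> J \<and> b \<in> ideal_power J k}"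

definition ideal_quotient :: "'a::comm_ring_1 set \<Rightarrow> 'a set \<Rightarrow> 'a set" where
  "ideal_quotient I J = {f. \<forall>g\<in>J. f * g \<in> I}"

definition saturation :: "('v, 'k::field) mpoly set \<Rightarrow> ('v, 'k) mpoly set" where
  "saturation I = (\<Union>k. ideal_quotient I (ideal_power irrelevant_ideal k))"

text \<open>The dimension of \<open>(S/I)\<^sub>t = S\<^sub>t / I\<^sub>t\<close>.\<close>

definition hilbert_function :: "('v::finite, 'k::field) mpoly set \<Rightarrow> nat \<Rightarrow> nat" where
  "hilbert_function I t =
     mpoly.dim (hom_part t :: ('v, 'k) mpoly set) - mpoly.dim (I \<inter> hom_part t)"

definition has_hilbert_polynomial :: "('v::finite, 'k::field) mpoly set \<Rightarrow> rat poly \<Rightarrow> bool" where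
  "has_hilbert_polynomial I p \<longleftrightarrow>
     (\<forall>\<^sub>F t in sequentially. of_nat (hilbert_function I t) = poly p (of_nat t))"


section \<open>Regularity and the Gotzmann number\<close>

text \<open>
  A graded free resolution \<open>\<dots> \<rightarrow> F\<^sub>1 \<rightarrow> F\<^sub>0 \<rightarrow> I \<rightarrow> 0\<close>, where \<open>F\<^sub>i\<close> is the direct sum of the \<open>S(-e)\<close>
  for \<open>e\<close> in the list \<open>a i\<close>. The augmentation \<open>F\<^sub>0 \<rightarrow> I\<close> is given by a vector \<open>\<epsilon>\<close> of generators
  of \<open>I\<close> and \<open>F\<^sub>i\<^sub>+\<^sub>1 \<rightarrow> F\<^sub>i\<close> by the matrix \<open>D i\<close>. The entry \<open>(j, k)\<close> of \<open>D i\<close> is homogeneous of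
  degree \<open>a (i+1) ! k - a i ! j\<close> (zero if this is negative). The resolution is minimal when
  no \<open>D i\<close> has an entry with non-zero constant coefficient, i.e. the image of \<open>F\<^sub>i\<^sub>+\<^sub>1\<close> lies in
  \<open>(x\<^sub>0, \<dots>, x\<^sub>n) F\<^sub>i\<close>.
\<close>

definition graded_free_resolution ::
  "('v::finite, 'k::field) mpoly set \<Rightarrow> (nat \<Rightarrow> nat list) \<Rightarrow>
   ('v, 'k) mpoly vec \<Rightarrow> (nat \<Rightarrow> ('v, 'k) mpoly mat) \<Rightarrow> bool" where
  "graded_free_resolution I a \<epsilon> D \<longleftrightarrow>
     \<epsilon> \<in> carrier_vec (length (a 0)) \<and>
     (\<forall>j < length (a 0). vec_index \<epsilon> j \<in> hom_part (a 0 ! j)) \<and>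
     (\<forall>i. D i \<in> carrier_mat (length (a i)) (length (a (Suc i)))) \<and>
     (\<forall>i. \<forall>j < length (a i). \<forall>k < length (a (Suc i)).
        \<forall>t \<in> Poly_Mapping.keys (D i $$ (j, k)). tdeg t + a i ! j = a (Suc i) ! k) \<and>
     I = {scalar_prod \<epsilon> v |v. v \<in> carrier_vec (length (a 0))} \<and>
     {v \<in> carrier_vec (length (a 0)). scalar_prod \<epsilon> v = 0} =
       {D 0 *\<^sub>v w |w. w \<in> carrier_vec (length (a 1))} \<and>
     (\<forall>i. mat_kernel (D i) =
       {D (Suc i) *\<^sub>v w |w. w \<in> carrier_vec (length (a (Suc (Suc i))))})"

definition minimal_graded_free_resolution ::
  "('v::finite, 'k::field) mpoly set \<Rightarrow> (nat \<Rightarrow> nat list) \<Rightarrow>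
   ('v, 'k) mpoly vec \<Rightarrow> (nat \<Rightarrow> ('v, 'k) mpoly mat) \<Rightarrow> bool" where
  "minimal_graded_free_resolution I a \<epsilon> D \<longleftrightarrow>
     graded_free_resolution I a \<epsilon> D \<and>
     (\<forall>i. \<forall>j < length (a i). \<forall>k < length (a (Suc i)). coeff_of (D i $$ (j, k)) 0 = 0)"

text \<open>Castelnuovo-Mumford regularity. Minimal graded free resolutions are unique up to
  isomorphism, so the quantifier over resolutions does not matter.\<close>

definition regular_ideal :: "nat \<Rightarrow> ('v::finite, 'k::field) mpoly set \<Rightarrow> bool" where
  "regular_ideal r I \<longleftrightarrow>
     (\<exists>a \<epsilon> D. minimal_graded_free_resolution I a \<epsilon> D \<and> (\<forall>i. \<forall>e \<in> set (a i). e \<le> r + i))"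

text \<open>The saturated ideals of the closed subschemes of projective space with Hilbert polynomial
  \<open>p\<close>. Closed subschemes correspond bijectively to saturated homogeneous ideals.\<close>

definition subscheme_ideals :: "rat poly \<Rightarrow> ('v::finite, 'k::field) mpoly set set" where
  "subscheme_ideals p =
     {J. homogeneous_ideal J \<and> saturation J = J \<and> has_hilbert_polynomial J p}"

text \<open>The type argument fixes the field and the number of variables.\<close>

definition is_gotzmann_number ::
  "('v::finite, 'k::field) mpoly itself \<Rightarrow> rat poly \<Rightarrow> nat \<Rightarrow> bool" where
  "is_gotzmann_number S p r \<longleftrightarrow>
     (\<forall>J \<in> (subscheme_ideals p :: ('v, 'k) mpoly set set). regular_ideal r J) \<and>
     (\<forall>s. (\<forall>J \<in> (subscheme_ideals p :: ('v, 'k) mpoly set set). regular_ideal s J) \<longrightarrow> r \<le> s)"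


section \<open>Grassmannian, Hilbert scheme, Pluecker coordinates\<close>

text \<open>The \<open>K\<close>-points of the Grassmannian of \<open>q\<close>-dimensional subspaces of \<open>S\<^sub>m\<close>, and the
  \<open>K\<close>-points of the Hilbert scheme under the embedding \<open>I \<mapsto> I\<^sub>m\<close>.\<close>

definition grassmannian :: "nat \<Rightarrow> nat \<Rightarrow> ('v::finite, 'k::field) mpoly set set" where
  "grassmannian m q = {V. V \<subseteq> hom_part m \<and> mpoly.subspace V \<and> mpoly.dim V = q}"

definition hilbert_scheme_points :: "rat poly \<Rightarrow> nat \<Rightarrow> ('v::finite, 'k::field) mpoly set set" where
  "hilbert_scheme_points p m = {J \<inter> hom_part m |J. J \<in> subscheme_ideals p}"

text \<open>The wedge product of the terms \<open>\<tau>\<^sub>1 \<succ> \<dots> \<succ> \<tau>\<^sub>q\<close> is encoded as the list \<open>[\<tau>\<^sub>1, \<dots>, \<tau>\<^sub>q]\<close>.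
  Throughout, \<open>prec s t\<close> stands for \<open>s \<prec> t\<close>.\<close>

definition term_wedges ::
  "('v::finite tm \<Rightarrow> 'v tm \<Rightarrow> bool) \<Rightarrow> nat \<Rightarrow> nat \<Rightarrow> 'v tm list set" where
  "term_wedges prec m q =
     {L. length L = q \<and> (\<forall>t \<in> set L. tdeg t = m) \<and> sorted_wrt (\<lambda>s t. prec t s) L}"

definition wedge_less ::
  "('v tm \<Rightarrow> 'v tm \<Rightarrow> bool) \<Rightarrow> 'v tm list \<Rightarrow> 'v tm list \<Rightarrow> bool" where
  "wedge_less prec L M \<longleftrightarrow> (\<exists>j < length L. (\<forall>i<j. L ! i = M ! i) \<and> prec (L ! j) (M ! j))"

definition max_wedge ::
  "('v tm \<Rightarrow> 'v tm \<Rightarrow> bool) \<Rightarrow> 'v tm list set \<Rightarrow> 'v tm list" where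
  "max_wedge prec A = (THE L. L \<in> A \<and> (\<forall>M \<in> A. M \<noteq> L \<longrightarrow> wedge_less prec M L))"

text \<open>The coefficient of \<open>\<tau>\<^sub>1 \<and> \<dots> \<and> \<tau>\<^sub>q\<close> in \<open>b\<^sub>1 \<and> \<dots> \<and> b\<^sub>q\<close>.\<close>

definition plucker_coord :: "('v, 'k::field) mpoly list \<Rightarrow> 'v tm list \<Rightarrow> 'k" where
  "plucker_coord bs L =
     Determinant.det (Matrix.mat (length bs) (length L) (\<lambda>(i, j). coeff_of (bs ! i) (L ! j)))"

definition is_basis_list :: "('v, 'k::field) mpoly list \<Rightarrow> ('v, 'k) mpoly set \<Rightarrow> bool" where
  "is_basis_list bs V \<longleftrightarrow>
     distinct bs \<and> mpoly.independent (set bs) \<and> mpoly.span (set bs) = V"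

text \<open>The \<open>K\<close>-points of \<open>U\<^sub>L\<close>. Another basis multiplies the Pluecker coordinates by a non-zero
  constant.\<close>

definition plucker_open ::
  "nat \<Rightarrow> nat \<Rightarrow> 'v::finite tm list \<Rightarrow> ('v, 'k::field) mpoly set set" where
  "plucker_open m q L =
     {V \<in> grassmannian m q. \<exists>bs. is_basis_list bs V \<and> plucker_coord bs L \<noteq> 0}"

definition vs :: "'v tm list \<Rightarrow> ('v, 'k::field) mpoly set" where
  "vs L = mpoly.span (mono_poly ` set L)"


section \<open>The action of the general linear group\<close>

definition GL :: "('k::field ^ 'v ^ 'v) set" where
  "GL = {g. invertible g}"

definition gl_act ::
  "'k::field ^ 'v ^ 'v \<Rightarrow> ('v::finite, 'k) mpoly \<Rightarrow> ('v, 'k) mpoly" where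
  "gl_act g f = (\<Sum>t \<in> Poly_Mapping.keys f. const_poly (coeff_of f t) *
     (\<Prod>i\<in>UNIV. (\<Sum>j\<in>UNIV. const_poly (vec_nth (vec_nth g i) j) * mono_poly (tm_of_var j))
        ^ Poly_Mapping.lookup t i))"

definition gl_orbit :: "('v::finite, 'k::field) mpoly set \<Rightarrow> ('v, 'k) mpoly set set" where
  "gl_orbit V = {gl_act g ` V |g. g \<in> GL}"

text \<open>Evaluation at \<open>g\<close> of a polynomial in the matrix entries.\<close>

definition eval_at_matrix :: "('v::finite \<times> 'v, 'k::field) mpoly \<Rightarrow> 'k ^ 'v ^ 'v \<Rightarrow> 'k" where
  "eval_at_matrix F g = (\<Sum>t \<in> Poly_Mapping.keys F. coeff_of F t *
     (\<Prod>(i, j)\<in>UNIV. vec_nth (vec_nth g i) j ^ Poly_Mapping.lookup t (i, j)))"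

definition zariski_open_GL :: "('k::field ^ 'v::finite ^ 'v) set \<Rightarrow> bool" where
  "zariski_open_GL U \<longleftrightarrow> (\<exists>\<Phi>. U = {g \<in> GL. \<exists>F \<in> \<Phi>. eval_at_matrix F g \<noteq> 0})"


section \<open>Initial and generic initial ideals\<close>

definition term_order :: "('v tm \<Rightarrow> 'v tm \<Rightarrow> bool) \<Rightarrow> bool" where
  "term_order prec \<longleftrightarrow>
     irreflp prec \<and> transp prec \<and> totalp prec \<and>
     (\<forall>t. t \<noteq> 0 \<longrightarrow> prec 0 t) \<and>
     (\<forall>s t u. prec s t \<longrightarrow> prec (s + u) (t + u))"

definition lead_tm ::
  "('v tm \<Rightarrow> 'v tm \<Rightarrow> bool) \<Rightarrow> ('v, 'k::zero) mpoly \<Rightarrow> 'v tm" where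
  "lead_tm prec f =
     (THE t. t \<in> Poly_Mapping.keys f \<and> (\<forall>s \<in> Poly_Mapping.keys f. s \<noteq> t \<longrightarrow> prec s t))"

definition initial_ideal ::
  "('v tm \<Rightarrow> 'v tm \<Rightarrow> bool) \<Rightarrow> ('v, 'k::field) mpoly set \<Rightarrow> ('v, 'k) mpoly set" where
  "initial_ideal prec I = ideal.span {mono_poly (lead_tm prec f) |f. f \<in> I \<and> f \<noteq> 0}"

text \<open>Over an infinite field any two non-empty open subsets of \<open>GL\<close> meet, so the value is
  unique.\<close>

definition generic_initial_ideal ::
  "('v tm \<Rightarrow> 'v tm \<Rightarrow> bool) \<Rightarrow> ('v::finite, 'k::field) mpoly set \<Rightarrow> ('v, 'k) mpoly set" where
  "generic_initial_ideal prec I =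
     (THE J. \<exists>U. zariski_open_GL U \<and> U \<noteq> {} \<and> (\<forall>g \<in> U. initial_ideal prec (gl_act g ` I) = J))"

definition in_wedge ::
  "('v tm \<Rightarrow> 'v tm \<Rightarrow> bool) \<Rightarrow> nat \<Rightarrow> nat \<Rightarrow> ('v::finite, 'k::field) mpoly set \<Rightarrow> 'v tm list" where
  "in_wedge prec m q V = max_wedge prec {L \<in> term_wedges prec m q. V \<in> plucker_open m q L}"

definition gin_wedge ::
  "('v tm \<Rightarrow> 'v tm \<Rightarrow> bool) \<Rightarrow> nat \<Rightarrow> nat \<Rightarrow> ('v::finite, 'k::field) mpoly set \<Rightarrow> 'v tm list" where
  "gin_wedge prec m q V =
     max_wedge prec {L \<in> term_wedges prec m q. plucker_open m q L \<inter> gl_orbit V \<noteq> {}}"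

end

theory Submission
  imports Defs "HOL-Library.Function_Algebras"
begin

text \<open>
  The graded minimal resolution of an \<open>r\<close>-regular ideal \<open>J\<close> has length at most \<open>n\<close> (killing the
  variables one after the other keeps the complex exact far enough to the left), so its Hilbert
  function is the alternating sum of the Hilbert functions of the \<open>S(-e)\<close> with \<open>e \<le> r + i\<close>, and this
  agrees with \<open>p\<close> from degree \<open>r\<close> on; moreover \<open>J\<close> is generated in degrees \<open>\<le> r\<close>.

  Let \<open>M\<close> be the set of leading terms of \<open>I\<^sub>V\<close>. The saturation of the monomial ideal \<open>(M)\<close> is
  itself the ideal of a subscheme with Hilbert polynomial \<open>p\<close>, hence \<open>r\<close>-regular by the choice
  of \<open>r\<close>. Both ideals have Hilbert function \<open>p\<close> in degrees \<open>\<ge> m\<close>, so they agree there, and thus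
  \<open>(M)\<close> is generated by \<open>M\<^sub>m\<close>, the leading terms of \<open>V\<close>. These are the entries of the greatest
  non-vanishing Pluecker coordinate: \<open>V \<in> U\<^sub>L\<close> iff no non-zero element of \<open>V\<close> vanishes at all
  terms of \<open>L\<close>, and a dimension count excludes anything greater.

  For \<open>gin\<close>, the same is applied to \<open>g(V)\<close> for \<open>g\<close> in the open set where the coordinate \<open>gin(V)\<close>
  of \<open>g(V)\<close> does not vanish.
\<close>

text \<open>As a simplification rule this instance rewrites \<open>a * (b * c)\<close> to \<open>a * b * c\<close> in every
  commutative ring, which loops with \<open>mult.assoc\<close>.\<close>

declare ideal.scale_scale [simp del]

section \<open>Linear algebra\<close>

text \<open>The ideal (M) need not be saturated, while the Gotzmann number controls saturated ideals
  only. Passing to the saturation makes the regularity bound available without a persistence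
  theorem: the two Hilbert functions are tied to p by different arguments, Macaulay's theorem for
  (M) and regularity for its saturation. Regularity is given by a minimal resolution indexed by all
  natural numbers, with shifts bounded by \<open>r + i\<close>. The bound weakens as i grows, so
  nothing follows before the resolution is known to stop. Stopping at i = n is enough because the
  Hilbert polynomial of S(-e) gives the right value already for e \<le> t + n, not merely for e
  \<le> t. S has infinite dimension, so dimensions are counted degree by degree, inside spans of
  finitely many terms. In the generic case the wedge is squeezed: if g(V) lies in the open set of
  the greatest wedge L of the orbit, then in(g(V)) is at least L by its own maximality and at most L
  by that of L. Infinitude of the field enters through the line joining two matrices.\<close>

context vector_space
begin

text \<open>\<open>dim\<close> is the cardinality of a basis and hence 0 for an infinite one. As S
  has infinite dimension, even monotonicity needs a finite set spanning the larger space; later a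
  graded piece provides it.\<close>

lemma finite_dim_subspace_mono:
  assumes "V \<subseteq> W" "W \<subseteq> span B" "finite B"
  shows "dim V \<le> dim W"
proof -
  obtain A where A: "A \<subseteq> V" "independent A" "V \<subseteq> span A" "card A = dim V"
    using basis_exists by blast
  obtain C where C: "A \<subseteq> C" "C \<subseteq> W" "independent C" "W \<subseteq> span C"
    using maximal_independent_subset_extend[of A W] A assms(1) by blast
  have "finite C"
    using independent_span_bound[OF assms(3) C(3)] C(2) assms(2) by blast
  moreover have "card C = dim W" using basis_card_eq_dim[OF C(2,4,3)] .
  ultimately show ?thesis using A(4) C(1) card_mono by metis
qed

lemma finite_dim_independent_card_le:
  assumes "A \<subseteq> V" "independent A" "V \<subseteq> span B" "finite B"
  shows "finite A \<and> card A \<le> dim V"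
proof -
  have "finite A" using independent_span_bound[OF assms(4,2)] assms(1,3) by blast
  moreover have "dim A = card A" using assms(2) by (rule dim_eq_card_independent)
  moreover have "dim A \<le> dim V" by (rule finite_dim_subspace_mono[OF assms(1,3,4)])
  ultimately show ?thesis by simp
qed

end

text \<open>Extend a basis \<open>B\<close> of the kernel inside \<open>V\<close> to a basis
  \<open>C\<close> of \<open>V\<close>; the images of \<open>C - B\<close> form a basis of the
  image. The version relative to \<open>V\<close> is needed because the ambient spaces are
  infinite-dimensional.\<close>

lemma (in Vector_Spaces.linear) rank_nullity:
  assumes V: "vs1.subspace V" "V \<subseteq> vs1.span A" "finite A"
  shows "vs1.dim V = vs1.dim {x \<in> V. f x = 0} + vs2.dim (f ` V)"
proof -
  let ?N = "{x \<in> V. f x = 0}"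
  obtain B where B: "B \<subseteq> ?N" "vs1.independent B" "?N \<subseteq> vs1.span B" "card B = vs1.dim ?N"
    using vs1.basis_exists by blast
  obtain C where C: "B \<subseteq> C" "C \<subseteq> V" "vs1.independent C" "V \<subseteq> vs1.span C"
    using vs1.maximal_independent_subset_extend[of B V] B by blast
  have fC: "finite C"
    using vs1.independent_span_bound[OF V(3) C(3)] C(2) V(2) by blast
  have cC: "card C = vs1.dim V" using vs1.basis_card_eq_dim[OF C(2,4,3)] .
  have sub: "vs1.span (C - B) \<subseteq> V" using vs1.span_minimal[OF _ V(1)] C(2) by blast
  have inj: "inj_on f (vs1.span (C - B))"
  proof (subst inj_on_iff_eq_0[OF vs1.subspace_span], intro ballI impI)
    fix x assume x: "x \<in> vs1.span (C - B)" "f x = 0"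
    hence xB: "x \<in> vs1.span B" using sub B(3) by blast
    \<comment> \<open>Uniqueness of coordinates: those of \<open>x\<close> over \<open>C\<close>
      vanish outside \<open>B\<close> and also outside \<open>C - B\<close>, hence
      everywhere.\<close>
    have "vs1.representation C x = vs1.representation B x"
      using vs1.representation_extend[OF C(3) xB C(1)] .
    moreover have "vs1.representation C x = vs1.representation (C - B) x"
      using vs1.representation_extend[OF C(3) x(1)] by blast
    ultimately have "vs1.representation C x b = 0" for b
      using vs1.representation_ne_zero[of B x b] vs1.representation_ne_zero[of "C - B" x b] by auto
    moreover have "x \<in> vs1.span C" using xB vs1.span_mono[OF C(1)] by blast
    ultimately show "x = 0"
      using vs1.sum_nonzero_representation_eq[OF C(3), of x] by simp
  qed
  have ind: "vs2.independent (f ` (C - B))"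
    using independent_injective_image[OF _ inj] C(3) vs1.independent_mono by blast
  have "f ` V \<subseteq> vs2.span (f ` (C - B))"
  proof -
    have "f ` V \<subseteq> vs2.span (f ` C)" using C(4) by (rule spans_image)
    also have "f ` C \<subseteq> vs2.span (f ` (C - B))"
    proof
      fix y assume "y \<in> f ` C"
      then obtain c where c: "c \<in> C" "y = f c" by blast
      show "y \<in> vs2.span (f ` (C - B))"
      proof (cases "c \<in> B")
        case True thus ?thesis using B(1) c vs2.span_zero by auto
      next
        case False thus ?thesis using c by (auto intro: vs2.span_base)
      qed
    qed
    hence "vs2.span (f ` C) \<subseteq> vs2.span (f ` (C - B))"
      by (rule vs2.span_minimal) simp
    finally show ?thesis .
  qed
  hence "card (f ` (C - B)) = vs2.dim (f ` V)"
    using vs2.basis_card_eq_dim[OF _ _ ind, of "f ` V"] C(2) by blast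
  moreover have "card (f ` (C - B)) = card (C - B)"
    using inj by (intro card_image) (meson inj_on_subset vs1.span_superset)
  moreover have "card (C - B) = card C - card B"
    using card_Diff_subset[of B C] C(1) fC finite_subset by blast
  moreover have "card B \<le> card C" using card_mono[OF fC C(1)] .
  ultimately show ?thesis using B(4) cC by simp
qed

section \<open>Polynomials as finitely supported functions\<close>

text \<open>Homogeneous parts, truncated monomial ideals and ideals generated by variables all have
  this shape, so inclusions and dimensions become questions about sets of terms.\<close>

definition supported :: "'v tm set \<Rightarrow> ('v, 'k::zero) mpoly set" where
  "supported M = {h. Poly_Mapping.keys h \<subseteq> M}"

definition deg_terms :: "nat \<Rightarrow> 'v::finite tm set" where
  "deg_terms d = {t. tdeg t = d}"

text \<open>The projection onto \<open>supported A\<close> along the other terms. With all terms of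
  one degree it takes homogeneous components; with finitely many chosen terms its injectivity on a
  subspace bounds a dimension.\<close>

definition restrict_poly :: "'v tm set \<Rightarrow> ('v, 'k::comm_monoid_add) mpoly \<Rightarrow> ('v, 'k) mpoly" where
  "restrict_poly A f = (\<Sum>t\<in>Poly_Mapping.keys f \<inter> A. Poly_Mapping.single t (coeff_of f t))"

lemma lookup_const_poly_mult [simp]:
  fixes f :: "('v, 'k::field) mpoly"
  shows "coeff_of (const_poly c * f) t = c * coeff_of f t"
  unfolding const_poly_def
  by (simp add: mult_map_scale_conv_mult[symmetric] Poly_Mapping.map.rep_eq when_def)

lemma lookup_mscale [simp]:
  fixes f :: "('v, 'k::field) mpoly"
  shows "coeff_of (mscale c f) t = c * coeff_of f t"
  by (simp add: mscale_def)

lemma hom_part_eq_supported: "hom_part d = supported (deg_terms d)"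
  by (auto simp: hom_part_def supported_def deg_terms_def)

lemma in_supported_iff: "f \<in> supported M \<longleftrightarrow> (\<forall>t. t \<notin> M \<longrightarrow> coeff_of f t = 0)"
  by (auto simp: supported_def in_keys_iff)

lemma supported_subspace: "mpoly.subspace (supported M :: ('v, 'k::field) mpoly set)"
  by (rule mpoly.subspaceI) (auto simp: in_supported_iff lookup_add)

lemma hom_part_subspace: "mpoly.subspace (hom_part d :: ('v::finite, 'k::field) mpoly set)"
  by (simp add: hom_part_eq_supported supported_subspace)

lemma supported_Int: "supported A \<inter> supported B = supported (A \<inter> B)"
  by (auto simp: supported_def)

lemma mono_poly_in_supported [simp]:
  "(mono_poly t :: ('v, 'k::zero_neq_one) mpoly) \<in> supported M \<longleftrightarrow> t \<in> M"
  by (simp add: mono_poly_def supported_def)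

lemma lookup_mono_poly: "coeff_of (mono_poly t) s = (if s = t then 1 else 0)"
  by (auto simp: mono_poly_def lookup_single when_def)

lemma inj_mono_poly: "inj (mono_poly :: 'v tm \<Rightarrow> ('v, 'k::zero_neq_one) mpoly)"
  by (rule injI) (metis lookup_mono_poly zero_neq_one)

lemma poly_as_sum:
  fixes f :: "('v, 'k::field) mpoly"
  shows "f = (\<Sum>t\<in>Poly_Mapping.keys f. mscale (coeff_of f t) (mono_poly t))"
proof (rule poly_mapping_eqI)
  fix s
  have "coeff_of (\<Sum>t\<in>Poly_Mapping.keys f. mscale (coeff_of f t) (mono_poly t)) s
    = (\<Sum>t\<in>Poly_Mapping.keys f. if s = t then coeff_of f t else 0)"
    by (simp add: lookup_sum lookup_mono_poly if_distrib cong: if_cong)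
  also have "\<dots> = coeff_of f s"
    by (simp add: in_keys_iff)
  finally show "coeff_of f s =
    coeff_of (\<Sum>t\<in>Poly_Mapping.keys f. mscale (coeff_of f t) (mono_poly t)) s" ..
qed

lemma span_mono_poly:
  "mpoly.span (mono_poly ` M) = (supported M :: ('v, 'k::field) mpoly set)"
proof
  show "mpoly.span (mono_poly ` M) \<subseteq> (supported M :: ('v, 'k) mpoly set)"
    by (rule mpoly.span_minimal) (auto simp: supported_subspace)
  show "(supported M :: ('v, 'k) mpoly set) \<subseteq> mpoly.span (mono_poly ` M)"
  proof
    fix f :: "('v, 'k) mpoly" assume "f \<in> supported M"
    hence "(\<Sum>t\<in>Poly_Mapping.keys f. mscale (coeff_of f t) (mono_poly t)) \<in>
      mpoly.span (mono_poly ` M)"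
      by (intro mpoly.span_sum mpoly.span_scale mpoly.span_base) (auto simp: supported_def)
    thus "f \<in> mpoly.span (mono_poly ` M)" using poly_as_sum[of f] by simp
  qed
qed

lemma independent_mono_poly:
  assumes "finite M"
  shows "mpoly.independent (mono_poly ` M :: ('v, 'k::field) mpoly set)"
proof (rule mpoly.independent_if_scalars_zero)
  show "finite (mono_poly ` M :: ('v, 'k) mpoly set)" using assms by simp
  fix g :: "('v, 'k) mpoly \<Rightarrow> 'k" and x :: "('v, 'k) mpoly"
  assume z: "(\<Sum>x\<in>mono_poly ` M. mscale (g x) x) = 0" and "x \<in> mono_poly ` M"
  then obtain t where t: "t \<in> M" "x = mono_poly t" by blast
  have "0 = coeff_of (\<Sum>x\<in>mono_poly ` M. mscale (g x) x) t" using z by simp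
  also have "\<dots> = coeff_of (\<Sum>s\<in>M. mscale (g (mono_poly s)) (mono_poly s)) t"
    by (subst sum.reindex) (auto intro: inj_on_subset[OF inj_mono_poly])
  also have "\<dots> = g x"
    using t assms by (simp add: lookup_sum lookup_mono_poly if_distrib cong: if_cong)
  finally show "g x = 0" ..
qed

lemma dim_supported:
  assumes "finite M"
  shows "mpoly.dim (supported M :: ('v, 'k::field) mpoly set) = card M"
proof -
  have "mpoly.dim (supported M :: ('v, 'k) mpoly set) = card (mono_poly ` M :: ('v, 'k) mpoly set)"
    unfolding span_mono_poly[symmetric]
    by (rule mpoly.dim_span_eq_card_independent) (rule independent_mono_poly[OF assms])
  also have "\<dots> = card M" by (rule card_image) (rule inj_on_subset[OF inj_mono_poly], simp)
  finally show ?thesis .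
qed

lemma lookup_restrict_poly [simp]:
  "coeff_of (restrict_poly A f) t = (if t \<in> A then coeff_of f t else 0)"
proof -
  have "coeff_of (restrict_poly A f) t = (\<Sum>s\<in>Poly_Mapping.keys f \<inter> A.
    if t = s then coeff_of f s else 0)"
    by (simp add: restrict_poly_def lookup_sum lookup_single when_def eq_commute)
  also have "\<dots> = (if t \<in> A then coeff_of f t else 0)" by (auto simp: in_keys_iff)
  finally show ?thesis .
qed

lemma restrict_poly_in: "restrict_poly A f \<in> supported A"
  by (auto simp: supported_def in_keys_iff split: if_splits)

lemma restrict_poly_id: "f \<in> supported A \<Longrightarrow> restrict_poly A f = f"
  by (rule poly_mapping_eqI) (auto simp: supported_def in_keys_iff)

lemma restrict_poly_add: "restrict_poly A (f + g) = restrict_poly A f + restrict_poly A g"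
  by (rule poly_mapping_eqI) (auto simp: lookup_add)

lemma restrict_poly_mscale:
  fixes f :: "('v, 'k::field) mpoly"
  shows "restrict_poly A (mscale c f) = mscale c (restrict_poly A f)"
  by (rule poly_mapping_eqI) auto

lemma restrict_poly_0 [simp]: "restrict_poly A 0 = 0"
  by (rule poly_mapping_eqI) auto

lemma restrict_poly_sum: "restrict_poly A (\<Sum>x\<in>X. h x) = (\<Sum>x\<in>X. restrict_poly A (h x))"
  by (induction X rule: infinite_finite_induct) (auto simp: restrict_poly_add)

lemma linear_restrict_poly:
  "Vector_Spaces.linear mscale mscale (restrict_poly A :: ('v, 'k::field) mpoly \<Rightarrow> _)"
  by unfold_locales (auto simp: restrict_poly_add restrict_poly_mscale)

lemma tdeg_add [simp]: "tdeg (s + t) = tdeg s + tdeg t"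
  by (simp add: tdeg_def lookup_add sum.distrib)

lemma tdeg_0 [simp]: "tdeg 0 = 0"
  by (simp add: tdeg_def)

lemma tdeg_eq_0 [simp]: "tdeg t = 0 \<longleftrightarrow> t = 0"
  by (auto simp: tdeg_def intro: poly_mapping_eqI)

lemma tdeg_tm_of_var [simp]: "tdeg (tm_of_var i) = 1"
  by (simp add: tdeg_def tm_of_var_def lookup_single when_def)

lemma mono_poly_mult: "mono_poly s * mono_poly t = (mono_poly (s + t) :: ('v, 'k::field) mpoly)"
  by (simp add: mono_poly_def mult_single)

lemma mono_poly_0: "mono_poly 0 = (1 :: ('v, 'k::field) mpoly)"
  by (simp add: mono_poly_def)

lemma keys_mult_subset:
  assumes "f \<in> supported A" "g \<in> supported B"
  shows "f * g \<in> supported {a + b |a b. a \<in> A \<and> b \<in> B}"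
  using keys_mult[of f g] assms by (fastforce simp: supported_def)

lemma hom_part_mult:
  assumes "f \<in> hom_part d" "g \<in> hom_part e"
  shows "f * g \<in> hom_part (d + e)"
  using keys_mult_subset[of f "deg_terms d" g "deg_terms e"] assms
  by (force simp: hom_part_eq_supported supported_def deg_terms_def)

lemma mult_mscale_right: "f * mscale c g = mscale c (f * g)"
  by (simp add: mscale_def mult.left_commute)

lemma lookup_mono_poly_mult:
  fixes f :: "('v, 'k::field) mpoly"
  shows "coeff_of (mono_poly t * f) (t + s) = coeff_of f s"
proof -
  have "mono_poly t * f = (\<Sum>u\<in>Poly_Mapping.keys f. mscale (coeff_of f u) (mono_poly (t + u)))"
    by (subst (1) poly_as_sum[of f])
      (simp add: sum_distrib_left mult_mscale_right mono_poly_mult)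
  also have "coeff_of \<dots> (t + s) = (\<Sum>u\<in>Poly_Mapping.keys f. if s = u then coeff_of f u else 0)"
    by (simp add: lookup_sum lookup_mono_poly if_distrib cong: if_cong)
  also have "\<dots> = coeff_of f s" by (simp add: in_keys_iff)
  finally show ?thesis .
qed

lemma keys_mono_poly_mult:
  fixes f :: "('v, 'k::field) mpoly"
  shows "Poly_Mapping.keys (mono_poly t * f) = (+) t ` Poly_Mapping.keys f"
proof
  show "Poly_Mapping.keys (mono_poly t * f) \<subseteq> (+) t ` Poly_Mapping.keys f"
    using keys_mult[of "mono_poly t" f] by (auto simp: mono_poly_def)
  show "(+) t ` Poly_Mapping.keys f \<subseteq> Poly_Mapping.keys (mono_poly t * f)"
    by (auto simp: in_keys_iff lookup_mono_poly_mult)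
qed

lemma poly_mult_as_sum:
  fixes f g :: "('v, 'k::field) mpoly"
  shows "f * g = (\<Sum>t\<in>Poly_Mapping.keys f. mscale (coeff_of f t) (mono_poly t * g))"
  by (subst (1) poly_as_sum[of f]) (simp add: sum_distrib_right mscale_def mult.assoc)

section \<open>Homogeneous components\<close>

abbreviation hcomp :: "nat \<Rightarrow> ('v::finite, 'k::comm_monoid_add) mpoly \<Rightarrow> ('v, 'k) mpoly" where
  "hcomp d \<equiv> restrict_poly (deg_terms d)"

lemma hcomp_in_hom_part [simp]: "hcomp d f \<in> hom_part d"
  by (simp add: hom_part_eq_supported restrict_poly_in)

lemma hcomp_id: "f \<in> hom_part d \<Longrightarrow> hcomp d f = f"
  by (simp add: hom_part_eq_supported restrict_poly_id)

lemma hcomp_other: "f \<in> hom_part e \<Longrightarrow> e \<noteq> d \<Longrightarrow> hcomp d f = 0"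
  by (rule poly_mapping_eqI) (auto simp: hom_part_def deg_terms_def in_keys_iff)

lemma poly_sum_hcomp:
  fixes f :: "('v::finite, 'k::field) mpoly"
  shows "f = (\<Sum>d\<in>tdeg ` Poly_Mapping.keys f. hcomp d f)"
proof (rule poly_mapping_eqI)
  fix t
  have "coeff_of (\<Sum>d\<in>tdeg ` Poly_Mapping.keys f. hcomp d f) t
     = (\<Sum>d\<in>tdeg ` Poly_Mapping.keys f. if tdeg t = d then coeff_of f t else 0)"
    by (simp add: lookup_sum deg_terms_def)
  also have "\<dots> = coeff_of f t" by (auto simp: in_keys_iff image_iff)
  finally show "coeff_of f t = coeff_of (\<Sum>d\<in>tdeg ` Poly_Mapping.keys f. hcomp d f) t" ..
qed

lemma hcomp_mult:
  fixes f g :: "('v::finite, 'k::field) mpoly"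
  assumes "f \<in> hom_part a"
  shows "hcomp (a + d) (f * g) = f * hcomp d g"
proof -
  have *: "hcomp (a + d) (f * hcomp e g) = (if e = d then f * hcomp e g else 0)" for e
    using hom_part_mult[OF assms, of "hcomp e g" e] hcomp_id hcomp_other by fastforce
  have "f * g = (\<Sum>e\<in>tdeg ` Poly_Mapping.keys g. f * hcomp e g)"
    by (subst (1) poly_sum_hcomp) (simp add: sum_distrib_left)
  hence "hcomp (a + d) (f * g) = (\<Sum>e\<in>tdeg ` Poly_Mapping.keys g.
    if e = d then f * hcomp e g else 0)"
    by (simp add: restrict_poly_sum *)
  also have "\<dots> = (if d \<in> tdeg ` Poly_Mapping.keys g then f * hcomp d g else 0)" by simp
  also have "d \<notin> tdeg ` Poly_Mapping.keys g \<Longrightarrow> hcomp d g = 0"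
    by (rule poly_mapping_eqI) (auto simp: deg_terms_def in_keys_iff)
  hence "(if d \<in> tdeg ` Poly_Mapping.keys g then f * hcomp d g else 0) = f * hcomp d g" by auto
  finally show ?thesis .
qed

lemma hcomp_mult_small:
  fixes f g :: "('v::finite, 'k::field) mpoly"
  assumes "f \<in> hom_part a" "d < a"
  shows "hcomp d (f * g) = 0"
proof (rule poly_mapping_eqI)
  fix t
  have "f * g \<in> supported {s + t |s t. s \<in> deg_terms a \<and> t \<in> UNIV}"
    using assms(1) by (intro keys_mult_subset) (auto simp: hom_part_eq_supported supported_def)
  thus "coeff_of (hcomp d (f * g)) t = coeff_of 0 t"
    using assms(2) by (force simp: supported_def deg_terms_def in_keys_iff subset_iff)
qed

section \<open>Counting terms\<close>

lemma tm_of_fun: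
  fixes f :: "'v::finite \<Rightarrow> nat"
  shows "\<exists>t. Poly_Mapping.lookup t = f"
  by (rule exI[of _ "Abs_poly_mapping f"]) simp

text \<open>Listing exponents along an enumeration of the variables reduces the count of terms to
  the known count of lists with given length and sum (\<open>card_length_sum_list\<close>).\<close>

lemma bij_deg_terms:
  assumes xs: "distinct xs" "set xs = (UNIV :: 'v::finite set)"
  shows "bij_betw (\<lambda>t. map (Poly_Mapping.lookup t) xs) (deg_terms d)
    {l::nat list. size l = CARD('v) \<and> sum_list l = d}"
proof (rule bij_betwI')
  have len: "length xs = CARD('v)" using xs distinct_card by fastforce
  have td: "sum_list (map (Poly_Mapping.lookup t) xs) = tdeg t" for t
    using xs by (simp add: tdeg_def sum_list_distinct_conv_sum_set)
  fix s t :: "'v tm"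
  show "(map (Poly_Mapping.lookup s) xs = map (Poly_Mapping.lookup t) xs) = (s = t)"
    using xs(2) by (auto intro: poly_mapping_eqI)
  assume "t \<in> deg_terms d"
  thus "map (Poly_Mapping.lookup t) xs \<in> {l::nat list. size l = CARD('v) \<and> sum_list l = d}"
    using td len by (simp add: deg_terms_def)
next
  have len: "length xs = CARD('v)" using xs distinct_card by fastforce
  have td: "sum_list (map (Poly_Mapping.lookup t) xs) = tdeg t" for t
    using xs by (simp add: tdeg_def sum_list_distinct_conv_sum_set)
  fix l :: "nat list" assume "l \<in> {l. size l = CARD('v) \<and> sum_list l = d}"
  hence l: "length l = length xs" "sum_list l = d" using len by auto
  obtain t where t: "Poly_Mapping.lookup t = (\<lambda>v. the (map_of (zip xs l) v))"
    using tm_of_fun by blast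
  have "map (Poly_Mapping.lookup t) xs = l"
    using l xs(1) by (intro nth_equalityI) (auto simp: t map_of_zip_nth)
  thus "\<exists>t\<in>deg_terms d. l = map (Poly_Mapping.lookup t) xs"
    using td[of t] l by (auto simp: deg_terms_def)
qed

lemma card_deg_terms:
  assumes "CARD('v::finite) = n + 1"
  shows "card (deg_terms d :: 'v tm set) = (n + d) choose n"
proof -
  obtain xs :: "'v list" where "set xs = UNIV" "distinct xs"
    using finite_distinct_list[of "UNIV :: 'v set"] by auto
  from bij_betw_same_card[OF bij_deg_terms[OF this(2,1)]]
  have "card (deg_terms d :: 'v tm set) = (d + CARD('v) - 1) choose d"
    by (simp add: card_length_sum_list)
  thus ?thesis using assms binomial_symmetric[of n "n + d"] by (simp add: add.commute)
qed

text \<open>An infinite set has cardinality 0, whereas the binomial coefficient just computed is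
  positive.\<close>

lemma finite_deg_terms [simp]: "finite (deg_terms d :: 'v::finite tm set)"
proof -
  obtain n where "CARD('v) = n + 1"
    by (metis Suc_eq_plus1 gr0_implies_Suc zero_less_card_finite)
  from card_deg_terms[OF this, of d] show ?thesis
    by (metis card.infinite binomial_eq_0_iff not_add_less1)
qed

lemma dim_hom_part: "mpoly.dim (hom_part d :: ('v::finite, 'k::field) mpoly set) =
  card (deg_terms d :: 'v tm set)"
  by (simp add: hom_part_eq_supported dim_supported)

lemma hom_part_finite_span:
  "\<exists>B. finite B \<and> (hom_part d :: ('v::finite, 'k::field) mpoly set) \<subseteq> mpoly.span B"
  by (rule exI[of _ "mono_poly ` deg_terms d"]) (simp add: span_mono_poly hom_part_eq_supported)

section \<open>Ideals\<close>

lemma ideal_subspace_mpoly: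
  fixes I :: "('v, 'k::field) mpoly set"
  shows "ideal.subspace I \<Longrightarrow> mpoly.subspace I"
  by (rule mpoly.subspaceI)
    (auto simp: mscale_def ideal.subspace_0 ideal.subspace_add ideal.subspace_scale)

text \<open>Multiplication by terms suffices, as every polynomial is a K-combination of
  terms.\<close>

lemma ideal_iff:
  fixes I :: "('v, 'k::field) mpoly set"
  shows "ideal.subspace I \<longleftrightarrow> mpoly.subspace I \<and> (\<forall>f\<in>I. \<forall>t. mono_poly t * f \<in> I)"
proof safe
  assume I: "mpoly.subspace I" "\<forall>f\<in>I. \<forall>t. mono_poly t * f \<in> I"
  show "ideal.subspace I"
  proof (rule ideal.subspaceI)
    show "0 \<in> I" using I mpoly.subspace_0 by blast
    show "x \<in> I \<Longrightarrow> y \<in> I \<Longrightarrow> x + y \<in> I" for x y using I mpoly.subspace_add by blast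
    show "x \<in> I \<Longrightarrow> c * x \<in> I" for c x
      by (subst poly_mult_as_sum) (use I in \<open>auto intro!: mpoly.subspace_sum mpoly.subspace_scale\<close>)
  qed
qed (auto simp: ideal_subspace_mpoly ideal.subspace_scale)

lemma homogeneous_ideal_ideal: "homogeneous_ideal I \<Longrightarrow> ideal.subspace I"
  by (auto simp: homogeneous_ideal_def)

text \<open>The definition only provides homogeneous generators. A component of \<open>c * x\<close>
  with \<open>x\<close> homogeneous is a component of \<open>c\<close> times \<open>x\<close>, or
  zero below the degree of \<open>x\<close>.\<close>

lemma homogeneous_ideal_hcomp:
  fixes I :: "('v::finite, 'k::field) mpoly set"
  assumes "homogeneous_ideal I" "f \<in> I"
  shows "hcomp d f \<in> I"
proof -
  obtain B where B: "B \<subseteq> (\<Union>d. hom_part d)" "I = ideal.span B"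
    using assms(1) by (auto simp: homogeneous_ideal_def)
  have "\<forall>d. hcomp d f \<in> ideal.span B"
    using assms(2) unfolding B(2)
  proof (induction rule: ideal.span_induct_alt)
    case base show ?case by (simp add: ideal.span_zero)
  next
    case (step c x y)
    from step.hyps B(1) obtain e where e: "x \<in> hom_part e" by blast
    show ?case
    proof
      fix d
      have "hcomp d (c * x) \<in> ideal.span B"
      proof (cases "e \<le> d")
        case True
        then obtain k where "d = e + k" using le_Suc_ex by blast
        hence "hcomp d (c * x) = hcomp k c * x"
          using hcomp_mult[OF e, of k c] by (simp add: mult.commute)
        thus ?thesis using step.hyps by (simp add: ideal.span_scale ideal.span_base)
      next
        case False
        hence "hcomp d (c * x) = 0" using hcomp_mult_small[OF e, of d c] by (simp add: mult.commute)
        thus ?thesis by (simp add: ideal.span_zero)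
      qed
      thus "hcomp d (c * x + y) \<in> ideal.span B"
        using step.IH by (simp add: restrict_poly_add ideal.span_add)
    qed
  qed
  thus ?thesis by (simp add: B(2))
qed

lemma homogeneous_idealI:
  fixes I :: "('v::finite, 'k::field) mpoly set"
  assumes "ideal.subspace I" "\<And>f d. f \<in> I \<Longrightarrow> hcomp d f \<in> I"
  shows "homogeneous_ideal I"
proof -
  let ?B = "I \<inter> (\<Union>d. hom_part d)"
  have "I = ideal.span ?B"
  proof
    show "ideal.span ?B \<subseteq> I" by (rule ideal.span_minimal[OF _ assms(1)]) simp
    show "I \<subseteq> ideal.span ?B"
    proof
      fix f assume "f \<in> I"
      hence "hcomp d f \<in> ?B" for d using assms(2) hcomp_in_hom_part by blast
      hence "(\<Sum>d\<in>tdeg ` Poly_Mapping.keys f. hcomp d f) \<in> ideal.span ?B"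
        by (meson ideal.span_sum ideal.span_base)
      thus "f \<in> ideal.span ?B" using poly_sum_hcomp[of f] by simp
    qed
  qed
  thus ?thesis by (auto simp: homogeneous_ideal_def)
qed

section \<open>Graded complexes of free modules\<close>

text \<open>Elements of free modules are total functions instead of vectors of fixed length: one
  type then carries a vector space structure for all ranks, the linear algebra above applies to it,
  and \<open>free_mod l\<close> singles out rank \<open>l\<close>.\<close>

definition fscale :: "'k::field \<Rightarrow> (nat \<Rightarrow> ('v, 'k) mpoly) \<Rightarrow> nat \<Rightarrow> ('v, 'k) mpoly" where
  "fscale c v = (\<lambda>j. mscale c (v j))"

global_interpretation fvec: Vector_Spaces.vector_space
  "fscale :: 'k::field \<Rightarrow> (nat \<Rightarrow> ('v, 'k) mpoly) \<Rightarrow> nat \<Rightarrow> ('v, 'k) mpoly"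
  by unfold_locales
    (auto simp: fscale_def fun_eq_iff mpoly.scale_left_distrib mpoly.scale_right_distrib)

definition free_mod :: "nat \<Rightarrow> (nat \<Rightarrow> ('v, 'k::zero) mpoly) set" where
  "free_mod l = {v. \<forall>j\<ge>l. v j = 0}"

section \<open>Ideals generated by sets of variables, described by their terms\<close>

definition var_ideal :: "'v set \<Rightarrow> ('v, 'k::zero) mpoly set" where
  "var_ideal A = supported {t. \<exists>x\<in>A. 0 < Poly_Mapping.lookup t x}"

lemma var_ideal_empty: "var_ideal {} = {0}"
  by (auto simp: var_ideal_def supported_def)

lemma var_ideal_mono: "A \<subseteq> B \<Longrightarrow> var_ideal A \<subseteq> var_ideal B"
  unfolding var_ideal_def supported_def by blast

lemma var_ideal_ideal: "ideal.subspace (var_ideal A :: ('v, 'k::field) mpoly set)"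
  unfolding ideal_iff
proof (intro conjI ballI allI)
  show "mpoly.subspace (var_ideal A :: ('v, 'k) mpoly set)"
    unfolding var_ideal_def by (rule supported_subspace)
  fix f :: "('v, 'k) mpoly" and t assume "f \<in> var_ideal A"
  hence "\<exists>x\<in>A. 0 < Poly_Mapping.lookup (t + s) x" if "s \<in> Poly_Mapping.keys f" for s
    using that unfolding var_ideal_def supported_def lookup_add
      by (auto simp: subset_iff dest!: spec[of _ s] bspec[of _ _ s])
  thus "mono_poly t * f \<in> var_ideal A"
    by (auto simp: var_ideal_def supported_def keys_mono_poly_mult)
qed

text \<open>A variable outside \<open>A\<close> is a non-zero-divisor modulo the ideal of
  \<open>A\<close>: multiplying a term by it changes no exponent at \<open>A\<close>.\<close>

lemma var_ideal_cancel:
  fixes f :: "('v, 'k::field) mpoly"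
  assumes "mono_poly (tm_of_var x) * f \<in> var_ideal A" "x \<notin> A"
  shows "f \<in> var_ideal A"
proof -
  have "\<exists>y\<in>A. 0 < Poly_Mapping.lookup t y" if "t \<in> Poly_Mapping.keys f" for t
  proof -
    have "tm_of_var x + t \<in> Poly_Mapping.keys (mono_poly (tm_of_var x) * f)"
      using that by (simp add: keys_mono_poly_mult)
    then obtain y where "y \<in> A" "0 < Poly_Mapping.lookup (tm_of_var x + t) y"
      using assms(1) unfolding var_ideal_def supported_def by blast
    thus ?thesis using assms(2)
      by (auto simp: lookup_add tm_of_var_def lookup_single when_def split: if_splits)
  qed
  thus ?thesis by (auto simp: var_ideal_def supported_def)
qed

lemma tm_of_var_diff:
  assumes "0 < Poly_Mapping.lookup t x"
  shows "tm_of_var x + (t - tm_of_var x) = t"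
  using assms by (intro poly_mapping_eqI)
    (auto simp: lookup_add lookup_minus tm_of_var_def lookup_single when_def)

text \<open>The terms of \<open>f\<close> outside the ideal of \<open>A\<close> are all divisible by
  \<open>x\<close>. Dividing them by \<open>x\<close> gives \<open>w\<close>, and the remaining
  terms form \<open>a\<close>.\<close>

lemma var_ideal_insert:
  fixes f :: "('v, 'k::field) mpoly"
  assumes "f \<in> var_ideal (insert x A)"
  shows "\<exists>w a. a \<in> var_ideal A \<and> f = mono_poly (tm_of_var x) * w + a"
proof -
  let ?T = "{t. \<exists>y\<in>A. 0 < Poly_Mapping.lookup t y}"
  let ?K = "Poly_Mapping.keys f - ?T"
  define w where "w = (\<Sum>t\<in>?K. mscale (coeff_of f t) (mono_poly (t - tm_of_var x)))"
  have "t \<in> ?K \<Longrightarrow> tm_of_var x + (t - tm_of_var x) = t" for t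
    using assms by (intro tm_of_var_diff) (auto simp: var_ideal_def supported_def)
  hence "mono_poly (tm_of_var x) * w = (\<Sum>t\<in>?K. mscale (coeff_of f t) (mono_poly t))"
    unfolding w_def by (simp add: sum_distrib_left mult_mscale_right mono_poly_mult)
  moreover have "f = (\<Sum>t\<in>?K. mscale (coeff_of f t) (mono_poly t)) + restrict_poly ?T f"
    by (rule poly_mapping_eqI)
      (auto simp: lookup_add lookup_sum lookup_mono_poly if_distrib in_keys_iff cong: if_cong)
  moreover have "restrict_poly ?T f \<in> var_ideal A" unfolding var_ideal_def
    by (rule restrict_poly_in)
  ultimately have "restrict_poly ?T f \<in> var_ideal A \<and> f =
    mono_poly (tm_of_var x) * w + restrict_poly ?T f"
    by simp
  thus ?thesis by (intro exI)
qed

text \<open>For all variables this is the irrelevant ideal, so minimality of a resolution says that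
  the matrix entries lie in it.\<close>

lemma var_ideal_UNIV: "f \<in> var_ideal UNIV \<longleftrightarrow> coeff_of f 0 = 0"
proof -
  have "(\<exists>x. 0 < Poly_Mapping.lookup t x) \<longleftrightarrow> t \<noteq> 0" for t :: "'a tm"
    by (metis lookup_zero poly_mapping_eqI gr0I less_irrefl)
  thus ?thesis by (auto simp: var_ideal_def in_supported_iff)
qed

text \<open>Degree \<open>t\<close> of the direct sum of the S(-e) for \<open>e\<close> in
  \<open>bl\<close>. Writing the condition as a sum avoids truncated subtraction: a shift above
  \<open>t\<close> leaves no terms. The test \<open>j < length bl\<close> forces zero beyond the
  rank.\<close>

definition graded_piece :: "nat list \<Rightarrow> nat \<Rightarrow> (nat \<Rightarrow> ('v::finite, 'k::field) mpoly) set" where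
  "graded_piece bl t = {v. \<forall>j. v j \<in> supported {s. j < length bl \<and> tdeg s + bl ! j = t}}"

definition graded_comp :: "nat list \<Rightarrow> nat \<Rightarrow> (nat \<Rightarrow> ('v::finite, 'k::field) mpoly) \<Rightarrow> nat \<Rightarrow> ('v, 'k) mpoly" where
  "graded_comp bl t v = (\<lambda>j. restrict_poly {s. j < length bl \<and> tdeg s + bl ! j = t} (v j))"

lemma graded_comp_in: "graded_comp bl t v \<in> graded_piece bl t"
  by (simp add: graded_comp_def graded_piece_def restrict_poly_in)

lemma graded_comp_id: "v \<in> graded_piece bl t \<Longrightarrow> graded_comp bl t v = v"
  by (simp add: graded_comp_def graded_piece_def restrict_poly_id)

lemma graded_piece_subset: "graded_piece bl t \<subseteq> free_mod (length bl)"
proof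
  fix v :: "nat \<Rightarrow> ('a, 'b) mpoly" assume v: "v \<in> graded_piece bl t"
  have "v j = 0" if "length bl \<le> j" for j
    using v that by (intro poly_mapping_eqI) (auto simp: graded_piece_def in_supported_iff)
  thus "v \<in> free_mod (length bl)" by (simp add: free_mod_def)
qed

lemma graded_piece_subspace: "fvec.subspace (graded_piece bl t)"
  by (rule fvec.subspaceI)
    (auto simp: graded_piece_def fscale_def intro: mpoly.subspace_0 mpoly.subspace_add
      mpoly.subspace_scale supported_subspace)

definition unit_term :: "nat \<times> 'v tm \<Rightarrow> nat \<Rightarrow> ('v, 'k::field) mpoly" where
  "unit_term x = (\<lambda>j. if j = fst x then mono_poly (snd x) else 0)"

lemma lookup_unit_term: "coeff_of (unit_term x j) s = (if x = (j, s) then 1 else 0)"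
  by (cases x) (auto simp: unit_term_def lookup_mono_poly)

lemma sum_fun_apply: "(\<Sum>x\<in>X. f x) j = (\<Sum>x\<in>X. f x j)"
  by (induction X rule: infinite_finite_induct) auto

lemma inj_unit_term: "inj (unit_term :: nat \<times> 'v tm \<Rightarrow> nat \<Rightarrow> ('v, 'k::field) mpoly)"
proof (rule injI)
  fix x y :: "nat \<times> 'v tm"
  assume "unit_term x = (unit_term y :: nat \<Rightarrow> ('v, 'k) mpoly)"
  hence "coeff_of (unit_term x (fst y) :: ('v, 'k) mpoly) (snd y) = 1"
    by (simp add: lookup_unit_term)
  thus "x = y" by (auto simp: lookup_unit_term split: if_splits)
qed

definition piece_index :: "nat list \<Rightarrow> nat \<Rightarrow> (nat \<times> 'v::finite tm) set" where
  "piece_index bl t = (SIGMA j:{..<length bl}. {s. tdeg s + bl ! j = t})"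

lemma finite_shifted_terms [simp]: "finite {s :: 'v::finite tm. tdeg s + e = t}"
proof (rule finite_subset)
  show "{s :: 'v tm. tdeg s + e = t} \<subseteq> deg_terms (t - e)" by (auto simp: deg_terms_def)
qed simp

lemma finite_piece_index [simp]: "finite (piece_index bl t)"
  unfolding piece_index_def by auto

lemma card_piece_index:
  "card (piece_index bl t :: (nat \<times> 'v::finite tm) set) =
    (\<Sum>e\<leftarrow>bl. card {s :: 'v tm. tdeg s + e = t})"
  unfolding piece_index_def by (simp add: sum_list_sum_nth atLeast0LessThan)

lemma graded_piece_span:
  "graded_piece bl t = fvec.span (unit_term ` piece_index bl t :: (nat \<Rightarrow> ('v::finite, 'k::field) mpoly) set)"
proof
  show "fvec.span (unit_term ` piece_index bl t) \<subseteq> (graded_piece bl t :: (nat \<Rightarrow> ('v, 'k) mpoly) set)"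
    by (rule fvec.span_minimal[OF _ graded_piece_subspace])
      (auto simp: graded_piece_def in_supported_iff lookup_unit_term piece_index_def)
  show "graded_piece bl t \<subseteq> fvec.span (unit_term ` piece_index bl t :: (nat \<Rightarrow> ('v, 'k) mpoly) set)"
  proof
    fix v :: "nat \<Rightarrow> ('v, 'k) mpoly" assume v: "v \<in> graded_piece bl t"
    have "v = (\<Sum>x\<in>piece_index bl t. fscale (coeff_of (v (fst x)) (snd x)) (unit_term x))"
    proof (intro ext poly_mapping_eqI)
      fix j s
      have "coeff_of ((\<Sum>x\<in>piece_index bl t. fscale (coeff_of (v (fst x)) (snd x)) (unit_term x)) j) s
        = (\<Sum>x\<in>piece_index bl t. if x = (j, s) then coeff_of (v (fst x)) (snd x) else 0)"
        by (simp add: sum_fun_apply lookup_sum fscale_def lookup_unit_term if_distrib cong: if_cong)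
      also have "\<dots> = (if (j, s) \<in> piece_index bl t then coeff_of (v j) s else 0)" by simp
      also have "\<dots> = coeff_of (v j) s"
        using v by (auto simp: graded_piece_def in_supported_iff piece_index_def)
      finally show "coeff_of (v j) s =
        coeff_of ((\<Sum>x\<in>piece_index bl t. fscale (coeff_of (v (fst x)) (snd x)) (unit_term x)) j) s" ..
    qed
    also have "\<dots> \<in> fvec.span (unit_term ` piece_index bl t)"
      by (rule fvec.span_sum, rule fvec.span_scale, rule fvec.span_base) simp
    finally show "v \<in> fvec.span (unit_term ` piece_index bl t)" .
  qed
qed

lemma dim_graded_piece:
  "fvec.dim (graded_piece bl t :: (nat \<Rightarrow> ('v::finite, 'k::field) mpoly) set)
    = (\<Sum>e\<leftarrow>bl. card {s :: 'v tm. tdeg s + e = t})"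
proof -
  have "fvec.independent (unit_term ` piece_index bl t :: (nat \<Rightarrow> ('v, 'k) mpoly) set)"
  proof (rule fvec.independent_if_scalars_zero)
    fix g :: "(nat \<Rightarrow> ('v, 'k) mpoly) \<Rightarrow> 'k" and x :: "nat \<Rightarrow> ('v, 'k) mpoly"
    assume z: "(\<Sum>x\<in>unit_term ` piece_index bl t. fscale (g x) x) = 0"
      and "x \<in> unit_term ` piece_index bl t"
    then obtain y where y: "y \<in> piece_index bl t" "x = unit_term y" by blast
    have "0 = coeff_of ((\<Sum>x\<in>unit_term ` piece_index bl t. fscale (g x) x) (fst y)) (snd y)"
      using z by simp
    also have "\<dots> = coeff_of ((\<Sum>z\<in>piece_index bl t. fscale (g (unit_term z)) (unit_term z)) (fst y)) (snd y)"
      by (subst sum.reindex) (auto intro: inj_on_subset[OF inj_unit_term])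
    also have "\<dots> = (\<Sum>z\<in>piece_index bl t. if z = y then g (unit_term z) else 0)"
      by (simp add: sum_fun_apply lookup_sum fscale_def lookup_unit_term if_distrib cong: if_cong)
    also have "\<dots> = g x" using y by simp
    finally show "g x = 0" ..
  qed simp
  hence "fvec.dim (graded_piece bl t :: (nat \<Rightarrow> ('v, 'k) mpoly) set)
    = card (unit_term ` piece_index bl t :: (nat \<Rightarrow> ('v, 'k) mpoly) set)"
    unfolding graded_piece_span by (rule fvec.dim_span_eq_card_independent)
  also have "\<dots> = card (piece_index bl t :: (nat \<times> 'v tm) set)"
    by (rule card_image) (rule inj_on_subset[OF inj_unit_term], simp)
  finally show ?thesis by (simp add: card_piece_index)
qed

text \<open>\<open>G\<^sub>i\<close> is the free module with generators in the degrees \<open>b i\<close>, \<open>bd i : G\<^sub>i\<^sub>+\<^sub>1 \<rightarrow> G\<^sub>i\<close> has the matrix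
  \<open>d i\<close>, and the complex is exact except at \<open>G\<^sub>0\<close>.\<close>

locale graded_complex =
  fixes b :: "nat \<Rightarrow> nat list" and d :: "nat \<Rightarrow> nat \<Rightarrow> nat \<Rightarrow> ('v::finite, 'k::field) mpoly"
    and bd :: "nat \<Rightarrow> (nat \<Rightarrow> ('v, 'k) mpoly) \<Rightarrow> nat \<Rightarrow> ('v, 'k) mpoly"
  assumes bd_def: "\<And>i v. bd i v = (\<lambda>j.
    if j < length (b i) then \<Sum>k<length (b (Suc i)). d i j k * v k else 0)"
    and degrees: "\<And>i j k t. j < length (b i) \<Longrightarrow> k < length (b (Suc i)) \<Longrightarrow>
      t \<in> Poly_Mapping.keys (d i j k) \<Longrightarrow> tdeg t + b i ! j = b (Suc i) ! k"
    and minimal: "\<And>i j k. j < length (b (Suc i)) \<Longrightarrow> k < length (b (Suc (Suc i))) \<Longrightarrow>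
      coeff_of (d (Suc i) j k) 0 = 0"
    and complex: "\<And>i w. w \<in> free_mod (length (b (Suc (Suc i)))) \<Longrightarrow> bd i (bd (Suc i) w) = 0"
    and exact: "\<And>i v. v \<in> free_mod (length (b (Suc i))) \<Longrightarrow> bd i v = 0 \<Longrightarrow>
      \<exists>w \<in> free_mod (length (b (Suc (Suc i)))). v = bd (Suc i) w"
begin

lemma diff_add: "bd i (v + w) = bd i v + bd i w"
  by (auto simp: bd_def fun_eq_iff sum.distrib distrib_left)

lemma diff_mult: "bd i (\<lambda>k. f * v k) = (\<lambda>j. f * bd i v j)"
  by (auto simp: bd_def fun_eq_iff sum_distrib_left mult.left_commute)

lemma diff_scale: "bd i (fscale c v) = fscale c (bd i v)"
  unfolding fscale_def mscale_def by (rule diff_mult)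

lemma diff_minus: "bd i (v - w) = bd i v - bd i w"
  by (auto simp: bd_def fun_eq_iff sum_subtractf right_diff_distrib)

lemma diff_free: "bd i v \<in> free_mod (length (b i))"
  by (simp add: bd_def free_mod_def)

lemma diff_var_ideal: "(\<And>k. v k \<in> var_ideal A) \<Longrightarrow> bd i v j \<in> var_ideal A"
  unfolding bd_def
  by (auto intro!: ideal.subspace_sum ideal.subspace_scale ideal.subspace_0 var_ideal_ideal)

lemma linear_diff: "Vector_Spaces.linear fscale fscale (bd i)"
  by unfold_locales (auto simp: diff_add diff_scale)

text \<open>Modulo a set \<open>A\<close> of variables the complex stays exact from position \<open>|A| + 1\<close> on, since each
  further variable is a non-zero-divisor on the free modules.\<close>

lemma exact_mod_variables:
  assumes "finite A" "card A \<le> i" "v \<in> free_mod (length (b (Suc i)))" "\<And>j. bd i v j \<in> var_ideal A"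
  shows "\<exists>z \<in> free_mod (length (b (Suc (Suc i)))). \<forall>j. v j - bd (Suc i) z j \<in> var_ideal A"
  using assms
proof (induction A arbitrary: i v rule: finite_induct)
  case empty
  hence "bd i v = 0" by (auto simp: var_ideal_empty)
  with exact[OF empty(2)] show ?case by (auto simp: var_ideal_empty)
next
  case (insert x A)
  let ?X = "mono_poly (tm_of_var x) :: ('v, 'k) mpoly"
  have ideal: "ideal.subspace (var_ideal A :: ('v, 'k) mpoly set)" by (rule var_ideal_ideal)
  \<comment> \<open>The induction hypothesis is used twice, at \<open>i'\<close> to lift
    \<open>w\<close> and at \<open>i\<close> to lift \<open>v'\<close>. The step down to
    \<open>i'\<close> is the price of one more variable, whence the bound
    \<open>card A \<le> i\<close>.\<close>
  obtain i' where i: "i = Suc i'" "card A \<le> i'"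
    using insert.prems(1) insert.hyps by (cases i) auto
  have "\<forall>j. \<exists>w a. a \<in> var_ideal A \<and> bd i v j = ?X * w + a"
    using insert.prems(3) by (intro allI var_ideal_insert)
  then obtain w' a' where wa': "\<And>j. a' j \<in> var_ideal A" "\<And>j. bd i v j = ?X * w' j + a' j"
    by metis
  \<comment> \<open>The decomposition is arbitrary beyond the rank; cutting it off there makes
    \<open>w\<close> an element of the free module.\<close>
  define w where "w = (\<lambda>j. if j < length (b i) then w' j else 0)"
  define a where "a = (\<lambda>j. if j < length (b i) then a' j else 0)"
  have wa: "bd i v = (\<lambda>j. ?X * w j) + a"
    using wa'(2) diff_free[of i v] by (auto simp: fun_eq_iff w_def a_def free_mod_def)
  have a: "a j \<in> var_ideal A" for j
    using wa'(1) ideal.subspace_0[OF ideal] by (simp add: a_def)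
  have wf: "w \<in> free_mod (length (b i))" by (simp add: w_def free_mod_def)
  \<comment> \<open>Applying the differential once more gives
    \<open>?X * bd i' w = - bd i' a\<close>. The right side lies in the ideal of \<open>A\<close>,
    and \<open>?X\<close> cancels modulo it, so \<open>w\<close> is a cycle modulo
    \<open>A\<close>.\<close>
  have "bd i' (bd i v) = 0" unfolding i by (rule complex) (use insert.prems i in simp)
  hence "?X * bd i' w j = - bd i' a j" for j
    unfolding wa diff_add diff_mult by (auto simp: fun_eq_iff eq_neg_iff_add_eq_0)
  moreover have "- bd i' a j \<in> var_ideal A" for j
    by (rule ideal.subspace_neg[OF ideal]) (rule diff_var_ideal, rule a)
  ultimately have "bd i' w j \<in> var_ideal A" for j
    using var_ideal_cancel insert.hyps(2) by metis
  from insert.IH[OF i(2) _ this] wf obtain u where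
    u: "u \<in> free_mod (length (b (Suc i)))" "\<And>j. w j - bd i u j \<in> var_ideal A"
    unfolding i by blast
  \<comment> \<open>Since \<open>w\<close> is the boundary of \<open>u\<close> modulo
    \<open>A\<close>, subtracting \<open>?X * u\<close> removes the multiple of \<open>?X\<close>
    from \<open>bd i v\<close>, and \<open>v'\<close> still equals \<open>v\<close> modulo
    \<open>x\<close>.\<close>
  define v' where "v' = v - (\<lambda>j. ?X * u j)"
  have "bd i v' j \<in> var_ideal A" for j
  proof -
    have "bd i v' j = ?X * (w j - bd i u j) + a j"
      by (simp add: v'_def diff_minus diff_mult wa right_diff_distrib)
    thus ?thesis using ideal.subspace_add[OF ideal] ideal.subspace_scale[OF ideal] u(2) a by metis
  qed
  moreover have "v' \<in> free_mod (length (b (Suc i)))"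
    using u(1) insert.prems(2) by (simp add: v'_def free_mod_def)
  ultimately obtain z where z: "z \<in> free_mod (length (b (Suc (Suc i))))"
      "\<And>j. v' j - bd (Suc i) z j \<in> var_ideal A"
    using insert.IH[of i v'] i by auto
  have "v j - bd (Suc i) z j \<in> var_ideal (insert x A)" for j
  proof -
    have ideal': "ideal.subspace (var_ideal (insert x A) :: ('v, 'k) mpoly set)"
      by (rule var_ideal_ideal)
    have "?X \<in> var_ideal (insert x A)"
      by (auto simp: var_ideal_def tm_of_var_def)
    hence "u j * ?X \<in> var_ideal (insert x A)" using ideal.subspace_scale[OF ideal'] by blast
    moreover have "v' j - bd (Suc i) z j \<in> var_ideal (insert x A)"
      using z(2) var_ideal_mono[of A "insert x A"] by blast
    ultimately have "u j * ?X + (v' j - bd (Suc i) z j) \<in> var_ideal (insert x A)"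
      by (rule ideal.subspace_add[OF ideal'])
    thus ?thesis by (simp add: v'_def algebra_simps)
  qed
  with z(1) show ?case by blast
qed

text \<open>Were there a generator at position \<open>i + 1\<close>, its unit vector would be a
  cycle modulo the irrelevant ideal, where minimality puts all entries. Exactness modulo all
  variables makes it a boundary, whose components lie in that ideal again, and so would 1. In the
  augmented numbering used below this says that F_i is zero for i > n.\<close>

theorem syzygy_theorem:
  assumes "CARD('v) \<le> i"
  shows "b (Suc i) = []"
proof (rule ccontr)
  assume ne: "b (Suc i) \<noteq> []"
  define v :: "nat \<Rightarrow> ('v, 'k) mpoly" where "v = (\<lambda>k. if k = 0 then 1 else 0)"
  obtain i' where i: "i = Suc i'" using assms by (cases i) auto
  have "bd i v j \<in> var_ideal UNIV" for j
    using ne minimal[of j i' 0] unfolding var_ideal_UNIV bd_def v_def i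
    by (auto simp: if_distrib cong: if_cong)
  moreover have "v \<in> free_mod (length (b (Suc i)))"
    using ne by (auto simp: free_mod_def v_def)
  ultimately obtain z where z: "v 0 - bd (Suc i) z 0 \<in> var_ideal UNIV"
    using exact_mod_variables[of UNIV i v] assms by auto
  have "bd (Suc i) z 0 \<in> var_ideal UNIV"
    using minimal unfolding bd_def
    by (auto intro!: ideal.subspace_sum[OF var_ideal_ideal] ideal.subspace_0[OF var_ideal_ideal]
      ideal.subspace_scale[OF var_ideal_ideal] simp: mult.commute[of "d _ _ _"] var_ideal_UNIV[symmetric])
  hence "v 0 - bd (Suc i) z 0 + bd (Suc i) z 0 \<in> var_ideal UNIV"
    using z ideal.subspace_add[OF var_ideal_ideal] by blast
  thus False by (simp add: v_def var_ideal_UNIV)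
qed

text \<open>A non-zero entry is homogeneous of degree \<open>b (Suc i) ! k - b i ! j\<close>, so it
  carries degree \<open>t\<close> of one shifted copy of S to degree \<open>t\<close> of the other.
  The cases with \<open>t\<close> below a shift concern parts that are zero.\<close>

lemma entry_graded_comp:
  assumes "j < length (b i)" "k < length (b (Suc i))"
  shows "d i j k * restrict_poly {s. tdeg s + b (Suc i) ! k = t} f =
    restrict_poly {s. tdeg s + b i ! j = t} (d i j k * f)"
proof (cases "d i j k = 0")
  case False
  then obtain u where u: "u \<in> Poly_Mapping.keys (d i j k)" by (metis all_not_in_conv keys_eq_empty)
  define e where "e = tdeg u"
  have e: "e + b i ! j = b (Suc i) ! k" using degrees[OF assms u] by (simp add: e_def)
  have hd: "d i j k \<in> hom_part e" using degrees[OF assms] e by (force simp: hom_part_def)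
  show ?thesis
  proof (cases "b (Suc i) ! k \<le> t")
    case True
    then obtain m where m: "t = b (Suc i) ! k + m" using le_Suc_ex by blast
    have "{s :: 'v tm. tdeg s + b (Suc i) ! k = t} = deg_terms m"
      and "{s :: 'v tm. tdeg s + b i ! j = t} = deg_terms (e + m)"
      using e m by (auto simp: deg_terms_def)
    thus ?thesis using hcomp_mult[OF hd, of m f] by simp
  next
    case False
    have "{s::'v tm. tdeg s + b (Suc i) ! k = t} = {}" using False by auto
    moreover have "restrict_poly {} f = 0" by (rule poly_mapping_eqI) simp
    moreover have "restrict_poly {s. tdeg s + b i ! j = t} (d i j k * f) = 0"
    proof (cases "b i ! j \<le> t")
      case True
      hence "{s::'v tm. tdeg s + b i ! j = t} = deg_terms (t - b i ! j)"
        by (auto simp: deg_terms_def)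
      thus ?thesis using hcomp_mult_small[OF hd, of "t - b i ! j" f] e False True by simp
    next
      case False
      hence "{s::'v tm. tdeg s + b i ! j = t} = {}" by auto
      thus ?thesis by (metis lookup_restrict_poly empty_iff lookup_zero poly_mapping_eqI)
    qed
    ultimately show ?thesis by simp
  qed
qed simp

lemma diff_graded_comp: "bd i (graded_comp (b (Suc i)) t v) = graded_comp (b i) t (bd i v)"
proof
  fix j
  show "bd i (graded_comp (b (Suc i)) t v) j = graded_comp (b i) t (bd i v) j"
  proof (cases "j < length (b i)")
    case True
    hence "bd i (graded_comp (b (Suc i)) t v) j =
        (\<Sum>k<length (b (Suc i)). d i j k * restrict_poly {s. tdeg s + b (Suc i) ! k = t} (v k))"
      by (simp add: bd_def graded_comp_def)
    also have "\<dots> = (\<Sum>k<length (b (Suc i)). restrict_poly {s. tdeg s + b i ! j = t} (d i j k * v k))"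
      using True by (intro sum.cong) (auto simp: entry_graded_comp)
    also have "\<dots> = graded_comp (b i) t (bd i v) j"
      using True by (simp add: bd_def graded_comp_def restrict_poly_sum)
    finally show ?thesis .
  qed (simp add: bd_def graded_comp_def)
qed

definition image_dim :: "nat \<Rightarrow> nat \<Rightarrow> nat" where
  "image_dim i t = fvec.dim (bd i ` graded_piece (b (Suc i)) t)"

text \<open>Rank and nullity of \<open>bd i\<close> in degree \<open>t\<close>, where exactness
  identifies the kernel with the image of the next differential.\<close>

lemma dim_piece_Suc:
  "fvec.dim (graded_piece (b (Suc i)) t :: (nat \<Rightarrow> ('v, 'k) mpoly) set) =
    image_dim (Suc i) t + image_dim i t"
proof -
  interpret lin: Vector_Spaces.linear fscale fscale "bd i" by (rule linear_diff)
  let ?G = "\<lambda>i. graded_piece (b i) t :: (nat \<Rightarrow> ('v, 'k) mpoly) set"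
  have "{x \<in> ?G (Suc i). bd i x = 0} = bd (Suc i) ` ?G (Suc (Suc i))"
  proof (intro equalityI subsetI)
    fix x assume "x \<in> {x \<in> ?G (Suc i). bd i x = 0}"
    hence x: "x \<in> ?G (Suc i)" "bd i x = 0" by auto
    then obtain w where w: "x = bd (Suc i) w"
      using exact graded_piece_subset by blast
    \<comment> \<open>The preimage given by exactness need not be homogeneous; its component of
      degree \<open>t\<close> is mapped to \<open>x\<close> as well.\<close>
    have "x = bd (Suc i) (graded_comp (b (Suc (Suc i))) t w)"
      using graded_comp_id[OF x(1)] unfolding diff_graded_comp w by simp
    thus "x \<in> bd (Suc i) ` ?G (Suc (Suc i))" using graded_comp_in by blast
  next
    fix x assume "x \<in> bd (Suc i) ` ?G (Suc (Suc i))"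
    then obtain w where w: "w \<in> ?G (Suc (Suc i))" "x = bd (Suc i) w" by blast
    have "x = graded_comp (b (Suc i)) t x"
      using graded_comp_id[OF w(1)] diff_graded_comp[of "Suc i" t w] w(2) by simp
    hence "x \<in> ?G (Suc i)" using graded_comp_in by metis
    moreover have "bd i x = 0" using complex w graded_piece_subset by blast
    ultimately show "x \<in> {x \<in> ?G (Suc i). bd i x = 0}" by simp
  qed
  thus ?thesis
    using lin.rank_nullity[OF graded_piece_subspace, of "b (Suc i)" t "unit_term ` piece_index (b (Suc i)) t"]
    by (simp add: graded_piece_span image_dim_def)
qed

text \<open>Iterating \<open>dim_piece_Suc\<close> leaves the remainder \<open>image_dim N t\<close>
  after \<open>N\<close> steps. For \<open>N = CARD('v)\<close> it is zero, since the source module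
  is zero by \<open>syzygy_theorem\<close>.\<close>

lemma image_dim_0:
  "int (image_dim 0 t) =
    (\<Sum>i<CARD('v). (-1) ^ i * int (\<Sum>e\<leftarrow>b (Suc i). card {s :: 'v tm. tdeg s + e = t}))"
proof -
  have *: "int (image_dim 0 t) = (\<Sum>i<N. (-1) ^ i * int (\<Sum>e\<leftarrow>b (Suc i). card {s :: 'v tm. tdeg s + e =
    t}))
    + (-1) ^ N * int (image_dim N t)" for N
    unfolding dim_graded_piece[symmetric, where 'k = 'k]
    by (induction N) (auto simp: dim_piece_Suc algebra_simps)
  have "image_dim (CARD('v)) t = 0"
  proof -
    have "graded_piece [] t = {0 :: nat \<Rightarrow> ('v, 'k) mpoly}"
      by (auto simp: graded_piece_def supported_def fun_eq_iff)
    hence "bd (CARD('v)) ` graded_piece (b (Suc (CARD('v)))) t \<subseteq> fvec.span {}"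
      using syzygy_theorem[of "CARD('v)"] by (auto simp: bd_def fun_eq_iff)
    from fvec.dim_le_card[OF this] show ?thesis unfolding image_dim_def by simp
  qed
  thus ?thesis using *[of "CARD('v)"] by simp
qed

end

section \<open>Consequences of regularity\<close>

text \<open>The Hilbert polynomial of \<open>S(-e)\<close> in \<open>n + 1\<close> variables.\<close>

definition shifted_binomial_poly :: "nat \<Rightarrow> nat \<Rightarrow> rat poly" where
  "shifted_binomial_poly n e = Polynomial.smult (inverse (fact n))
     (\<Prod>l<n. [:of_nat n - of_nat e - of_nat l, 1:])"

text \<open>The range reaches beyond \<open>e \<le> t\<close>: for \<open>t < e \<le> t + n\<close>
  one of the \<open>n\<close> factors is zero, and so is the binomial coefficient.\<close>

lemma poly_shifted_binomial_poly:
  assumes "e \<le> t + n"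
  shows "poly (shifted_binomial_poly n e) (of_nat t) = of_nat ((n + t - e) choose n)"
proof -
  have "poly (shifted_binomial_poly n e) (of_nat t) =
      (\<Prod>l<n. of_nat n - of_nat e - of_nat l + of_nat t) / (fact n :: rat)"
    by (simp add: shifted_binomial_poly_def poly_prod field_simps)
  also have "\<dots> = (\<Prod>l<n. of_nat (n + t - e) - of_nat l) / (fact n :: rat)"
    using assms by (intro arg_cong2[where f = "(/)"] prod.cong)
      (auto simp: of_nat_diff algebra_simps)
  also have "\<dots> = of_nat (n + t - e) gchoose n"
    by (simp add: gbinomial_prod_rev atLeast0LessThan)
  also have "\<dots> = of_nat ((n + t - e) choose n)" by (simp add: binomial_gbinomial)
  finally show ?thesis .
qed

lemma of_nat_sum_list_map: "of_nat (\<Sum>x\<leftarrow>xs. f x) = (\<Sum>x\<leftarrow>xs. of_nat (f x))"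
  by (induction xs) auto

lemma of_int_sum_list_map: "of_int (\<Sum>x\<leftarrow>xs. f x) = (\<Sum>x\<leftarrow>xs. of_int (f x))"
  by (induction xs) auto

lemma poly_sum_list_map: "poly (\<Sum>x\<leftarrow>xs. f x) y = (\<Sum>x\<leftarrow>xs. poly (f x) y)"
  by (induction xs) auto

lemma card_shifted_terms:
  assumes "CARD('v::finite) = n + 1" "e \<le> t + n"
  shows "of_nat (card {s :: 'v tm. tdeg s + e = t}) = poly (shifted_binomial_poly n e) (of_nat t)"
proof (cases "e \<le> t")
  case True
  hence "{s :: 'v tm. tdeg s + e = t} = deg_terms (t - e)" by (auto simp: deg_terms_def)
  thus ?thesis using True card_deg_terms[OF assms(1), of "t - e"] poly_shifted_binomial_poly[OF assms(2)]
    by simp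
next
  case False
  hence "{s :: 'v tm. tdeg s + e = t} = {}" by auto
  moreover have "(n + t - e) choose n = 0" using False assms by simp
  ultimately show ?thesis using poly_shifted_binomial_poly[OF assms(2)] by simp
qed

lemma poly_eq_if_eventually_eq:
  fixes P Q :: "rat poly"
  assumes "\<forall>\<^sub>F t in sequentially. poly P (of_nat t) = poly Q (of_nat t)"
  shows "P = Q"
proof (rule ccontr)
  assume "P \<noteq> Q"
  hence fin: "finite {x. poly (P - Q) x = 0}" by (intro poly_roots_finite) simp
  obtain N where N: "\<And>t. t \<ge> N \<Longrightarrow> poly P (of_nat t) = poly Q (of_nat t)"
    using assms by (auto simp: eventually_sequentially)
  have "of_nat ` {N..} \<subseteq> {x. poly (P - Q) x = 0}" using N by auto
  hence "finite ((of_nat :: nat \<Rightarrow> rat) ` {N..})" using fin finite_subset by blast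
  hence "finite {N..}" by (rule finite_imageD) simp
  thus False by (simp add: infinite_Ici)
qed

lemma tm_split:
  assumes "k \<le> tdeg t"
  shows "\<exists>s u. t = s + u \<and> tdeg s = k"
  using assms
proof (induction k)
  case 0
  show ?case by (intro exI[of _ 0] exI[of _ t]) simp
next
  case (Suc k)
  then obtain s u where su: "t = s + u" "tdeg s = k" by auto
  hence "u \<noteq> 0" using Suc.prems by auto
  then obtain x where "Poly_Mapping.lookup u x \<noteq> 0" by (metis lookup_zero poly_mapping_eqI)
  hence "tm_of_var x + (u - tm_of_var x) = u" by (intro tm_of_var_diff) simp
  hence "t = (s + tm_of_var x) + (u - tm_of_var x)" by (simp add: su(1) add.assoc)
  moreover have "tdeg (s + tm_of_var x) = Suc k" using su(2) by simp
  ultimately show ?case by blast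
qed

locale minimal_resolution =
  fixes I :: "('v::finite, 'k::field) mpoly set"
    and a :: "nat \<Rightarrow> nat list" and \<epsilon> :: "('v, 'k) mpoly vec" and D :: "nat \<Rightarrow> ('v, 'k) mpoly mat"
  assumes resolution: "minimal_graded_free_resolution I a \<epsilon> D"
begin

text \<open>The augmentation \<open>\<epsilon>\<close> becomes the first differential: position \<open>0\<close> holds \<open>S\<close>, position \<open>i + 1\<close>
  holds \<open>F\<^sub>i\<close>.\<close>

definition shifts :: "nat \<Rightarrow> nat list" where
  "shifts i = (case i of 0 \<Rightarrow> [0] | Suc i' \<Rightarrow> a i')"

definition entries :: "nat \<Rightarrow> nat \<Rightarrow> nat \<Rightarrow> ('v, 'k) mpoly" where
  "entries i j k = (case i of 0 \<Rightarrow> vec_index \<epsilon> k | Suc i' \<Rightarrow> D i' $$ (j, k))"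

definition bdry :: "nat \<Rightarrow> (nat \<Rightarrow> ('v, 'k) mpoly) \<Rightarrow> nat \<Rightarrow> ('v, 'k) mpoly" where
  "bdry i v = (\<lambda>j.
    if j < length (shifts i) then \<Sum>k<length (shifts (Suc i)). entries i j k * v k else 0)"

lemma resolution_facts:
  shows eps_dim: "\<epsilon> \<in> carrier_vec (length (a 0))"
    and eps_deg: "j < length (a 0) \<Longrightarrow> vec_index \<epsilon> j \<in> hom_part (a 0 ! j)"
    and D_dim: "D i \<in> carrier_mat (length (a i)) (length (a (Suc i)))"
    and D_deg: "j < length (a i) \<Longrightarrow> k < length (a (Suc i)) \<Longrightarrow> t \<in> Poly_Mapping.keys (D i $$ (j, k)) \<Longrightarrow>
       tdeg t + a i ! j = a (Suc i) ! k"
    and D_min: "j < length (a i) \<Longrightarrow> k < length (a (Suc i)) \<Longrightarrow> coeff_of (D i $$ (j, k)) 0 = 0"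
    and eps_image: "I = {scalar_prod \<epsilon> v |v. v \<in> carrier_vec (length (a 0))}"
    and eps_kernel: "{v \<in> carrier_vec (length (a 0)). scalar_prod \<epsilon> v = 0} =
       {D 0 *\<^sub>v w |w. w \<in> carrier_vec (length (a 1))}"
    and D_kernel: "mat_kernel (D i) = {D (Suc i) *\<^sub>v w |w. w \<in>
      carrier_vec (length (a (Suc (Suc i))))}"
proof -
  note * = resolution[unfolded minimal_graded_free_resolution_def graded_free_resolution_def]
  note 1 = conjunct1[OF *]
  note 2 = conjunct2[OF 1]
  note 3 = conjunct2[OF 2]
  note 4 = conjunct2[OF 3]
  note 5 = conjunct2[OF 4]
  note 6 = conjunct2[OF 5]
  show "\<epsilon> \<in> carrier_vec (length (a 0))" by (rule conjunct1[OF 1])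
  show "j < length (a 0) \<Longrightarrow> vec_index \<epsilon> j \<in> hom_part (a 0 ! j)" using conjunct1[OF 2] by blast
  show "D i \<in> carrier_mat (length (a i)) (length (a (Suc i)))" using conjunct1[OF 3] by blast
  show "j < length (a i) \<Longrightarrow> k < length (a (Suc i)) \<Longrightarrow> t \<in> Poly_Mapping.keys (D i $$ (j, k)) \<Longrightarrow>
       tdeg t + a i ! j = a (Suc i) ! k" using conjunct1[OF 4] by blast
  show "j < length (a i) \<Longrightarrow> k < length (a (Suc i)) \<Longrightarrow> coeff_of (D i $$ (j, k)) 0 = 0"
    using conjunct2[OF *] by blast
  show "I = {scalar_prod \<epsilon> v |v. v \<in> carrier_vec (length (a 0))}" by (rule conjunct1[OF 5])
  show "{v \<in> carrier_vec (length (a 0)). scalar_prod \<epsilon> v = 0} =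
       {D 0 *\<^sub>v w |w. w \<in> carrier_vec (length (a 1))}" by (rule conjunct1[OF 6])
  show "mat_kernel (D i) = {D (Suc i) *\<^sub>v w |w. w \<in> carrier_vec (length (a (Suc (Suc i))))}"
    using conjunct2[OF 6] by (rule spec)
qed

lemma bdry_0: "bdry 0 v = (\<lambda>j. if j = 0 then scalar_prod \<epsilon> (Matrix.vec (length (a 0)) v) else 0)"
  by (auto simp: bdry_def shifts_def entries_def scalar_prod_def fun_eq_iff atLeast0LessThan)

lemma bdry_Suc: "bdry (Suc i) v = (\<lambda>j. if j < length (a i)
    then vec_index (D i *\<^sub>v Matrix.vec (length (a (Suc i))) v) j else 0)"
  using D_dim[of i]
  by (auto simp: bdry_def shifts_def entries_def scalar_prod_def fun_eq_iff atLeast0LessThan intro!: sum.cong)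

lemma vec_bdry_Suc:
  "Matrix.vec (length (a i)) (bdry (Suc i) v) = D i *\<^sub>v Matrix.vec (length (a (Suc i))) v"
  using D_dim[of i] by (intro eq_vecI) (auto simp: bdry_Suc)

lemma vec_eq_free_mod:
  assumes "Matrix.vec l v = Matrix.vec l w" "v \<in> free_mod l" "w \<in> free_mod l"
  shows "v = w"
proof
  fix j
  show "v j = w j"
  proof (cases "j < l")
    case True
    thus ?thesis using arg_cong[OF assms(1), of "\<lambda>x. vec_index x j"] by simp
  next
    case False
    thus ?thesis using assms(2,3) by (simp add: free_mod_def)
  qed
qed

lemma bdry_free: "bdry i v \<in> free_mod (length (shifts i))"
  by (simp add: bdry_def free_mod_def)

lemma vec_free_mod_surj:
  assumes "w \<in> carrier_vec l"
  shows "\<exists>v \<in> free_mod l. w = Matrix.vec l v"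
  using assms by (intro bexI[of _ "\<lambda>j. if j < l then vec_index w j else 0"])
    (auto simp: free_mod_def intro!: eq_vecI)

lemma bdry_bdry: "bdry i (bdry (Suc i) w) = 0"
proof (cases i)
  case 0
  have "D 0 *\<^sub>v Matrix.vec (length (a 1)) w \<in> {v \<in> carrier_vec (length (a 0)). scalar_prod \<epsilon> v = 0}"
    unfolding eps_kernel by force
  thus ?thesis unfolding 0 bdry_0 vec_bdry_Suc by (auto simp: fun_eq_iff)
next
  case (Suc i')
  have "D (Suc i') *\<^sub>v Matrix.vec (length (a (Suc (Suc i')))) w \<in> mat_kernel (D i')"
    unfolding D_kernel by force
  hence "D i' *\<^sub>v (D (Suc i') *\<^sub>v Matrix.vec (length (a (Suc (Suc i')))) w) = 0\<^sub>v (length (a i'))"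
    using D_dim[of i'] by (auto simp: mat_kernel_def)
  thus ?thesis unfolding Suc bdry_Suc[of i'] vec_bdry_Suc by (auto simp: fun_eq_iff)
qed

lemma bdry_exact:
  assumes "v \<in> free_mod (length (shifts (Suc i)))" "bdry i v = 0"
  shows "\<exists>w \<in> free_mod (length (shifts (Suc (Suc i)))). v = bdry (Suc i) w"
proof -
  have "\<exists>w \<in> carrier_vec (length (a (Suc i))). Matrix.vec (length (a i)) v = D i *\<^sub>v w"
  proof (cases i)
    case 0
    have "scalar_prod \<epsilon> (Matrix.vec (length (a 0)) v) = 0"
      using fun_cong[OF assms(2), of 0] unfolding 0 bdry_0 by simp
    hence "Matrix.vec (length (a 0)) v \<in> {v \<in> carrier_vec (length (a 0)). scalar_prod \<epsilon> v = 0}"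
      by simp
    thus ?thesis unfolding eps_kernel 0 by auto
  next
    case (Suc i')
    have "vec_index (D i' *\<^sub>v Matrix.vec (length (a i)) v) j = 0" if "j < length (a i')" for j
      using fun_cong[OF assms(2), of j] that unfolding Suc bdry_Suc by simp
    hence "Matrix.vec (length (a i)) v \<in> mat_kernel (D i')"
      using D_dim[of i'] Suc by (intro mat_kernelI[of _ "length (a i')"]) (auto intro!: eq_vecI)
    thus ?thesis unfolding D_kernel Suc by auto
  qed
  then obtain w where w: "w \<in> free_mod (length (a (Suc i)))"
    "Matrix.vec (length (a i)) v = D i *\<^sub>v Matrix.vec (length (a (Suc i))) w"
    using vec_free_mod_surj by metis
  have "v = bdry (Suc i) w"
    by (rule vec_eq_free_mod[of "length (a i)"])
      (use w vec_bdry_Suc assms(1) bdry_free[of "Suc i" w] in \<open>auto simp: shifts_def\<close>)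
  thus ?thesis using w(1) by (auto simp: shifts_def)
qed

text \<open>With S prepended, exactness at F_0 is an instance of exactness at a positive position;
  only at S may it fail, the cokernel being S/I. Minimality is demanded from
  \<open>entries 1\<close> on, because an entry of \<epsilon> is a unit when I is the whole
  ring.\<close>

sublocale graded_complex shifts entries bdry
proof (unfold_locales)
  fix i j k t
  show "j < length (shifts i) \<Longrightarrow> k < length (shifts (Suc i)) \<Longrightarrow>
    t \<in> Poly_Mapping.keys (entries i j k) \<Longrightarrow> tdeg t + shifts i ! j = shifts (Suc i) ! k"
    using eps_deg D_deg by (cases i) (auto simp: shifts_def entries_def hom_part_def)
  show "j < length (shifts (Suc i)) \<Longrightarrow> k < length (shifts (Suc (Suc i))) \<Longrightarrow>
      coeff_of (entries (Suc i) j k) 0 = 0"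
    using D_min by (simp add: shifts_def entries_def)
qed (simp_all only: bdry_def[symmetric] bdry_bdry bdry_exact)

text \<open>The augmentation has image I and respects degrees, so degree \<open>t\<close> of F_0 is
  mapped onto degree \<open>t\<close> of I. The map \<iota> places I inside the free module of rank
  one that starts the complex.\<close>

lemma image_dim_eq_dim: "image_dim 0 t = mpoly.dim (I \<inter> hom_part t)"
proof -
  define \<iota> :: "('v, 'k) mpoly \<Rightarrow> nat \<Rightarrow> ('v, 'k) mpoly" where "\<iota> f = (\<lambda>j. if j = 0 then f else 0)"
    for f
  interpret lin: Vector_Spaces.linear mscale fscale \<iota>
    by unfold_locales (auto simp: \<iota>_def fscale_def fun_eq_iff)
  have "bdry 0 ` graded_piece (shifts 1) t = \<iota> ` (I \<inter> hom_part t)"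
  proof (intro equalityI subsetI)
    fix x assume "x \<in> bdry 0 ` graded_piece (shifts 1) t"
    then obtain v where v: "v \<in> graded_piece (shifts 1) t" "x = bdry 0 v" by blast
    have "x = graded_comp (shifts 0) t x"
      using graded_comp_id[OF v(1)] diff_graded_comp[of 0 t v] v(2) by simp
    hence "x 0 = hcomp t (x 0)"
      by (drule_tac fun_cong[of _ _ 0]) (simp add: graded_comp_def shifts_def deg_terms_def)
    hence "x 0 \<in> hom_part t" using hcomp_in_hom_part by metis
    moreover have "x 0 \<in> I" unfolding eps_image v(2) bdry_0
      by (auto intro!: exI[of _ "Matrix.vec _ _"])
    moreover have "x = \<iota> (x 0)" by (auto simp: \<iota>_def v(2) bdry_0)
    ultimately show "x \<in> \<iota> ` (I \<inter> hom_part t)" by blast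
  next
    fix x assume "x \<in> \<iota> ` (I \<inter> hom_part t)"
    then obtain f where f: "f \<in> I" "f \<in> hom_part t" "x = \<iota> f" by blast
    then obtain w where "w \<in> carrier_vec (length (a 0))" "f = scalar_prod \<epsilon> w"
      unfolding eps_image by blast
    then obtain v where v: "f = scalar_prod \<epsilon> (Matrix.vec (length (a 0)) v)"
      using vec_free_mod_surj by blast
    have "x = bdry 0 v" by (simp add: bdry_0 f(3) \<iota>_def v)
    moreover have "graded_comp (shifts 0) t x = x"
      using hcomp_id[OF f(2)]
        by (auto simp: graded_comp_def shifts_def f(3) \<iota>_def fun_eq_iff deg_terms_def)
    ultimately have "x = bdry 0 (graded_comp (shifts 1) t v)"
      using diff_graded_comp[of 0 t v] by simp
    thus "x \<in> bdry 0 ` graded_piece (shifts 1) t" using graded_comp_in by blast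
  qed
  moreover have "mpoly.dim (I \<inter> hom_part t) = fvec.dim (\<iota> ` (I \<inter> hom_part t))"
  proof -
    obtain B where B: "finite B" "hom_part t \<subseteq> mpoly.span (B :: ('v, 'k) mpoly set)"
      using hom_part_finite_span by blast
    have "ideal.subspace I"
    proof -
      have "0 \<in> I" unfolding eps_image using eps_dim
        by (force intro: exI[of _ "0\<^sub>v (length (a 0))"])
      moreover have "x + y \<in> I" if xy: "x \<in> I" "y \<in> I" for x y
      proof -
        obtain v w where "v \<in> carrier_vec (length (a 0))" "w \<in> carrier_vec (length (a 0))"
          "x = scalar_prod \<epsilon> v" "y = scalar_prod \<epsilon> w" using xy unfolding eps_image by blast
        hence "x + y = scalar_prod \<epsilon> (v + w)" "v + w \<in> carrier_vec (length (a 0))"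
          using eps_dim by (auto simp: scalar_prod_add_distrib)
        thus ?thesis unfolding eps_image by blast
      qed
      moreover have "c * x \<in> I" if x: "x \<in> I" for c x
      proof -
        obtain v where "v \<in> carrier_vec (length (a 0))" "x = scalar_prod \<epsilon> v"
          using x unfolding eps_image by blast
        hence "c * x = scalar_prod \<epsilon> (c \<cdot>\<^sub>v v)" "c \<cdot>\<^sub>v v \<in> carrier_vec (length (a 0))"
          using eps_dim by auto
        thus ?thesis unfolding eps_image by blast
      qed
      ultimately show ?thesis by (rule ideal.subspaceI)
    qed
    hence sub: "mpoly.subspace (I \<inter> hom_part t)"
      by (intro mpoly.subspace_inter ideal_subspace_mpoly hom_part_subspace)
    have "{x \<in> I \<inter> hom_part t. \<iota> x = 0} \<subseteq> mpoly.span {}"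
      by (auto simp: \<iota>_def fun_eq_iff)
    from mpoly.dim_le_card[OF this] have "mpoly.dim {x \<in> I \<inter> hom_part t. \<iota> x = 0} = 0" by simp
    thus ?thesis using lin.rank_nullity[OF sub, of B] B by auto
  qed
  ultimately show ?thesis by (simp add: image_dim_def)
qed

lemma hilbert_function_eq_poly:
  assumes card: "CARD('v) = n + 1" and a: "\<And>i e. e \<in> set (a i) \<Longrightarrow> e \<le> r + i"
    and t: "r \<le> t"
  shows "of_nat (hilbert_function I t) = poly (shifted_binomial_poly n 0 -
    (\<Sum>i<n + 1. (-1) ^ i * (\<Sum>e\<leftarrow>a i. shifted_binomial_poly n e))) (of_nat t)"
proof -
  obtain B where B: "finite B" "hom_part t \<subseteq> mpoly.span (B :: ('v, 'k) mpoly set)"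
    using hom_part_finite_span by blast
  have le: "mpoly.dim (I \<inter> hom_part t) \<le> mpoly.dim (hom_part t :: ('v, 'k) mpoly set)"
    by (rule mpoly.finite_dim_subspace_mono[OF _ B(2,1)]) simp
  have "of_nat (mpoly.dim (I \<inter> hom_part t)) = (of_int (int (image_dim 0 t)) :: rat)"
    by (simp add: image_dim_eq_dim)
  also have "\<dots> = (\<Sum>i<n + 1. (-1) ^ i * (\<Sum>e\<leftarrow>a i. of_nat (card {s :: 'v tm. tdeg s + e = t})))"
    unfolding image_dim_0 card by (simp add: shifts_def of_nat_sum_list_map of_int_sum_list_map)
  also have "\<dots> = (\<Sum>i<n + 1. (-1) ^ i * (\<Sum>e\<leftarrow>a i. poly (shifted_binomial_poly n e) (of_nat t)))"
  proof (intro sum.cong arg_cong2[where f = "(*)"] refl arg_cong[where f = sum_list] map_cong)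
    fix i e assume "i \<in> {..<n + 1}" "e \<in> set (a i)"
    \<comment> \<open>Here \<open>i \<le> n\<close> and \<open>r \<le> t\<close> turn the bound
      \<open>r + i\<close> on the shifts into the full range in which the polynomial counts
      terms.\<close>
    hence "e \<le> t + n" using a[of e i] t by simp
    thus "of_nat (card {s :: 'v tm. tdeg s + e = t}) = poly (shifted_binomial_poly n e) (of_nat t)"
      by (rule card_shifted_terms[OF card])
  qed
  also have "\<dots> = poly (\<Sum>i<n + 1. (-1) ^ i * (\<Sum>e\<leftarrow>a i. shifted_binomial_poly n e)) (of_nat t)"
    by (simp add: poly_sum poly_sum_list_map)
  finally have 1: "of_nat (mpoly.dim (I \<inter> hom_part t)) =
    poly (\<Sum>i<n + 1. (-1) ^ i * (\<Sum>e\<leftarrow>a i. shifted_binomial_poly n e)) (of_nat t)" .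
  have "{s :: 'v tm. tdeg s + 0 = t} = deg_terms t" by (simp add: deg_terms_def)
  hence 2: "of_nat (mpoly.dim (hom_part t :: ('v, 'k) mpoly set)) =
    poly (shifted_binomial_poly n 0) (of_nat t)"
    using card_shifted_terms[OF card, of 0 t] by (simp add: dim_hom_part)
  show ?thesis using le by (simp add: hilbert_function_def of_nat_diff 1 2)
qed

text \<open>A generator of degree at most \<open>m\<close> times a term, of total degree
  \<open>t \<ge> m\<close>, passes through degree \<open>m\<close>: the term has a divisor of degree
  \<open>m - a 0 ! k\<close>, and the generator times this divisor already lies in degree
  \<open>m\<close> of I.\<close>

lemma generated:
  assumes a: "\<And>e. e \<in> set (a 0) \<Longrightarrow> e \<le> m" and t: "m \<le> t" and f: "f \<in> I \<inter> hom_part t"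
  shows "f \<in> ideal.span (I \<inter> hom_part m)"
proof -
  have mem: "vec_index \<epsilon> k * mono_poly u \<in> ideal.span (I \<inter> hom_part m)"
    if k: "k < length (a 0)" and u: "tdeg u + a 0 ! k = t" for k u
  proof -
    have ak: "a 0 ! k \<le> m" using a k by simp
    hence "m - a 0 ! k \<le> tdeg u" using u t by simp
    then obtain s s' where s: "u = s + s'" "tdeg s = m - a 0 ! k"
      using tm_split by blast
    have "vec_index \<epsilon> k * mono_poly s = scalar_prod \<epsilon> (Matrix.vec (length (a 0)) (\<lambda>j.
      if j = k then mono_poly s else 0))"
      using k by (simp add: scalar_prod_def if_distrib cong: if_cong)
    hence "vec_index \<epsilon> k * mono_poly s \<in> I" unfolding eps_image
      by (auto intro!: exI[of _ "Matrix.vec _ _"])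
    moreover have "vec_index \<epsilon> k * mono_poly s \<in> hom_part (a 0 ! k + (m - a 0 ! k))"
      by (rule hom_part_mult[OF eps_deg[OF k]]) (simp add: hom_part_eq_supported deg_terms_def s)
    ultimately have "mono_poly s' * (vec_index \<epsilon> k * mono_poly s) \<in> ideal.span (I \<inter> hom_part m)"
      using ak by (intro ideal.span_scale ideal.span_base) simp
    thus ?thesis by (simp add: s mono_poly_mult[symmetric] mult_ac)
  qed
  obtain w where "w \<in> carrier_vec (length (a 0))" "f = scalar_prod \<epsilon> w"
    using f unfolding eps_image by blast
  then obtain v where v: "f = scalar_prod \<epsilon> (Matrix.vec (length (a 0)) v)"
    using vec_free_mod_surj by blast
  \<comment> \<open>Only the component of degree \<open>t\<close> of the coefficient vector
    contributes to \<open>f\<close>; in it all cofactors have the degree that \<open>mem\<close>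
    asks for.\<close>
  let ?v = "graded_comp (shifts 1) t v"
  have "f = hcomp t (bdry 0 v 0)" using f by (simp add: bdry_0 v[symmetric] hcomp_id)
  also have "\<dots> = graded_comp (shifts 0) t (bdry 0 v) 0"
    by (simp add: graded_comp_def shifts_def deg_terms_def)
  also have "\<dots> = bdry 0 ?v 0" using diff_graded_comp[of 0 t v] by simp
  also have "\<dots> = (\<Sum>k<length (a 0). vec_index \<epsilon> k * ?v k)"
    by (simp add: bdry_def shifts_def entries_def)
  also have "\<dots> \<in> ideal.span (I \<inter> hom_part m)"
  proof (rule ideal.span_sum)
    fix k assume k: "k \<in> {..<length (a 0)}"
    have "?v k \<in> supported {s. tdeg s + a 0 ! k = t}"
      using spec[OF graded_comp_in[of "shifts 1" t v, unfolded graded_piece_def mem_Collect_eq], of k] k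
      by (simp add: shifts_def)
    hence keys: "tdeg s + a 0 ! k = t" if "s \<in> Poly_Mapping.keys (?v k)" for s
      using that by (auto simp: supported_def)
    have "vec_index \<epsilon> k * ?v k = (\<Sum>s\<in>Poly_Mapping.keys (?v k).
        mscale (coeff_of (?v k) s) (vec_index \<epsilon> k * mono_poly s))"
      by (subst (1) poly_as_sum) (simp add: sum_distrib_left mult_mscale_right)
    also have "\<dots> \<in> ideal.span (I \<inter> hom_part m)"
      unfolding mscale_def by (intro ideal.span_sum ideal.span_scale mem keys) (use k in auto)
    finally show "vec_index \<epsilon> k * ?v k \<in> ideal.span (I \<inter> hom_part m)" .
  qed
  finally show ?thesis .
qed

end

text \<open>The polynomial from the resolution and \<open>p\<close> agree at all large integers,
  hence are equal, and \<open>p\<close> inherits the range starting at \<open>r\<close>.\<close>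

theorem regular_ideal_hilbert_function:
  fixes I :: "('v::finite, 'k::field) mpoly set"
  assumes "regular_ideal r I" "has_hilbert_polynomial I p" "r \<le> t"
  shows "of_nat (hilbert_function I t) = poly p (of_nat t)"
proof -
  obtain a \<epsilon> D where aD: "minimal_graded_free_resolution I a \<epsilon> D" "\<forall>i. \<forall>e \<in> set (a i). e \<le> r + i"
    using assms(1) unfolding regular_ideal_def by blast
  interpret minimal_resolution I a \<epsilon> D by unfold_locales (rule aD(1))
  obtain n where n: "CARD('v) = n + 1"
    by (metis Suc_eq_plus1 gr0_implies_Suc zero_less_card_finite)
  define Q where "Q = shifted_binomial_poly n 0 -
    (\<Sum>i<n + 1. (-1) ^ i * (\<Sum>e\<leftarrow>a i. shifted_binomial_poly n e))"
  have Q: "of_nat (hilbert_function I t) = poly Q (of_nat t)" if "r \<le> t" for t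
    unfolding Q_def using hilbert_function_eq_poly[OF n _ that] aD(2) by blast
  have "\<forall>\<^sub>F t in sequentially. poly Q (of_nat t) = poly p (of_nat t)"
    using assms(2) eventually_ge_at_top[of r] unfolding has_hilbert_polynomial_def
    by eventually_elim (simp add: Q)
  hence "Q = p" by (rule poly_eq_if_eventually_eq)
  thus ?thesis using Q assms(3) by simp
qed

theorem regular_ideal_generated:
  fixes I :: "('v::finite, 'k::field) mpoly set"
  assumes "regular_ideal r I" "r \<le> m" "m \<le> t" "f \<in> I \<inter> hom_part t"
  shows "f \<in> ideal.span (I \<inter> hom_part m)"
proof -
  obtain a \<epsilon> D where aD: "minimal_graded_free_resolution I a \<epsilon> D" "\<forall>i. \<forall>e \<in> set (a i). e \<le> r + i"
    using assms(1) unfolding regular_ideal_def by blast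
  interpret minimal_resolution I a \<epsilon> D by unfold_locales (rule aD(1))
  have "e \<le> m" if "e \<in> set (a 0)" for e using aD(2) that assms(2) by fastforce
  thus ?thesis using generated assms(3,4) by blast
qed

section \<open>Leading terms\<close>

definition lead_terms :: "('v tm \<Rightarrow> 'v tm \<Rightarrow> bool) \<Rightarrow> ('v, 'k::zero) mpoly set \<Rightarrow> 'v tm set" where
  "lead_terms prec W = {lead_tm prec f |f. f \<in> W \<and> f \<noteq> 0}"

locale ordered_terms =
  fixes prec :: "'v::finite tm \<Rightarrow> 'v tm \<Rightarrow> bool"
  assumes order: "term_order prec"
begin

lemma prec_irrefl: "\<not> prec t t"
  and prec_trans: "prec s t \<Longrightarrow> prec t u \<Longrightarrow> prec s u"
  and prec_total: "s \<noteq> t \<Longrightarrow> prec s t \<or> prec t s"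
  and prec_add: "prec s t \<Longrightarrow> prec (s + u) (t + u)"
  using order unfolding term_order_def
  by (auto simp: irreflp_def totalp_on_def dest: transpD)

lemma prec_asym: "prec s t \<Longrightarrow> \<not> prec t s"
  using prec_irrefl prec_trans by blast

lemma finite_max:
  assumes "finite T" "T \<noteq> {}"
  shows "\<exists>t\<in>T. \<forall>s\<in>T. s \<noteq> t \<longrightarrow> prec s t"
  using assms
proof (induction rule: finite_ne_induct)
  case (insert x F)
  then obtain t where t: "t \<in> F" "\<forall>s\<in>F. s \<noteq> t \<longrightarrow> prec s t" by blast
  consider "prec t x" | "prec x t" using insert t prec_total by metis
  thus ?case
  proof cases
    case 1
    hence "prec s x" if "s \<in> F" for s using t that prec_trans[of s t x] by (cases "s = t") auto
    thus ?thesis by blast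
  next
    case 2
    thus ?thesis using t by blast
  qed
qed simp

lemma descending_list:
  assumes "finite T"
  shows "\<exists>L. set L = T \<and> sorted_wrt (\<lambda>s t. prec t s) L"
  using assms
proof (induction "card T" arbitrary: T)
  case (Suc c)
  then obtain t where t: "t \<in> T" "\<forall>s\<in>T. s \<noteq> t \<longrightarrow> prec s t"
    using finite_max[of T] by (metis card.empty nat.distinct(1))
  have "c = card (T - {t})" "finite (T - {t})" using t(1) Suc.hyps(2) Suc.prems by auto
  from Suc.hyps(1)[OF this]
  obtain L where L: "set L = T - {t}" "sorted_wrt (\<lambda>s t. prec t s) L" by blast
  show ?case by (rule exI[of _ "t # L"]) (use L t in auto)
qed (auto intro: exI[of _ "[]"])

lemma descending_distinct: "sorted_wrt (\<lambda>s t. prec t s) L \<Longrightarrow> distinct L"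
  by (induction L) (auto simp: prec_irrefl)

lemma lead_tm_eqI:
  assumes "t \<in> Poly_Mapping.keys f" "\<And>s. s \<in> Poly_Mapping.keys f \<Longrightarrow> s \<noteq> t \<Longrightarrow> prec s t"
  shows "lead_tm prec f = t"
  unfolding lead_tm_def
proof (rule the_equality)
  fix u assume "u \<in> Poly_Mapping.keys f \<and> (\<forall>s\<in>Poly_Mapping.keys f. s \<noteq> u \<longrightarrow> prec s u)"
  thus "u = t" using assms(2)[of u] assms(1) prec_asym[of u t] by metis
qed (use assms in blast)

lemma lead_tm_max:
  assumes "f \<noteq> 0"
  shows "lead_tm prec f \<in> Poly_Mapping.keys f"
    and "s \<in> Poly_Mapping.keys f \<Longrightarrow> s \<noteq> lead_tm prec f \<Longrightarrow> prec s (lead_tm prec f)"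
proof -
  obtain t where t: "t \<in> Poly_Mapping.keys f" "\<forall>s\<in>Poly_Mapping.keys f. s \<noteq> t \<longrightarrow> prec s t"
    using finite_max[of "Poly_Mapping.keys f"] assms by auto
  hence *: "lead_tm prec f = t" by (intro lead_tm_eqI) auto
  show "lead_tm prec f \<in> Poly_Mapping.keys f"
    and "s \<in> Poly_Mapping.keys f \<Longrightarrow> s \<noteq> lead_tm prec f \<Longrightarrow> prec s (lead_tm prec f)"
    unfolding * using t by blast+
qed

lemma lead_tm_mono_mult:
  fixes f :: "('v, 'k::field) mpoly"
  assumes "f \<noteq> 0"
  shows "lead_tm prec (mono_poly t * f) = t + lead_tm prec f"
proof (rule lead_tm_eqI)
  show "t + lead_tm prec f \<in> Poly_Mapping.keys (mono_poly t * f)"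
    unfolding keys_mono_poly_mult using lead_tm_max(1)[OF assms] by blast
  fix s assume "s \<in> Poly_Mapping.keys (mono_poly t * f)" "s \<noteq> t + lead_tm prec f"
  then obtain u where "s = t + u" "u \<in> Poly_Mapping.keys f" "u \<noteq> lead_tm prec f"
    unfolding keys_mono_poly_mult by blast
  thus "prec s (t + lead_tm prec f)"
    using prec_add[OF lead_tm_max(2)[OF assms], of u t] by (simp add: add.commute)
qed

lemma lead_terms_ideal:
  fixes I :: "('v, 'k::field) mpoly set"
  assumes "ideal.subspace I" "t \<in> lead_terms prec I"
  shows "u + t \<in> lead_terms prec I"
proof -
  obtain f where f: "f \<in> I" "f \<noteq> 0" "t = lead_tm prec f"
    using assms(2) unfolding lead_terms_def by blast
  have "mono_poly u * f \<in> I" using assms(1) f(1) ideal.subspace_scale by blast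
  moreover have "Poly_Mapping.keys (mono_poly u * f) \<noteq> {}"
    using f(2) by (simp only: keys_mono_poly_mult) simp
  hence "mono_poly u * f \<noteq> 0" by auto
  moreover have "u + t = lead_tm prec (mono_poly u * f)" using lead_tm_mono_mult f by metis
  ultimately show ?thesis unfolding lead_terms_def by blast
qed

lemma lead_terms_subset:
  assumes "W \<subseteq> supported A"
  shows "lead_terms prec W \<subseteq> A"
  using assms lead_tm_max(1) unfolding lead_terms_def supported_def by blast

text \<open>The coefficients at the leading terms determine an element of \<open>W\<close>; conversely elements with
  distinct leading terms are linearly independent.\<close>

lemma dim_eq_card_lead_terms:
  fixes W :: "('v, 'k::field) mpoly set"
  assumes W: "mpoly.subspace W" "W \<subseteq> hom_part d"
  shows "mpoly.dim W = card (lead_terms prec W)"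
proof (rule antisym)
  let ?T = "lead_terms prec W"
  have fin: "finite ?T"
    using lead_terms_subset[of W "deg_terms d"] W(2) finite_subset finite_deg_terms
    unfolding hom_part_eq_supported by blast
  obtain B where B: "finite B" "hom_part d \<subseteq> mpoly.span (B :: ('v, 'k) mpoly set)"
    using hom_part_finite_span by blast
  interpret lin: Vector_Spaces.linear mscale mscale "restrict_poly ?T :: ('v, 'k) mpoly \<Rightarrow> _"
    by (rule linear_restrict_poly)
  have "f = 0" if "f \<in> W" "restrict_poly ?T f = 0" for f
  proof (rule ccontr)
    assume "f \<noteq> 0"
    hence "lead_tm prec f \<in> ?T" "coeff_of f (lead_tm prec f) \<noteq> 0"
      using that lead_tm_max(1) unfolding lead_terms_def in_keys_iff by blast+
    thus False using arg_cong[OF that(2), of "\<lambda>g. coeff_of g (lead_tm prec f)"] by simp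
  qed
  hence "{x \<in> W. restrict_poly ?T x = 0} \<subseteq> mpoly.span {}" by auto
  from mpoly.dim_le_card[OF this]
  have "mpoly.dim W = mpoly.dim (restrict_poly ?T ` W)"
    using lin.rank_nullity[OF W(1) _ B(1)] W(2) B(2) by simp
  also have "\<dots> \<le> card (mono_poly ` ?T :: ('v, 'k) mpoly set)"
    using restrict_poly_in[of ?T] fin by (intro mpoly.dim_le_card) (auto simp: span_mono_poly)
  also have "\<dots> \<le> card ?T" using fin by (rule card_image_le)
  finally show "mpoly.dim W \<le> card ?T" .
  have "\<forall>t\<in>?T. \<exists>f\<in>W. f \<noteq> 0 \<and> lead_tm prec f = t" unfolding lead_terms_def by blast
  then obtain F where F: "\<And>t. t \<in> ?T \<Longrightarrow> F t \<in> W \<and> F t \<noteq> 0 \<and> lead_tm prec (F t) = t" by metis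
  have inj: "inj_on F ?T" by (rule inj_onI) (metis F)
  have "mpoly.independent (F ` ?T)"
  proof (rule mpoly.independent_if_scalars_zero)
    show "finite (F ` ?T)" using fin by simp
    fix g x assume z: "(\<Sum>x\<in>F ` ?T. mscale (g x) x) = 0" and x: "x \<in> F ` ?T"
    show "g x = 0"
    proof (rule ccontr)
      let ?Z = "{t \<in> ?T. g (F t) \<noteq> 0}"
      assume "g x \<noteq> 0"
      hence "?Z \<noteq> {}" using x by blast
      \<comment> \<open>At the greatest leading term with non-zero coefficient only
        \<open>F t\<close> contributes: every other \<open>F s\<close> has coefficient zero or a
        smaller leading term.\<close>
      then obtain t where t: "t \<in> ?Z" "\<forall>s\<in>?Z. s \<noteq> t \<longrightarrow> prec s t"
        using finite_max[of ?Z] fin by auto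
      have "0 = coeff_of (\<Sum>s\<in>?T. mscale (g (F s)) (F s)) t"
        using z by (simp add: sum.reindex[OF inj])
      also have "\<dots> = (\<Sum>s\<in>?T. if s = t then g (F t) * coeff_of (F t) t else 0)"
        unfolding lookup_sum
      proof (rule sum.cong)
        fix s assume s: "s \<in> ?T"
        have "g (F s) * coeff_of (F s) t = 0" if "s \<noteq> t"
        proof (cases "g (F s) = 0")
          case False
          hence "prec s t" using t s that by blast
          hence "t \<notin> Poly_Mapping.keys (F s)"
            using lead_tm_max(2)[of "F s" t] F[OF s] that prec_asym by auto
          thus ?thesis by (simp add: in_keys_iff)
        qed simp
        thus "coeff_of (mscale (g (F s)) (F s)) t = (if s =
          t then g (F t) * coeff_of (F t) t else 0)"
          by simp
      qed simp
      also have "\<dots> = g (F t) * coeff_of (F t) t" using t fin by simp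
      finally have "coeff_of (F t) t = 0" using t by simp
      thus False using F[of t] lead_tm_max(1)[of "F t"] t by (auto simp: in_keys_iff)
    qed
  qed
  from mpoly.finite_dim_independent_card_le[OF _ this _ B(1), of W]
  have "card (F ` ?T) \<le> mpoly.dim W" using F W(2) B(2) by blast
  thus "card ?T \<le> mpoly.dim W" by (simp add: card_image[OF inj])
qed

text \<open>The leading terms of an ideal are closed under multiplication by terms, so their K-span
  is already an ideal.\<close>

lemma initial_ideal_eq_supported:
  fixes I :: "('v, 'k::field) mpoly set"
  assumes "ideal.subspace I"
  shows "initial_ideal prec I = supported (lead_terms prec I)"
proof
  have gen: "{mono_poly (lead_tm prec f) |f. f \<in> I \<and> f \<noteq> 0} =
    (mono_poly ` lead_terms prec I :: ('v, 'k) mpoly set)"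
    by (auto simp: lead_terms_def)
  have "ideal.subspace (supported (lead_terms prec I) :: ('v, 'k) mpoly set)"
    unfolding ideal_iff
  proof (intro conjI ballI allI supported_subspace)
    fix f :: "('v, 'k) mpoly" and t assume "f \<in> supported (lead_terms prec I)"
    thus "mono_poly t * f \<in> supported (lead_terms prec I)"
      using lead_terms_ideal[OF assms] by (auto simp: supported_def keys_mono_poly_mult)
  qed
  thus "initial_ideal prec I \<subseteq> supported (lead_terms prec I)"
    unfolding initial_ideal_def gen by (intro ideal.span_minimal) auto
  have "mpoly.span (mono_poly ` lead_terms prec I) \<subseteq> initial_ideal prec I"
    unfolding initial_ideal_def gen
    by (intro mpoly.span_minimal ideal.span_superset ideal_subspace_mpoly ideal.subspace_span)
  thus "supported (lead_terms prec I) \<subseteq> initial_ideal prec I" by (simp add: span_mono_poly)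
qed

text \<open>If the leading term of \<open>f\<close> has degree \<open>d\<close>, it is also the
  leading term of the component \<open>hcomp d f\<close>, which stays in the ideal.\<close>

lemma lead_terms_homogeneous:
  fixes I :: "('v, 'k::field) mpoly set"
  assumes "homogeneous_ideal I"
  shows "lead_terms prec I \<inter> deg_terms d = lead_terms prec (I \<inter> hom_part d)"
proof (intro equalityI subsetI)
  fix t assume "t \<in> lead_terms prec I \<inter> deg_terms d"
  then obtain f where f: "f \<in> I" "f \<noteq> 0" "t = lead_tm prec f" "t \<in> deg_terms d"
    unfolding lead_terms_def by blast
  have keys: "s \<in> Poly_Mapping.keys (hcomp d f) \<longleftrightarrow> s \<in> Poly_Mapping.keys f \<and> s \<in> deg_terms d" for s
    by (simp add: in_keys_iff)
  have t: "t \<in> Poly_Mapping.keys (hcomp d f)"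
    unfolding keys using lead_tm_max(1)[OF f(2)] f by simp
  have "lead_tm prec (hcomp d f) = t"
    using t by (rule lead_tm_eqI) (use lead_tm_max(2)[OF f(2)] f(3) keys in blast)
  moreover have "hcomp d f \<noteq> 0" using t by auto
  moreover have "hcomp d f \<in> I \<inter> hom_part d"
    using homogeneous_ideal_hcomp[OF assms f(1)] hcomp_in_hom_part by blast
  ultimately show "t \<in> lead_terms prec (I \<inter> hom_part d)" unfolding lead_terms_def by blast
next
  fix t assume t: "t \<in> lead_terms prec (I \<inter> hom_part d)"
  hence "t \<in> deg_terms d" using lead_terms_subset[of "I \<inter> hom_part d" "deg_terms d"]
    unfolding hom_part_eq_supported by blast
  thus "t \<in> lead_terms prec I \<inter> deg_terms d" using t unfolding lead_terms_def by blast
qed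

lemma card_lead_terms_homogeneous:
  fixes I :: "('v, 'k::field) mpoly set"
  assumes "homogeneous_ideal I"
  shows "card (lead_terms prec I \<inter> deg_terms d) = mpoly.dim (I \<inter> hom_part d)"
  unfolding lead_terms_homogeneous[OF assms]
  by (intro dim_eq_card_lead_terms[symmetric, of _ d] mpoly.subspace_inter ideal_subspace_mpoly
      homogeneous_ideal_ideal[OF assms] hom_part_subspace) simp

end

lemma hilbert_function_supported:
  "hilbert_function (supported M :: ('v::finite, 'k::field) mpoly set) d
    = card (deg_terms d :: 'v tm set) - card (M \<inter> deg_terms d)"
  by (simp add: hilbert_function_def dim_hom_part)
    (simp add: hom_part_eq_supported supported_Int dim_supported)

text \<open>Macaulay's theorem: the initial ideal has the same Hilbert function.\<close>

lemma (in ordered_terms) hilbert_function_lead_terms: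
  fixes I :: "('v, 'k::field) mpoly set"
  assumes "homogeneous_ideal I"
  shows "hilbert_function (supported (lead_terms prec I) :: ('v, 'k) mpoly set) d =
    hilbert_function I d"
  by (simp add: hilbert_function_supported card_lead_terms_homogeneous[OF assms])
    (simp add: hilbert_function_def dim_hom_part)

section \<open>Pluecker coordinates\<close>

lemma sum_list_basis:
  assumes "distinct bs"
  shows "(\<Sum>x\<in>set bs. g x) = (\<Sum>i<length bs. g (bs ! i))"
  using sum.reindex_bij_betw[OF bij_betw_nth[OF assms refl refl], of g] by simp

lemma is_basis_list_length:
  assumes "is_basis_list bs V"
  shows "length bs = mpoly.dim V"
  using assms mpoly.dim_span_eq_card_independent[of "set bs"]
  by (auto simp: is_basis_list_def distinct_card)

text \<open>Kernel vectors of the transposed coefficient matrix are the coordinate vectors, with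
  respect to \<open>bs\<close>, of those elements of \<open>V\<close> that vanish at all terms of
  \<open>L\<close>.\<close>

lemma plucker_coord_eq_0_iff:
  fixes V :: "('v, 'k::field) mpoly set"
  assumes bs: "is_basis_list bs V" and L: "length L = length bs"
  shows "plucker_coord bs L = 0 \<longleftrightarrow> (\<exists>f\<in>V. f \<noteq> 0 \<and> (\<forall>t\<in>set L. coeff_of f t = 0))"
proof -
  let ?q = "length bs"
  let ?M = "Matrix.mat ?q ?q (\<lambda>(i, j). coeff_of (bs ! i) (L ! j))"
  let ?f = "\<lambda>c :: nat \<Rightarrow> 'k. \<Sum>i<?q. mscale (c i) (bs ! i)"
  have V: "V = range ?f"
  proof -
    have "V = range (\<lambda>u. \<Sum>v\<in>set bs. mscale (u v) v)"
      using bs mpoly.span_finite[of "set bs"] by (simp add: is_basis_list_def)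
    also have "\<dots> = range ?f"
    proof (intro equalityI subsetI)
      fix x assume "x \<in> range (\<lambda>u. \<Sum>v\<in>set bs. mscale (u v) v)"
      then obtain u where "x = (\<Sum>v\<in>set bs. mscale (u v) v)" by blast
      hence "x = ?f (\<lambda>i. u (bs ! i))" using bs by (simp add: sum_list_basis is_basis_list_def)
      thus "x \<in> range ?f" by (rule range_eqI[of x ?f "\<lambda>i. u (bs ! i)"])
    next
      fix x assume "x \<in> range ?f"
      then obtain c where c: "x = ?f c" by blast
      \<comment> \<open>Since \<open>bs\<close> is distinct, coefficients indexed by positions can
        be read as coefficients indexed by basis elements.\<close>
      have "\<exists>u. \<forall>i<?q. u (bs ! i) = c i"
        using bs by (intro exI[of _ "\<lambda>v. c (THE i. i < ?q \<and> bs ! i =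
          v)"] allI impI arg_cong[of _ _ c] the_equality)
          (auto simp: is_basis_list_def nth_eq_iff_index_eq)
      then obtain u where "\<forall>i<?q. u (bs ! i) = c i" by blast
      hence "x = (\<Sum>v\<in>set bs. mscale (u v) v)" using bs c
        by (simp add: sum_list_basis is_basis_list_def)
      thus "x \<in> range (\<lambda>u. \<Sum>v\<in>set bs. mscale (u v) v)"
        by (rule range_eqI[of x "\<lambda>u. \<Sum>v\<in>set bs. mscale (u v) v" u])
    qed
    finally show ?thesis .
  qed
  have f0: "?f c = 0 \<longleftrightarrow> (\<forall>i<?q. c i = 0)" for c
  proof
    assume z: "?f c = 0"
    show "\<forall>i<?q. c i = 0"
    proof (intro allI impI)
      fix i assume i: "i < ?q"
      let ?u = "\<lambda>v. c (THE i. i < ?q \<and> bs ! i = v)"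
      have u: "?u (bs ! j) = c j" if "j < ?q" for j
        using bs that by (intro arg_cong[of _ _ c] the_equality)
          (auto simp: is_basis_list_def nth_eq_iff_index_eq)
      have "(\<Sum>v\<in>set bs. mscale (?u v) v) = 0"
        using z bs u by (simp add: sum_list_basis is_basis_list_def)
      hence "?u (bs ! i) = 0"
        using mpoly.independentD[of "set bs" "set bs" ?u "bs ! i"] bs i
          by (simp add: is_basis_list_def)
      thus "c i = 0" using u i by simp
    qed
  qed simp
  have coef: "coeff_of (?f c) (L ! j) = vec_index (transpose_mat ?M *\<^sub>v Matrix.vec ?q c) j"
    if "j < ?q" for c j
    using that by (simp add: lookup_sum scalar_prod_def atLeast0LessThan mult.commute)
  have van: "(\<forall>t\<in>set L. coeff_of (?f c) t = 0) \<longleftrightarrow> transpose_mat ?M *\<^sub>v Matrix.vec ?q c = 0\<^sub>v ?q"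
    for c
  proof -
    have "(\<forall>t\<in>set L. coeff_of (?f c) t = 0) \<longleftrightarrow> (\<forall>j<?q. coeff_of (?f c) (L ! j) = 0)"
      by (simp only: all_set_conv_all_nth L)
    also have "\<dots> \<longleftrightarrow> (\<forall>j<?q. vec_index (transpose_mat ?M *\<^sub>v Matrix.vec ?q c) j = 0)"
      by (simp only: coef cong: imp_cong)
    also have "\<dots> \<longleftrightarrow> transpose_mat ?M *\<^sub>v Matrix.vec ?q c = 0\<^sub>v ?q"
    proof
      assume "\<forall>j<?q. vec_index (transpose_mat ?M *\<^sub>v Matrix.vec ?q c) j = 0"
      thus "transpose_mat ?M *\<^sub>v Matrix.vec ?q c = 0\<^sub>v ?q" by (intro eq_vecI) simp_all
    qed simp
    finally show ?thesis .
  qed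
  have "plucker_coord bs L = 0 \<longleftrightarrow> Determinant.det (transpose_mat ?M) = 0"
    unfolding plucker_coord_def L by (subst det_transpose[of _ ?q]) auto
  also have "\<dots> \<longleftrightarrow> (\<exists>v\<in>carrier_vec ?q. v \<noteq> 0\<^sub>v ?q \<and> transpose_mat ?M *\<^sub>v v = 0\<^sub>v ?q)"
    by (subst det_0_iff_vec_prod_zero_field[of _ ?q]) auto
  also have "\<dots> \<longleftrightarrow> (\<exists>c. (\<exists>i<?q. c i \<noteq> 0) \<and> transpose_mat ?M *\<^sub>v Matrix.vec ?q c = 0\<^sub>v ?q)"
  proof
    assume "\<exists>v\<in>carrier_vec ?q. v \<noteq> 0\<^sub>v ?q \<and> transpose_mat ?M *\<^sub>v v = 0\<^sub>v ?q"
    then obtain v where v: "v \<in> carrier_vec ?q" "v \<noteq> 0\<^sub>v ?q" "transpose_mat ?M *\<^sub>v v = 0\<^sub>v ?q"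
      by blast
    have "v = Matrix.vec ?q (vec_index v)" using v(1) by (intro eq_vecI) auto
    moreover have "\<exists>i<?q. vec_index v i \<noteq> 0"
      using v(1,2) by (metis carrier_vecD eq_vecI index_zero_vec)
    ultimately show "\<exists>c. (\<exists>i<?q. c i \<noteq> 0) \<and> transpose_mat ?M *\<^sub>v Matrix.vec ?q c = 0\<^sub>v ?q"
      using v(3) by metis
  next
    assume "\<exists>c. (\<exists>i<?q. c i \<noteq> 0) \<and> transpose_mat ?M *\<^sub>v Matrix.vec ?q c = 0\<^sub>v ?q"
    then obtain c i where c: "i < ?q" "c i \<noteq> 0" "transpose_mat ?M *\<^sub>v Matrix.vec ?q c = 0\<^sub>v ?q"
      by blast
    have "Matrix.vec ?q c \<noteq> 0\<^sub>v ?q" using c(1,2) by (metis index_vec index_zero_vec(1))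
    thus "\<exists>v\<in>carrier_vec ?q. v \<noteq> 0\<^sub>v ?q \<and> transpose_mat ?M *\<^sub>v v = 0\<^sub>v ?q" using c(3) by auto
  qed
  also have "\<dots> \<longleftrightarrow> (\<exists>f\<in>V. f \<noteq> 0 \<and> (\<forall>t\<in>set L. coeff_of f t = 0))"
    unfolding V van[symmetric] using f0 by auto
  finally show ?thesis .
qed

lemma grassmannian_basis:
  assumes "V \<in> grassmannian m q"
  shows "\<exists>bs. is_basis_list bs V"
proof -
  obtain B where B: "B \<subseteq> V" "mpoly.independent B" "V \<subseteq> mpoly.span B"
    using mpoly.basis_exists[of V] by metis
  obtain A where A: "finite A" "hom_part m \<subseteq> mpoly.span (A :: ('a, 'b) mpoly set)"
    using hom_part_finite_span by blast
  have "finite B"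
    using mpoly.independent_span_bound[OF A(1) B(2)] B(1) A(2) assms unfolding grassmannian_def
      by blast
  then obtain bs where bs: "set bs = B" "distinct bs" using finite_distinct_list by blast
  have "mpoly.span B = V"
    using B assms unfolding grassmannian_def by (intro mpoly.span_subspace) auto
  thus ?thesis using bs B(2) by (auto simp: is_basis_list_def)
qed

text \<open>A criterion free of bases: the coefficients at \<open>L\<close> determine the elements
  of \<open>V\<close>. It reduces all later arguments about open sets to dimension counts.\<close>

lemma plucker_open_iff:
  assumes "length L = q"
  shows "V \<in> plucker_open m q L \<longleftrightarrow>
    V \<in> grassmannian m q \<and> (\<forall>f\<in>V. (\<forall>t\<in>set L. coeff_of f t = 0) \<longrightarrow> f = 0)"
proof -
  have *: "plucker_coord bs L \<noteq> 0 \<longleftrightarrow> (\<forall>f\<in>V. (\<forall>t\<in>set L. coeff_of f t = 0) \<longrightarrow> f = 0)"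
    if "V \<in> grassmannian m q" "is_basis_list bs V" for bs
  proof -
    have "length L = length bs"
      using is_basis_list_length[OF that(2)] that(1) assms by (simp add: grassmannian_def)
    from plucker_coord_eq_0_iff[OF that(2) this] show ?thesis by blast
  qed
  show ?thesis
    unfolding plucker_open_def using * grassmannian_basis by blast
qed

section \<open>The order on wedges, and the wedge of the leading terms as its maximum\<close>

context ordered_terms
begin

lemma wedge_less_asym:
  assumes "length L = length M" "wedge_less prec L M"
  shows "\<not> wedge_less prec M L"
proof
  assume "wedge_less prec M L"
  then obtain j where j: "\<forall>i<j. M ! i = L ! i" "prec (M ! j) (L ! j)" by (auto simp: wedge_less_def)
  obtain k where k: "\<forall>i<k. L ! i = M ! i" "prec (L ! k) (M ! k)" using assms(2)
    by (auto simp: wedge_less_def)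
  consider "j < k" | "k < j" | "j = k" by linarith
  thus False using j k prec_irrefl prec_asym by cases metis+
qed

lemma wedge_less_trans:
  assumes "length L = length M" "length M = length N" "wedge_less prec L M" "wedge_less prec M N"
  shows "wedge_less prec L N"
proof -
  obtain j where j: "j < length L" "\<forall>i<j. L ! i = M ! i" "prec (L ! j) (M ! j)"
    using assms(3) by (auto simp: wedge_less_def)
  obtain k where k: "k < length L" "\<forall>i<k. M ! i = N ! i" "prec (M ! k) (N ! k)"
    using assms by (auto simp: wedge_less_def)
  consider "j < k" | "k < j" | "j = k" by linarith
  thus ?thesis
  proof cases
    case 1 thus ?thesis unfolding wedge_less_def using j k by (intro exI[of _ j]) auto
  next
    case 2 thus ?thesis unfolding wedge_less_def using j k by (intro exI[of _ k]) auto
  next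
    case 3 thus ?thesis unfolding wedge_less_def using j k prec_trans by (intro exI[of _ j]) auto
  qed
qed

lemma first_difference:
  assumes "length L = length M" "L \<noteq> M"
  shows "\<exists>j<length L. (\<forall>i<j. L ! i = M ! i) \<and> L ! j \<noteq> M ! j"
proof -
  let ?P = "\<lambda>j. j < length L \<and> L ! j \<noteq> M ! j"
  have "\<exists>j. ?P j" using assms nth_equalityI by blast
  hence "?P (LEAST j. ?P j)" by (rule LeastI_ex)
  moreover have "\<forall>i<(LEAST j. ?P j). L ! i = M ! i"
    using not_less_Least[of _ ?P] calculation by (meson less_trans)
  ultimately show ?thesis by blast
qed

lemma wedge_less_total:
  assumes "length L = length M" "L \<noteq> M"
  shows "wedge_less prec L M \<or> wedge_less prec M L"
  using first_difference[OF assms] assms(1) prec_total unfolding wedge_less_def by metis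

lemma max_wedge_eqI:
  assumes "L \<in> A" "\<And>M. M \<in> A \<Longrightarrow> M \<noteq> L \<Longrightarrow> wedge_less prec M L" "\<And>M. M \<in> A \<Longrightarrow> length M = q"
  shows "max_wedge prec A = L"
  unfolding max_wedge_def
proof (rule the_equality)
  show "L \<in> A \<and> (\<forall>M\<in>A. M \<noteq> L \<longrightarrow> wedge_less prec M L)" using assms by blast
  fix L' assume L': "L' \<in> A \<and> (\<forall>M\<in>A. M \<noteq> L' \<longrightarrow> wedge_less prec M L')"
  show "L' = L"
    using L' assms(1,2) wedge_less_asym[of L L'] assms(3) by metis
qed

lemma max_wedge_exists:
  assumes "finite A" "A \<noteq> {}" "\<And>M. M \<in> A \<Longrightarrow> length M = q"
  shows "\<exists>L\<in>A. \<forall>M\<in>A. M \<noteq> L \<longrightarrow> wedge_less prec M L"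
  using assms
proof (induction rule: finite_ne_induct)
  case (insert x F)
  then obtain L where L: "L \<in> F" "\<forall>M\<in>F. M \<noteq> L \<longrightarrow> wedge_less prec M L" by auto
  have len: "length M = q" if "M \<in> insert x F" for M using insert.prems that by blast
  consider "wedge_less prec x L" | "wedge_less prec L x"
    using wedge_less_total[of x L] len L(1) insert.hyps by auto
  thus ?case
  proof cases
    case 1 thus ?thesis using L by blast
  next
    case 2
    have "wedge_less prec M x" if "M \<in> F" for M
      using that L 2 wedge_less_trans[of M L x] len by (cases "M = L") auto
    thus ?thesis by blast
  qed
qed simp

lemma finite_term_wedges: "finite (term_wedges prec m q)"
proof (rule finite_subset)
  show "term_wedges prec m q \<subseteq> {L. set L \<subseteq> deg_terms m \<and> length L = q}"
    by (auto simp: term_wedges_def deg_terms_def)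
qed (simp add: finite_lists_length_eq)

text \<open>A non-zero element of \<open>V\<close> has a non-zero coefficient at its own leading
  term, which belongs to \<open>L\<close>.\<close>

lemma plucker_open_lead_terms:
  fixes V :: "('v, 'k::field) mpoly set"
  assumes V: "V \<in> grassmannian m q" and L: "set L = lead_terms prec V" "length L = q"
  shows "V \<in> plucker_open m q L"
proof -
  have "f = 0" if "f \<in> V" "\<forall>t\<in>set L. coeff_of f t = 0" for f
    using that lead_tm_max(1)[of f] L(1) unfolding lead_terms_def in_keys_iff by blast
  thus ?thesis using plucker_open_iff[OF L(2)] V by blast
qed

text \<open>Let \<open>j\<close> be the first difference (positions start at 0) and suppose that
  \<open>L ! j\<close> precedes \<open>M ! j\<close>. The elements of \<open>V\<close> without terms
  above \<open>L ! j\<close> have dimension at least \<open>q - j\<close> and vanish at the first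
  \<open>j + 1\<close> entries of \<open>M\<close>. The other \<open>q - j - 1\<close> entries
  cannot separate them, against \<open>V \<in> plucker_open m q M\<close>.\<close>

lemma lead_terms_maximal:
  fixes V :: "('v, 'k::field) mpoly set"
  assumes V: "V \<in> plucker_open m q M" and M: "M \<in> term_wedges prec m q"
    and L: "set L = lead_terms prec V" "L \<in> term_wedges prec m q" and ne: "M \<noteq> L"
  shows "wedge_less prec M L"
proof -
  have len: "length M = q" "length L = q" using M L by (auto simp: term_wedges_def)
  have van: "f = 0" if "f \<in> V" "\<forall>t\<in>set M. coeff_of f t = 0" for f
    using V plucker_open_iff[OF len(1)] that by blast
  have Vg: "mpoly.subspace V" "V \<subseteq> hom_part m" using V
    by (auto simp: plucker_open_def grassmannian_def)
  have sortM: "sorted_wrt (\<lambda>s t. prec t s) M" and sortL: "sorted_wrt (\<lambda>s t. prec t s) L"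
    using M L by (auto simp: term_wedges_def)
  obtain j where j: "j < q" "\<forall>i<j. M ! i = L ! i" "M ! j \<noteq> L ! j"
    using first_difference[of M L] len ne by auto
  have "\<not> prec (L ! j) (M ! j)"
  proof
    assume less: "prec (L ! j) (M ! j)"
    define W where "W = V \<inter> supported {t. t = L ! j \<or> prec t (L ! j)}"
    have W: "mpoly.subspace W" "W \<subseteq> hom_part m"
      using Vg by (auto simp: W_def intro: mpoly.subspace_inter supported_subspace)
    have "(\<lambda>i. L ! i) ` {j..<q} \<subseteq> lead_terms prec W"
    proof
      fix t assume "t \<in> (\<lambda>i. L ! i) ` {j..<q}"
      then obtain i where i: "j \<le> i" "i < q" "t = L ! i" by auto
      hence "t \<in> lead_terms prec V" unfolding L(1)[symmetric] using len by simp
      then obtain f where f: "f \<in> V" "f \<noteq> 0" "lead_tm prec f = t" unfolding lead_terms_def by blast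
      have "t = L ! j \<or> prec t (L ! j)"
        using sorted_wrt_nth_less[OF sortL, of j i] i len by (cases "i = j") auto
      hence "s = L ! j \<or> prec s (L ! j)" if "s \<in> Poly_Mapping.keys f" for s
        using lead_tm_max(2)[OF f(2) that] f(3) prec_trans by metis
      hence "f \<in> W" using f(1) by (auto simp: W_def supported_def)
      thus "t \<in> lead_terms prec W" using f unfolding lead_terms_def by blast
    qed
    moreover have "finite (lead_terms prec W)"
      using lead_terms_subset[of W "deg_terms m"] W(2) finite_subset finite_deg_terms
      unfolding hom_part_eq_supported by blast
    ultimately have "card ((\<lambda>i. L ! i) ` {j..<q}) \<le> card (lead_terms prec W)" by (intro card_mono)
    moreover have "card ((\<lambda>i. L ! i) ` {j..<q}) = q - j"
      using descending_distinct[OF sortL] len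
        by (subst card_image) (auto simp: inj_on_def nth_eq_iff_index_eq)
    ultimately have dimW: "q - j \<le> mpoly.dim W" using dim_eq_card_lead_terms[OF W] by simp
    \<comment> \<open>Entries of \<open>M\<close> up to position \<open>j\<close> are left out,
      since each of them is greater than \<open>L ! j\<close> and elements of \<open>W\<close>
      vanish there.\<close>
    define T where "T = (\<lambda>i. M ! i) ` {Suc j..<q}"
    interpret lin: Vector_Spaces.linear mscale mscale "restrict_poly T :: ('v, 'k) mpoly \<Rightarrow> _"
      by (rule linear_restrict_poly)
    have "f = 0" if f: "f \<in> W" "restrict_poly T f = 0" for f
    proof (rule van)
      show "f \<in> V" using f by (simp add: W_def)
      show "\<forall>t\<in>set M. coeff_of f t = 0"
      proof
        fix t assume "t \<in> set M"
        then obtain i where i: "i < q" "t = M ! i" using len by (auto simp: in_set_conv_nth)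
        show "coeff_of f t = 0"
        proof (cases "j < i")
          case True
          hence "t \<in> T" using i by (auto simp: T_def)
          thus ?thesis using arg_cong[OF f(2), of "\<lambda>g. coeff_of g t"] by simp
        next
          case False
          hence "M ! i = M ! j \<or> prec (M ! j) (M ! i)"
            using sorted_wrt_nth_less[OF sortM, of i j] j(1) len by (cases "i = j") auto
          hence "prec (L ! j) t" using less prec_trans i by metis
          hence "t \<noteq> L ! j \<and> \<not> prec t (L ! j)" using prec_irrefl prec_asym by blast
          thus ?thesis using f(1) by (auto simp: W_def in_supported_iff)
        qed
      qed
    qed
    hence "{x \<in> W. restrict_poly T x = 0} \<subseteq> mpoly.span {}" by auto
    from mpoly.dim_le_card[OF this]
    have z: "mpoly.dim {x \<in> W. restrict_poly T x = 0} = 0" by simp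
    obtain B where B: "finite B" "hom_part m \<subseteq> mpoly.span (B :: ('v, 'k) mpoly set)"
      using hom_part_finite_span by blast
    have "mpoly.dim W = mpoly.dim (restrict_poly T ` W)"
      using lin.rank_nullity[OF W(1) _ B(1)] W(2) B(2) z by simp
    also have "\<dots> \<le> card (mono_poly ` T :: ('v, 'k) mpoly set)"
      using restrict_poly_in[of T] by (intro mpoly.dim_le_card) (auto simp: span_mono_poly T_def)
    also have "\<dots> \<le> card T" by (rule card_image_le) (simp add: T_def)
    also have "\<dots> \<le> q - Suc j" unfolding T_def using card_image_le[of "{Suc j..<q}" "\<lambda>i. M ! i"]
      by simp
    finally show False using dimW j(1) by simp
  qed
  hence "prec (M ! j) (L ! j)" using prec_total j(3) by blast
  thus ?thesis unfolding wedge_less_def using j len by auto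
qed

lemma lead_terms_list:
  fixes V :: "('v, 'k::field) mpoly set"
  assumes V: "V \<in> grassmannian m q"
  shows "\<exists>L\<in>term_wedges prec m q. set L = lead_terms prec V"
proof -
  have V': "mpoly.subspace V" "V \<subseteq> hom_part m" "mpoly.dim V = q" using V
    by (auto simp: grassmannian_def)
  have sub: "lead_terms prec V \<subseteq> deg_terms m"
    using lead_terms_subset V'(2) unfolding hom_part_eq_supported by blast
  then obtain L where L: "set L = lead_terms prec V" "sorted_wrt (\<lambda>s t. prec t s) L"
    using descending_list finite_subset finite_deg_terms by metis
  have "length L = q"
    using distinct_card[OF descending_distinct[OF L(2)]] dim_eq_card_lead_terms[OF V'(1,2)] L(1) V'(3) by simp
  hence "L \<in> term_wedges prec m q" using L sub by (auto simp: term_wedges_def deg_terms_def)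
  thus ?thesis using L(1) by blast
qed

lemma in_wedge_eq:
  fixes V :: "('v, 'k::field) mpoly set"
  assumes V: "V \<in> grassmannian m q" and L: "set L = lead_terms prec V" "L \<in> term_wedges prec m q"
  shows "in_wedge prec m q V = L"
  unfolding in_wedge_def
proof (rule max_wedge_eqI)
  show "L \<in> {L \<in> term_wedges prec m q. V \<in> plucker_open m q L}"
    using plucker_open_lead_terms[OF V L(1)] L(2) by (auto simp: term_wedges_def)
  fix M assume "M \<in> {L \<in> term_wedges prec m q. V \<in> plucker_open m q L}" "M \<noteq> L"
  thus "wedge_less prec M L" using lead_terms_maximal[OF _ _ L] by blast
qed (simp add: term_wedges_def)

lemma set_in_wedge:
  fixes V :: "('v, 'k::field) mpoly set"
  assumes V: "V \<in> grassmannian m q"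
  shows "set (in_wedge prec m q V) = lead_terms prec V"
    and "in_wedge prec m q V \<in> term_wedges prec m q"
  using lead_terms_list[OF V] in_wedge_eq[OF V] by metis+

end

section \<open>Dickson's lemma\<close>

text \<open>A sequence has a monotone subsequence; if that one decreases, it is constant from the
  place of its least value on.\<close>

lemma nat_seq_monosub:
  fixes f :: "nat \<Rightarrow> nat"
  shows "\<exists>\<psi> :: nat \<Rightarrow> nat. strict_mono \<psi> \<and> mono (\<lambda>i. f (\<psi> i))"
proof -
  obtain \<psi> where \<psi>: "strict_mono \<psi>" "monoseq (\<lambda>n. f (\<psi> n))" using seq_monosub by blast
  show ?thesis
  proof (cases "incseq (\<lambda>n. f (\<psi> n))")
    case True thus ?thesis using \<psi> by (auto simp: incseq_def mono_def)
  next
    case False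
    hence dec: "decseq (\<lambda>n. f (\<psi> n))" using \<psi>(2) by (auto simp: monoseq_iff)
    obtain N where N: "\<And>n. f (\<psi> N) \<le> f (\<psi> n)"
      using ex_has_least_nat[of "\<lambda>_. True" 0 "\<lambda>n. f (\<psi> n)"] by auto
    have "f (\<psi> (i + N)) = f (\<psi> N)" for i
      using N[of "i + N"] decseqD[OF dec, of N "i + N"] by simp
    moreover have "strict_mono (\<lambda>i. \<psi> (i + N))" using \<psi>(1) by (simp add: strict_mono_def)
    ultimately show ?thesis by (intro exI[of _ "\<lambda>i. \<psi> (i + N)"]) (auto simp: mono_def)
  qed
qed

lemma monotone_subsequence:
  fixes f :: "nat \<Rightarrow> 'v \<Rightarrow> nat"
  assumes "finite A"
  shows "\<exists>\<phi> :: nat \<Rightarrow> nat. strict_mono \<phi> \<and> (\<forall>x\<in>A. mono (\<lambda>i. f (\<phi> i) x))"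
  using assms
proof (induction A rule: finite_induct)
  case empty
  show ?case by (intro exI[of _ "\<lambda>i. i"]) (simp add: strict_mono_def)
next
  case (insert x A)
  then obtain \<phi> :: "nat \<Rightarrow> nat" where \<phi>: "strict_mono \<phi>" "\<forall>x\<in>A. mono (\<lambda>i. f (\<phi> i) x)" by blast
  obtain \<psi> :: "nat \<Rightarrow> nat" where \<psi>: "strict_mono \<psi>" "mono (\<lambda>i. f (\<phi> (\<psi> i)) x)"
    using nat_seq_monosub[of "\<lambda>i. f (\<phi> i) x"] by blast
  have "mono (\<lambda>i. f (\<phi> (\<psi> i)) y)" if "y \<in> A" for y
  proof (rule monoI)
    fix i j :: nat assume "i \<le> j"
    hence "\<psi> i \<le> \<psi> j" using \<psi>(1) by (simp add: strict_mono_less_eq)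
    thus "f (\<phi> (\<psi> i)) y \<le> f (\<phi> (\<psi> j)) y" using monoD[OF bspec[OF \<phi>(2) that]] by simp
  qed
  moreover have "strict_mono (\<phi> \<circ> \<psi>)" using \<phi>(1) \<psi>(1) by (rule strict_mono_o)
  ultimately show ?case using \<psi>(2) by (intro exI[of _ "\<phi> \<circ> \<psi>"]) (simp add: o_def)
qed

lemma tm_divides_iff:
  fixes s t :: "'v tm"
  shows "(\<exists>u. t = s + u) \<longleftrightarrow> (\<forall>x. Poly_Mapping.lookup s x \<le> Poly_Mapping.lookup t x)"
proof
  assume "\<forall>x. Poly_Mapping.lookup s x \<le> Poly_Mapping.lookup t x"
  hence "t = s + (t - s)" by (intro poly_mapping_eqI) (simp add: lookup_add lookup_minus)
  thus "\<exists>u. t = s + u" ..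
qed (auto simp: lookup_add)

text \<open>The set F consists of the elements minimal for divisibility. Were it infinite, a
  sequence of distinct elements would have a subsequence with all exponents non-decreasing, and one
  minimal element would divide another.\<close>

lemma dickson:
  fixes M :: "'v::finite tm set"
  shows "\<exists>F\<subseteq>M. finite F \<and> (\<forall>t\<in>M. \<exists>g\<in>F. \<exists>u. t = g + u)"
proof -
  let ?F = "{t \<in> M. \<forall>s\<in>M. (\<exists>u. t = s + u) \<longrightarrow> s = t}"
  have "finite ?F"
  proof (rule ccontr)
    assume "infinite ?F"
    then obtain f :: "nat \<Rightarrow> 'v tm" where f: "inj f" "range f \<subseteq> ?F"
      using infinite_countable_subset by blast
    obtain \<phi> :: "nat \<Rightarrow> nat"
      where \<phi>: "strict_mono \<phi>" "\<forall>x\<in>UNIV. mono (\<lambda>i. Poly_Mapping.lookup (f (\<phi> i)) x)"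
      using monotone_subsequence[of UNIV "\<lambda>i. Poly_Mapping.lookup (f i)"] by auto
    have "\<forall>x. Poly_Mapping.lookup (f (\<phi> 0)) x \<le> Poly_Mapping.lookup (f (\<phi> 1)) x"
      using \<phi>(2) monoD by (metis UNIV_I zero_le)
    hence "\<exists>u. f (\<phi> 1) = f (\<phi> 0) + u" by (rule tm_divides_iff[THEN iffD2])
    hence "f (\<phi> 0) = f (\<phi> 1)" using f(2) by blast
    hence "\<phi> 0 = \<phi> 1" using f(1) by (simp add: inj_eq)
    thus False using \<phi>(1) by (simp add: strict_mono_eq)
  qed
  moreover have "\<exists>g\<in>?F. \<exists>u. t = g + u" if "t \<in> M" for t
    using that
  proof (induction "tdeg t" arbitrary: t rule: less_induct)
    case less
    show ?case
    proof (cases "t \<in> ?F")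
      case True thus ?thesis by (intro bexI[of _ t] exI[of _ 0]) auto
    next
      case False
      then obtain s u where s: "s \<in> M" "t = s + u" "s \<noteq> t" using less.prems by blast
      hence "u \<noteq> 0" by auto
      hence "tdeg u \<noteq> 0" by simp
      hence "tdeg s < tdeg t" unfolding s(2) tdeg_add by linarith
      from less.hyps[OF this s(1)] obtain g w where "g \<in> ?F" "s = g + w" by blast
      thus ?thesis using s(2) by (intro bexI[of _ g] exI[of _ "w + u"]) (auto simp: add.assoc)
    qed
  qed
  ultimately show ?thesis by (intro exI[of _ ?F]) blast
qed

section \<open>Saturation of monomial ideals\<close>

definition term_ideal :: "'v tm set \<Rightarrow> bool" where
  "term_ideal M \<longleftrightarrow> (\<forall>t\<in>M. \<forall>u. u + t \<in> M)"

definition saturated_terms :: "'v::finite tm set \<Rightarrow> 'v tm set" where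
  "saturated_terms M = {t. \<exists>k. \<forall>u. k \<le> tdeg u \<longrightarrow> u + t \<in> M}"

lemma supported_ideal: "term_ideal M \<Longrightarrow> ideal.subspace (supported M :: ('v, 'k::field) mpoly set)"
  unfolding ideal_iff term_ideal_def
  by (intro conjI supported_subspace) (auto simp: supported_def keys_mono_poly_mult)

lemma supported_subset_ideal:
  fixes I :: "('v, 'k::field) mpoly set"
  assumes "ideal.subspace I" "\<And>t. t \<in> M \<Longrightarrow> mono_poly t \<in> I"
  shows "supported M \<subseteq> I"
  unfolding span_mono_poly[symmetric] using assms
  by (intro mpoly.span_minimal ideal_subspace_mpoly) auto

lemma supported_homogeneous:
  "term_ideal M \<Longrightarrow> homogeneous_ideal (supported M :: ('v::finite, 'k::field) mpoly set)"
  by (intro homogeneous_idealI supported_ideal) (auto simp: in_supported_iff)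

lemma term_ideal_degree_ge: "term_ideal {t. k \<le> tdeg t}"
  by (simp add: term_ideal_def)

lemma ideal_power_irrelevant:
  "ideal_power irrelevant_ideal k = (supported {t. k \<le>
    tdeg t} :: ('v::finite, 'k::field) mpoly set)"
proof (induction k)
  case 0
  show ?case by (auto simp: supported_def)
next
  case (Suc k)
  have irr: "irrelevant_ideal \<subseteq> (supported {t. 1 \<le> tdeg t} :: ('v, 'k) mpoly set)"
    unfolding irrelevant_ideal_def
    by (intro ideal.span_minimal supported_ideal term_ideal_degree_ge) auto
  let ?P = "ideal_power irrelevant_ideal (Suc k) :: ('v, 'k) mpoly set"
  show ?case
  proof
    show "?P \<subseteq> supported {t. Suc k \<le> tdeg t}"
    proof (simp only: ideal_power.simps, intro ideal.span_minimal supported_ideal term_ideal_degree_ge subsetI)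
      fix x :: "('v, 'k) mpoly" assume "x \<in> {a * b |a b. a \<in> irrelevant_ideal \<and> b \<in>
        ideal_power irrelevant_ideal k}"
      then obtain a b where ab: "a \<in> supported {t. 1 \<le> tdeg t}" "b \<in> supported {t. k \<le> tdeg t}" "x =
        a * b"
        using irr Suc.IH by blast
      from keys_mult_subset[OF ab(1,2)] ab(3) show "x \<in> supported {t. Suc k \<le> tdeg t}"
        by (fastforce simp: supported_def)
    qed
    show "supported {t. Suc k \<le> tdeg t} \<subseteq> ?P"
    proof (rule supported_subset_ideal)
      show "ideal.subspace ?P" by simp
      fix t :: "'v tm" assume "t \<in> {t. Suc k \<le> tdeg t}"
      \<comment> \<open>A divisor of degree one is a single variable, so one factor from the
        irrelevant ideal can be split off.\<close>
      then obtain s u where su: "t = s + u" "tdeg s = 1" "k \<le> tdeg u"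
        using tm_split[of 1 t] by auto
      obtain x where "Poly_Mapping.lookup s x \<noteq> 0"
        using su(2) by (metis lookup_zero poly_mapping_eqI tdeg_0 zero_neq_one)
      hence "tm_of_var x + (s - tm_of_var x) = s" by (intro tm_of_var_diff) simp
      moreover from this have "s - tm_of_var x = 0"
        using su(2) tdeg_add[of "tm_of_var x" "s - tm_of_var x"] by simp
      ultimately have s: "s = tm_of_var x" by simp
      have "mono_poly s \<in> (irrelevant_ideal :: ('v, 'k) mpoly set)"
        unfolding s irrelevant_ideal_def by (rule ideal.span_base) simp
      moreover have "mono_poly u \<in> (ideal_power irrelevant_ideal k :: ('v, 'k) mpoly set)"
        using su(3) by (simp add: Suc.IH)
      ultimately have "mono_poly s * mono_poly u \<in> ?P"
        unfolding ideal_power.simps by (intro ideal.span_base) blast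
      thus "mono_poly t \<in> ?P" by (simp add: su(1) mono_poly_mult)
    qed
  qed
qed

text \<open>Multiplication by a term shifts exponents without cancellation, so membership in the
  saturation can be tested separately on each term of \<open>f\<close>.\<close>

lemma saturation_supported:
  "saturation (supported M) = (supported (saturated_terms M) :: ('v::finite, 'k::field) mpoly set)"
proof (intro equalityI subsetI)
  fix f :: "('v, 'k) mpoly" assume "f \<in> saturation (supported M)"
  then obtain k where k: "\<And>g. g \<in> supported {t. k \<le> tdeg t} \<Longrightarrow> f * g \<in> supported M"
    by (auto simp: saturation_def ideal_quotient_def ideal_power_irrelevant)
  have "u + t \<in> M" if "t \<in> Poly_Mapping.keys f" "k \<le> tdeg u" for t u
  proof -
    have "f * mono_poly u \<in> supported M" using that(2) by (intro k) simp
    hence "(+) u ` Poly_Mapping.keys f \<subseteq> M"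
      by (simp add: mult.commute[of f] supported_def keys_mono_poly_mult)
    thus ?thesis using that(1) by blast
  qed
  thus "f \<in> supported (saturated_terms M)" by (auto simp: supported_def saturated_terms_def)
next
  fix f :: "('v, 'k) mpoly" assume f: "f \<in> supported (saturated_terms M)"
  then obtain K where K: "\<And>t u. t \<in> Poly_Mapping.keys f \<Longrightarrow> K t \<le> tdeg u \<Longrightarrow> u + t \<in> M"
    unfolding supported_def saturated_terms_def subset_iff mem_Collect_eq by metis
  \<comment> \<open>The bounds depend on the term; their sum is a common bound for the finitely many
    terms of \<open>f\<close>.\<close>
  define k where "k = (\<Sum>t\<in>Poly_Mapping.keys f. K t)"
  have Kk: "K t \<le> k" if "t \<in> Poly_Mapping.keys f" for t
    unfolding k_def using that by (intro member_le_sum) auto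
  have "f * g \<in> supported M" if g: "g \<in> supported {t. k \<le> tdeg t}" for g
  proof -
    have "(\<Sum>u\<in>Poly_Mapping.keys g. mscale (coeff_of g u) (mono_poly u * f)) \<in> supported M"
    proof (intro mpoly.subspace_sum mpoly.subspace_scale supported_subspace)
      fix u assume "u \<in> Poly_Mapping.keys g"
      hence "k \<le> tdeg u" using g by (auto simp: supported_def)
      thus "mono_poly u * f \<in> supported M"
        using K Kk by (fastforce simp: supported_def keys_mono_poly_mult)
    qed
    thus ?thesis by (subst mult.commute) (simp only: poly_mult_as_sum[of g f])
  qed
  thus "f \<in> saturation (supported M)"
    by (auto simp: saturation_def ideal_quotient_def ideal_power_irrelevant)
qed

lemma subset_saturated_terms: "term_ideal M \<Longrightarrow> M \<subseteq> saturated_terms M"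
  by (auto simp: saturated_terms_def term_ideal_def)

lemma term_ideal_saturated_terms: "term_ideal (saturated_terms M)"
  unfolding term_ideal_def
proof (intro ballI allI)
  fix t u assume "t \<in> saturated_terms M"
  then obtain k where "\<And>w. k \<le> tdeg w \<Longrightarrow> w + t \<in> M" by (auto simp: saturated_terms_def)
  hence "w + (u + t) \<in> M" if "k \<le> tdeg w" for w
    using that by (metis add.assoc tdeg_add trans_le_add1)
  thus "u + t \<in> saturated_terms M" by (auto simp: saturated_terms_def)
qed

lemma saturated_terms_idem:
  assumes "term_ideal M"
  shows "saturated_terms (saturated_terms M) = saturated_terms M"
proof
  show "saturated_terms M \<subseteq> saturated_terms (saturated_terms M)"
    by (rule subset_saturated_terms[OF term_ideal_saturated_terms])
  show "saturated_terms (saturated_terms M) \<subseteq> saturated_terms M"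
  proof
    fix t assume "t \<in> saturated_terms (saturated_terms M)"
    then obtain k where "\<And>u. k \<le> tdeg u \<Longrightarrow> u + t \<in> saturated_terms M"
      by (auto simp: saturated_terms_def[of "saturated_terms M"])
    hence "\<forall>u. \<exists>l. k \<le> tdeg u \<longrightarrow> (\<forall>w. l \<le> tdeg w \<longrightarrow> w + (u + t) \<in> M)"
      by (auto simp: saturated_terms_def)
    then obtain l where l: "\<And>u w. k \<le> tdeg u \<Longrightarrow> l u \<le> tdeg w \<Longrightarrow> w + (u + t) \<in> M" by metis
    \<comment> \<open>The inner bound depends on the multiplier \<open>u\<close>, but multipliers of
      degree exactly \<open>k\<close> suffice, and there are finitely many of them.\<close>
    define N where "N = (\<Sum>u\<in>deg_terms k. l u)"
    have "w + t \<in> M" if "k + N \<le> tdeg w" for w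
    proof -
      have "k \<le> tdeg w" using that by simp
      then obtain u w' where u: "w = u + w'" "tdeg u = k" using tm_split by blast
      have "l u \<le> N" unfolding N_def
        by (rule member_le_sum)
          (simp_all add: deg_terms_def[of k] u(2) finite_deg_terms[of k, unfolded deg_terms_def])
      hence "w' + (u + t) \<in> M" using l[of u w'] u that by simp
      thus ?thesis by (simp add: u(1) ac_simps)
    qed
    thus "t \<in> saturated_terms M" by (auto simp: saturated_terms_def)
  qed
qed

text \<open>By \<open>dickson\<close> finitely many terms generate the saturation, each with its own
  bound. In large degree the cofactor exceeds the bound of the generator used.\<close>

lemma saturated_terms_eventually:
  shows "\<exists>N. \<forall>d\<ge>N. saturated_terms M \<inter> deg_terms d \<subseteq> M"
proof -
  obtain F where F: "F \<subseteq> saturated_terms M" "finite F" "\<forall>t\<in>saturated_terms M. \<exists>g\<in>F. \<exists>u. t = g + u"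
    using dickson[of "saturated_terms M"] by (elim exE conjE)
  have "\<forall>g\<in>F. \<exists>k. \<forall>u. k \<le> tdeg u \<longrightarrow> u + g \<in> M" using F(1) by (auto simp: saturated_terms_def)
  then obtain k where k: "\<And>g u. g \<in> F \<Longrightarrow> k g \<le> tdeg u \<Longrightarrow> u + g \<in> M" by metis
  define N where "N = (\<Sum>g\<in>F. tdeg g + k g)"
  have "t \<in> M" if asm: "N \<le> d" "t \<in> saturated_terms M" "tdeg t = d" for t d
  proof -
    obtain g u where g: "g \<in> F" "t = g + u" using F(3) asm(2) by blast
    have "tdeg g + k g \<le> N" unfolding N_def using g(1) F(2) by (intro member_le_sum) auto
    hence "k g \<le> tdeg u" using asm(1,3) g(2) by simp
    thus ?thesis using k[OF g(1)] g(2) by (simp add: add.commute[of g u])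
  qed
  thus ?thesis by (auto simp: deg_terms_def)
qed

lemma truncate_ge_supported:
  "truncate_ge m (supported M) = (supported (M \<inter> {t. m \<le>
    tdeg t}) :: ('v::finite, 'k::field) mpoly set)"
proof
  show "truncate_ge m (supported M) \<subseteq> (supported (M \<inter> {t. m \<le> tdeg t}) :: ('v, 'k) mpoly set)"
    unfolding truncate_ge_def
    by (rule mpoly.span_minimal[OF _ supported_subspace])
      (auto simp: hom_part_eq_supported in_supported_iff deg_terms_def)
  show "(supported (M \<inter> {t. m \<le> tdeg t}) :: ('v, 'k) mpoly set) \<subseteq> truncate_ge m (supported M)"
    unfolding truncate_ge_def span_mono_poly[symmetric, of "_ \<inter> _"]
  proof (rule mpoly.span_mono, rule subsetI)
    fix x :: "('v, 'k) mpoly" assume "x \<in> mono_poly ` (M \<inter> {t. m \<le> tdeg t})"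
    then obtain t where "t \<in> M" "m \<le> tdeg t" "x = mono_poly t" by blast
    thus "x \<in> (\<Union>t\<in>{m..}. supported M \<inter> hom_part t)"
      by (intro UN_I[of "tdeg t"]) (auto simp: hom_part_eq_supported deg_terms_def)
  qed
qed

section \<open>The initial ideal of a point of the Hilbert scheme\<close>

context ordered_terms
begin

lemma lead_terms_term_ideal:
  fixes I :: "('v, 'k::field) mpoly set"
  shows "ideal.subspace I \<Longrightarrow> term_ideal (lead_terms prec I)"
  unfolding term_ideal_def using lead_terms_ideal by blast

text \<open>Stated for an arbitrary point because it is applied to V and to its translates g(V); the
  first conclusion supplies the dimension that the Pluecker criteria need.\<close>

theorem initial_ideal_hilbert_point:
  fixes V :: "('v, 'k::field) mpoly set"
  assumes gotzmann: "\<forall>J\<in>(subscheme_ideals p :: ('v, 'k) mpoly set set). regular_ideal r J"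
    and rm: "r \<le> m" and card: "CARD('v) = n + 1"
    and q: "of_nat q = of_nat ((n + m) choose n) - poly p (of_nat m)"
    and V: "V \<in> hilbert_scheme_points p m"
  shows "V \<in> grassmannian m q"
    and "has_hilbert_polynomial (ideal.span (vs (in_wedge prec m q V)) :: ('v, 'k) mpoly set) p"
    and "ideal.span (vs (in_wedge prec m q V)) = initial_ideal prec (ideal.span V)"
    and "initial_ideal prec (ideal.span V) =
      truncate_ge m (saturation (initial_ideal prec (ideal.span V)))"
proof -
  note regular = bspec[OF gotzmann]
  obtain J :: "('v, 'k) mpoly set" where J: "J \<in> subscheme_ideals p" "V = J \<inter> hom_part m"
    using V unfolding hilbert_scheme_points_def by blast
  have Jh: "homogeneous_ideal J" "has_hilbert_polynomial J p" using J(1)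
    by (auto simp: subscheme_ideals_def)
  note Ji = homogeneous_ideal_ideal[OF Jh(1)]
  have HFJ: "of_nat (hilbert_function J t) = poly p (of_nat t)" if "r \<le> t" for t
    by (rule regular_ideal_hilbert_function[OF regular[OF J(1)] Jh(2) that])
  define I where "I = ideal.span V"
  have Ih: "homogeneous_ideal I"
    unfolding homogeneous_ideal_def I_def using J(2) by (intro exI[of _ V]) auto
  note Ii = homogeneous_ideal_ideal[OF Ih]
  \<comment> \<open>\<open>J\<close> is generated in degrees at most \<open>r\<close>, so degree
    \<open>m\<close> generates everything above it.\<close>
  have I_eq: "I \<inter> hom_part t = J \<inter> hom_part t" if "m \<le> t" for t
  proof
    have "I \<subseteq> J" unfolding I_def using J(2) Ji by (intro ideal.span_minimal) auto
    thus "I \<inter> hom_part t \<subseteq> J \<inter> hom_part t" by blast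
    show "J \<inter> hom_part t \<subseteq> I \<inter> hom_part t"
      using regular_ideal_generated[OF regular[OF J(1)] rm that] by (auto simp: I_def J(2))
  qed
  have I_ge: "I \<subseteq> supported {t. m \<le> tdeg t}"
    unfolding I_def using J(2)
    by (intro ideal.span_minimal supported_ideal term_ideal_degree_ge)
      (auto simp: hom_part_eq_supported supported_def deg_terms_def)
  have HFI: "of_nat (hilbert_function I t) = poly p (of_nat t)" if "m \<le> t" for t
    using HFJ[of t] I_eq[OF that] that rm by (simp add: hilbert_function_def)
  obtain B where B: "finite B" "hom_part m \<subseteq> mpoly.span (B :: ('v, 'k) mpoly set)"
    using hom_part_finite_span by blast
  have "mpoly.dim V \<le> mpoly.dim (hom_part m :: ('v, 'k) mpoly set)"
    unfolding J(2) by (rule mpoly.finite_dim_subspace_mono[OF _ B(2,1)]) simp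
  moreover have "mpoly.dim (hom_part m :: ('v, 'k) mpoly set) = (n + m) choose n"
    by (simp add: dim_hom_part card_deg_terms[OF card])
  ultimately have "(of_nat (mpoly.dim V) :: rat) = of_nat q"
    unfolding q using HFJ[OF rm] by (simp add: hilbert_function_def J(2) of_nat_diff)
  moreover have "mpoly.subspace V" unfolding J(2)
    by (intro mpoly.subspace_inter ideal_subspace_mpoly Ji hom_part_subspace)
  ultimately show Vg: "V \<in> grassmannian m q" by (simp add: grassmannian_def J(2))
  define M where "M = lead_terms prec I"
  have Mt: "term_ideal M" unfolding M_def by (rule lead_terms_term_ideal[OF Ii])
  have init: "initial_ideal prec I = supported M"
    unfolding M_def by (rule initial_ideal_eq_supported[OF Ii])
  have M_ge: "M \<subseteq> {t. m \<le> tdeg t}" unfolding M_def by (rule lead_terms_subset[OF I_ge])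
  have HFM: "of_nat (hilbert_function (supported M :: ('v, 'k) mpoly set) t) = poly p (of_nat t)"
    if "m \<le> t" for t
    unfolding M_def hilbert_function_lead_terms[OF Ih] by (rule HFI[OF that])
  have HPM: "has_hilbert_polynomial (supported M :: ('v, 'k) mpoly set) p"
    unfolding has_hilbert_polynomial_def eventually_sequentially using HFM by blast
  \<comment> \<open>Saturating changes \<open>M\<close> in finitely many degrees only, so the
    Hilbert polynomial is kept; being saturated, \<open>?J'\<close> is the ideal of a subscheme, and
    the bound \<open>r\<close> applies to it.\<close>
  let ?J' = "supported (saturated_terms M) :: ('v, 'k) mpoly set"
  obtain N where N: "\<And>d. N \<le> d \<Longrightarrow> saturated_terms M \<inter> deg_terms d \<subseteq> M"
    using saturated_terms_eventually by blast
  have "hilbert_function ?J' d = hilbert_function (supported M :: ('v, 'k) mpoly set) d" if "N \<le> d"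
    for d
  proof -
    have "saturated_terms M \<inter> deg_terms d = M \<inter> deg_terms d"
      using N[OF that] subset_saturated_terms[OF Mt] by blast
    thus ?thesis by (simp add: hilbert_function_supported)
  qed
  hence "has_hilbert_polynomial ?J' p"
    using HPM unfolding has_hilbert_polynomial_def eventually_sequentially
      by (metis le_trans nat_le_linear)
  hence J': "?J' \<in> subscheme_ideals p"
    unfolding subscheme_ideals_def
    by (simp add: supported_homogeneous term_ideal_saturated_terms saturation_supported saturated_terms_idem[OF Mt])
  have HFJ': "of_nat (hilbert_function ?J' t) = poly p (of_nat t)" if "r \<le> t" for t
    by (rule regular_ideal_hilbert_function[OF regular[OF J'] \<open>has_hilbert_polynomial ?J' p\<close> that])
  \<comment> \<open>One set contains the other, and their complements in degree \<open>t\<close>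
    both have p(t) elements.\<close>
  have M_eq: "M \<inter> deg_terms t = saturated_terms M \<inter> deg_terms t" if "m \<le> t" for t
  proof (rule card_seteq)
    show "M \<inter> deg_terms t \<subseteq> saturated_terms M \<inter> deg_terms t"
      using subset_saturated_terms[OF Mt] by blast
    have "(of_nat (hilbert_function ?J' t) :: rat) =
      of_nat (hilbert_function (supported M :: ('v, 'k) mpoly set) t)"
      using HFJ' HFM that rm by simp
    hence "card (deg_terms t :: 'v tm set) - card (saturated_terms M \<inter> deg_terms t)
        = card (deg_terms t :: 'v tm set) - card (M \<inter> deg_terms t)"
      by (simp add: hilbert_function_supported)
    moreover have "card (saturated_terms M \<inter> deg_terms t) \<le> card (deg_terms t :: 'v tm set)"
      "card (M \<inter> deg_terms t) \<le> card (deg_terms t :: 'v tm set)" by (auto intro: card_mono)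
    ultimately show "card (saturated_terms M \<inter> deg_terms t) \<le> card (M \<inter> deg_terms t)" by simp
  qed simp
  \<comment> \<open>Below degree \<open>m\<close> there is nothing in \<open>M\<close>, as
    \<open>I\<close> is generated in degree \<open>m\<close>.\<close>
  have "M = saturated_terms M \<inter> {t. m \<le> tdeg t}"
    using M_eq M_ge unfolding deg_terms_def by blast
  thus "initial_ideal prec (ideal.span V) =
    truncate_ge m (saturation (initial_ideal prec (ideal.span V)))"
    unfolding I_def[symmetric] init saturation_supported truncate_ge_supported by simp
  \<comment> \<open>Generation in degree \<open>m\<close> comes from regularity of the saturation:
    its part of degree \<open>m\<close>, which equals that of \<open>M\<close>, generates all terms
    of \<open>M\<close>.\<close>
  have "supported M \<subseteq> ideal.span (supported (M \<inter> deg_terms m) :: ('v, 'k) mpoly set)"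
  proof (rule supported_subset_ideal)
    fix t assume t: "t \<in> M"
    hence "m \<le> tdeg t" using M_ge by blast
    moreover have "mono_poly t \<in> ?J' \<inter> hom_part (tdeg t)"
      using t subset_saturated_terms[OF Mt] by (auto simp: hom_part_eq_supported deg_terms_def)
    ultimately have "mono_poly t \<in> ideal.span (?J' \<inter> hom_part m)"
      using regular_ideal_generated[OF regular[OF J'] rm] by blast
    thus "mono_poly t \<in> ideal.span (supported (M \<inter> deg_terms m) :: ('v, 'k) mpoly set)"
      by (simp add: hom_part_eq_supported supported_Int M_eq)
  qed simp
  moreover have "ideal.span (supported (M \<inter> deg_terms m) :: ('v, 'k) mpoly set) \<subseteq> supported M"
    by (intro ideal.span_minimal supported_ideal Mt) (auto simp: supported_def)
  moreover have "lead_terms prec V = M \<inter> deg_terms m"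
    unfolding M_def lead_terms_homogeneous[OF Ih] I_eq[OF order_refl] J(2) ..
  hence "vs (in_wedge prec m q V) = (supported (M \<inter> deg_terms m) :: ('v, 'k) mpoly set)"
    unfolding vs_def set_in_wedge(1)[OF Vg] span_mono_poly by simp
  ultimately have span: "ideal.span (vs (in_wedge prec m q V)) =
    (supported M :: ('v, 'k) mpoly set)" by auto
  show "has_hilbert_polynomial (ideal.span (vs (in_wedge prec m q V)) :: ('v, 'k) mpoly set) p"
    unfolding span by (rule HPM)
  show "ideal.span (vs (in_wedge prec m q V)) = initial_ideal prec (ideal.span V)"
    unfolding span I_def[symmetric] init ..
qed

end

section \<open>Substitution homomorphisms\<close>

lemma poly_sum_superset:
  fixes f :: "('v, 'k::field) mpoly"
  assumes "finite T" "f \<in> supported T"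
  shows "f = (\<Sum>t\<in>T. mscale (coeff_of f t) (mono_poly t))"
proof -
  have "(\<Sum>t\<in>Poly_Mapping.keys f. mscale (coeff_of f t) (mono_poly t)) =
    (\<Sum>t\<in>T. mscale (coeff_of f t) (mono_poly t))"
    using assms by (intro sum.mono_neutral_left) (auto simp: supported_def in_keys_iff)
  thus ?thesis using poly_as_sum[of f] by simp
qed

text \<open>The action of a matrix on S and the evaluation of a polynomial at a matrix both replace
  terms multiplicatively; the locale proves the homomorphism laws once for both.\<close>

locale substitution =
  fixes c :: "'k::field \<Rightarrow> 'r::comm_ring_1" and E :: "'v tm \<Rightarrow> 'r"
    and \<sigma> :: "('v, 'k) mpoly \<Rightarrow> 'r"
  assumes subst_def: "\<sigma> f = (\<Sum>t\<in>Poly_Mapping.keys f. c (coeff_of f t) * E t)"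
    and c_0: "c 0 = 0" and c_1: "c 1 = 1"
    and c_add: "c (a + b) = c a + c b" and c_mult: "c (a * b) = c a * c b"
    and E_0: "E 0 = 1" and E_add: "E (s + t) = E s * E t"
begin

lemma subst_superset:
  assumes "finite T" "Poly_Mapping.keys f \<subseteq> T"
  shows "\<sigma> f = (\<Sum>t\<in>T. c (coeff_of f t) * E t)"
  unfolding subst_def using assms by (intro sum.mono_neutral_left) (auto simp: in_keys_iff c_0)

lemma subst_add: "\<sigma> (f + g) = \<sigma> f + \<sigma> g"
proof -
  let ?T = "Poly_Mapping.keys f \<union> Poly_Mapping.keys g"
  have "\<sigma> (f + g) = (\<Sum>t\<in>?T. c (coeff_of (f + g) t) * E t)"
    using keys_add[of f g] by (intro subst_superset) auto
  also have "\<dots> = (\<Sum>t\<in>?T. c (coeff_of f t) * E t) + (\<Sum>t\<in>?T. c (coeff_of g t) * E t)"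
    by (simp add: lookup_add c_add distrib_right sum.distrib)
  also have "\<dots> = \<sigma> f + \<sigma> g"
    using subst_superset[of ?T f] subst_superset[of ?T g] by simp
  finally show ?thesis .
qed

lemma subst_0: "\<sigma> 0 = 0"
  by (simp add: subst_def)

lemma subst_sum: "\<sigma> (\<Sum>x\<in>X. f x) = (\<Sum>x\<in>X. \<sigma> (f x))"
  by (induction X rule: infinite_finite_induct) (auto simp: subst_0 subst_add)

lemma subst_single: "\<sigma> (Poly_Mapping.single t a) = c a * E t"
  by (cases "a = 0") (simp_all add: subst_def c_0)

lemma subst_mono_poly: "\<sigma> (mono_poly t) = E t"
  by (simp add: mono_poly_def subst_single c_1)

lemma subst_const_poly: "\<sigma> (const_poly a) = c a"
  by (simp add: const_poly_def subst_single E_0)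

lemma subst_1: "\<sigma> 1 = 1"
  using subst_mono_poly[of 0] by (simp add: mono_poly_0 E_0)

lemma subst_mult: "\<sigma> (f * g) = \<sigma> f * \<sigma> g"
proof -
  have "f * g = (\<Sum>s\<in>Poly_Mapping.keys f. \<Sum>t\<in>Poly_Mapping.keys g.
      Poly_Mapping.single (s + t) (coeff_of f s * coeff_of g t))"
    by (subst (1) poly_as_sum[of f], subst (1) poly_as_sum[of g])
      (simp add: sum_product mscale_def const_poly_def mono_poly_def mult_single)
  hence "\<sigma> (f * g) = (\<Sum>s\<in>Poly_Mapping.keys f. \<Sum>t\<in>Poly_Mapping.keys g.
      (c (coeff_of f s) * E s) * (c (coeff_of g t) * E t))"
    by (simp add: subst_sum subst_single c_mult E_add mult_ac)
  thus ?thesis by (simp add: subst_def sum_product)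
qed

lemma subst_power: "\<sigma> (f ^ k) = \<sigma> f ^ k"
  by (induction k) (auto simp: subst_1 subst_mult)

lemma subst_prod: "\<sigma> (\<Prod>x\<in>X. f x) = (\<Prod>x\<in>X. \<sigma> (f x))"
  by (induction X rule: infinite_finite_induct) (auto simp: subst_1 subst_mult)

end

section \<open>The action of the general linear group\<close>

definition linear_form :: "'k::field ^ 'v ^ 'v \<Rightarrow> 'v::finite \<Rightarrow> ('v, 'k) mpoly" where
  "linear_form g i = (\<Sum>j\<in>UNIV. const_poly (vec_nth (vec_nth g i) j) * mono_poly (tm_of_var j))"

definition form_monomial :: "'k::field ^ 'v ^ 'v \<Rightarrow> 'v::finite tm \<Rightarrow> ('v, 'k) mpoly" where
  "form_monomial g t = (\<Prod>i\<in>UNIV. linear_form g i ^ Poly_Mapping.lookup t i)"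

lemma const_poly_mult: "const_poly (a * b) = const_poly a * (const_poly b :: ('v, 'k::field) mpoly)"
  by (simp add: const_poly_def mult_single)

lemma const_poly_add: "const_poly (a + b) = const_poly a + (const_poly b :: ('v, 'k::field) mpoly)"
  by (simp add: const_poly_def single_add)

lemma const_poly_0: "const_poly 0 = (0 :: ('v, 'k::field) mpoly)"
  by (simp add: const_poly_def)

lemma const_poly_1: "const_poly 1 = (1 :: ('v, 'k::field) mpoly)"
  by (simp add: const_poly_def)

lemma const_poly_sum: "const_poly (\<Sum>x\<in>X. f x) = (\<Sum>x\<in>X. const_poly (f x) :: ('v, 'k::field) mpoly)"
  by (induction X rule: infinite_finite_induct) (auto simp: const_poly_0 const_poly_add)

interpretation gl: substitution const_poly "form_monomial g" "gl_act g"
  for g :: "'k::field ^ 'v ^ 'v::finite"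
  by unfold_locales
    (simp_all add: gl_act_def form_monomial_def linear_form_def const_poly_0 const_poly_1
      const_poly_add const_poly_mult lookup_add power_add prod.distrib)

lemma form_monomial_var: "form_monomial g (tm_of_var j) = linear_form g j"
proof -
  have "form_monomial g (tm_of_var j) = (\<Prod>i\<in>UNIV. if i = j then linear_form g j else 1)"
    unfolding form_monomial_def
      by (intro prod.cong) (auto simp: tm_of_var_def lookup_single when_def)
  thus ?thesis by simp
qed

lemma gl_act_linear_form: "gl_act h (linear_form g i) = linear_form (g ** h) i"
proof -
  have "gl_act h (linear_form g i) =
    (\<Sum>j\<in>UNIV. const_poly (vec_nth (vec_nth g i) j) * linear_form h j)"
    by (simp add: linear_form_def[of g] gl.subst_sum gl.subst_mult gl.subst_const_poly
        gl.subst_mono_poly form_monomial_var)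
  also have "\<dots> = (\<Sum>j\<in>UNIV. \<Sum>k\<in>UNIV. const_poly (vec_nth (vec_nth g i) j * vec_nth (vec_nth h j) k) * mono_poly (tm_of_var k))"
    by (simp add: linear_form_def sum_distrib_left const_poly_mult mult.assoc)
  also have "\<dots> = (\<Sum>k\<in>UNIV. \<Sum>j\<in>UNIV. const_poly (vec_nth (vec_nth g i) j * vec_nth (vec_nth h j) k) * mono_poly (tm_of_var k))"
    by (rule sum.swap)
  also have "\<dots> = linear_form (g ** h) i"
    by (simp add: linear_form_def matrix_matrix_mult_def const_poly_sum sum_distrib_right)
  finally show ?thesis .
qed

text \<open>Substitution reverses the order: the i-th variable becomes row i of \<open>g\<close>,
  and acting by \<open>h\<close> turns this into row i of \<open>g ** h\<close>.\<close>

lemma gl_act_comp: "gl_act h (gl_act g f) = gl_act (g ** h) f"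
proof -
  have "gl_act h (gl_act g f) =
      (\<Sum>t\<in>Poly_Mapping.keys f. const_poly (coeff_of f t) * gl_act h (form_monomial g t))"
    by (simp add: gl.subst_def[of g] gl.subst_sum gl.subst_mult gl.subst_const_poly)
  also have "\<dots> = (\<Sum>t\<in>Poly_Mapping.keys f. const_poly (coeff_of f t) * form_monomial (g ** h) t)"
    by (simp add: form_monomial_def gl.subst_prod gl.subst_power gl_act_linear_form)
  finally show ?thesis by (simp add: gl.subst_def)
qed

lemma mono_poly_power: "mono_poly (tm_of_var i) ^ k =
  (mono_poly (Poly_Mapping.single i k) :: ('v, 'k::field) mpoly)"
  by (induction k) (simp_all add: mono_poly_0 mono_poly_mult tm_of_var_def single_add[symmetric])

lemma mono_poly_prod: "(\<Prod>x\<in>X. mono_poly (f x)) = (mono_poly (\<Sum>x\<in>X. f x) :: ('v, 'k::field) mpoly)"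
  by (induction X rule: infinite_finite_induct) (auto simp: mono_poly_0 mono_poly_mult)

lemma tm_as_sum: "(\<Sum>i\<in>UNIV. Poly_Mapping.single i (Poly_Mapping.lookup t i)) = (t :: 'v::finite tm)"
  by (rule poly_mapping_eqI) (simp add: lookup_sum lookup_single when_def)

lemma gl_act_mat_1: "gl_act (Finite_Cartesian_Product.mat 1 :: 'k::field ^ 'v ^ 'v::finite) f = f"
proof -
  have lin: "linear_form (Finite_Cartesian_Product.mat 1 :: 'k ^ 'v ^ 'v) i =
    mono_poly (tm_of_var i)" for i
  proof -
    have "linear_form (Finite_Cartesian_Product.mat 1 :: 'k ^ 'v ^ 'v) i = (\<Sum>j\<in>UNIV.
      if j = i then mono_poly (tm_of_var j) else 0)"
      unfolding linear_form_def
        by (intro sum.cong) (auto simp: Finite_Cartesian_Product.mat_def const_poly_0 const_poly_1)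
    thus ?thesis by simp
  qed
  have "form_monomial (Finite_Cartesian_Product.mat 1 :: 'k ^ 'v ^ 'v) t = mono_poly t" for t
    unfolding form_monomial_def lin mono_poly_power mono_poly_prod tm_as_sum ..
  thus ?thesis using poly_as_sum[of f] by (simp add: gl.subst_def mscale_def)
qed

lemma mat_1_GL: "Finite_Cartesian_Product.mat 1 \<in> GL"
  unfolding GL_def invertible_def mem_Collect_eq
  by (rule exI[of _ "Finite_Cartesian_Product.mat 1"]) simp

lemma gl_act_mscale: "gl_act g (mscale a f) = mscale a (gl_act g f)"
  by (simp add: mscale_def gl.subst_mult gl.subst_const_poly)

lemma linear_gl_act: "Vector_Spaces.linear mscale mscale (gl_act g)"
  by unfold_locales (auto simp: gl.subst_add gl_act_mscale)

lemma hom_part_power: "(f :: ('v::finite, 'k::field) mpoly) \<in> hom_part d \<Longrightarrow> f ^ k \<in> hom_part (k * d)"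
proof (induction k)
  case 0
  show ?case by (simp add: hom_part_def)
next
  case (Suc k)
  thus ?case using hom_part_mult[of f d "f ^ k" "k * d"] by simp
qed

lemma hom_part_prod:
  assumes "\<And>x. x \<in> X \<Longrightarrow> (f x :: ('v::finite, 'k::field) mpoly) \<in> hom_part (d x)"
  shows "(\<Prod>x\<in>X. f x) \<in> hom_part (\<Sum>x\<in>X. d x)"
  using assms
  by (induction X rule: infinite_finite_induct) (auto simp: hom_part_def[of 0] intro: hom_part_mult)

lemma form_monomial_hom: "form_monomial g t \<in> hom_part (tdeg t)"
proof -
  have "linear_form g i \<in> hom_part 1" for i
    unfolding linear_form_def mscale_def[symmetric]
    by (intro mpoly.subspace_sum mpoly.subspace_scale hom_part_subspace)
      (simp add: hom_part_eq_supported deg_terms_def)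
  hence "linear_form g i ^ k \<in> hom_part k" for i k using hom_part_power[of "linear_form g i" 1 k]
    by simp
  thus ?thesis unfolding form_monomial_def tdeg_def by (intro hom_part_prod)
qed

lemma gl_act_hom_part: "f \<in> hom_part d \<Longrightarrow> gl_act g f \<in> hom_part d"
  unfolding gl.subst_def mscale_def[symmetric]
  by (intro mpoly.subspace_sum mpoly.subspace_scale hom_part_subspace)
    (use form_monomial_hom in \<open>fastforce simp: hom_part_def\<close>)

lemma gl_act_degree_ge:
  assumes "f \<in> supported {t. k \<le> tdeg t}"
  shows "gl_act g f \<in> supported {t. k \<le> tdeg t}"
  unfolding gl.subst_def mscale_def[symmetric]
proof (intro mpoly.subspace_sum mpoly.subspace_scale supported_subspace)
  fix t assume "t \<in> Poly_Mapping.keys f"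
  hence "k \<le> tdeg t" using assms by (auto simp: supported_def)
  thus "form_monomial g t \<in> supported {t. k \<le> tdeg t}"
    using form_monomial_hom[of g t] by (auto simp: hom_part_def supported_def)
qed

text \<open>An explicit inverse turns images under \<open>gl_act g\<close> into preimages under
  \<open>gl_act h\<close>, so that membership in an image becomes a plain membership.\<close>

locale gl_pair =
  fixes g h :: "'k::field ^ 'v ^ 'v::finite"
  assumes gh: "g ** h = Finite_Cartesian_Product.mat 1"
    and hg: "h ** g = Finite_Cartesian_Product.mat 1"
begin

lemma inv1 [simp]: "gl_act h (gl_act g f) = f"
  by (simp add: gl_act_comp gh gl_act_mat_1)

lemma inv2 [simp]: "gl_act g (gl_act h f) = f"
  by (simp add: gl_act_comp hg gl_act_mat_1)

lemma mem_image_iff: "f \<in> gl_act g ` A \<longleftrightarrow> gl_act h f \<in> A"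
  by (metis imageE image_eqI inv1 inv2)

lemma inj: "inj (gl_act g)"
  by (metis injI inv1)

lemma image_ideal: "ideal.subspace I \<Longrightarrow> ideal.subspace (gl_act g ` I)"
  by (rule ideal.subspaceI)
    (simp_all add: mem_image_iff gl.subst_0 gl.subst_add gl.subst_mult ideal.subspace_0
      ideal.subspace_add ideal.subspace_scale)

lemma image_span: "gl_act g ` ideal.span B = ideal.span (gl_act g ` B)"
proof
  have *: "gl_act g' ` ideal.span B \<subseteq> ideal.span (gl_act g' ` B)" for g' :: "'k ^ 'v ^ 'v" and B
  proof
    fix x assume "x \<in> gl_act g' ` ideal.span B"
    then obtain f where f: "f \<in> ideal.span B" "x = gl_act g' f" by blast
    from f(1) have "gl_act g' f \<in> ideal.span (gl_act g' ` B)"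
      by (induction rule: ideal.span_induct_alt)
        (simp_all add: gl.subst_0 gl.subst_add gl.subst_mult ideal.span_zero ideal.span_add ideal.span_scale ideal.span_base)
    thus "x \<in> ideal.span (gl_act g' ` B)" by (simp add: f(2))
  qed
  show "gl_act g ` ideal.span B \<subseteq> ideal.span (gl_act g ` B)" by (rule *)
  show "ideal.span (gl_act g ` B) \<subseteq> gl_act g ` ideal.span B"
    by (rule ideal.span_minimal[OF _ image_ideal]) (auto intro: ideal.span_base)
qed

lemma image_Int_hom_part: "gl_act g ` I \<inter> hom_part d = gl_act g ` (I \<inter> hom_part d)"
proof (intro equalityI subsetI)
  fix f assume "f \<in> gl_act g ` I \<inter> hom_part d"
  thus "f \<in> gl_act g ` (I \<inter> hom_part d)" by (simp add: mem_image_iff gl_act_hom_part)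
next
  fix f assume f: "f \<in> gl_act g ` (I \<inter> hom_part d)"
  hence "gl_act h f \<in> I \<inter> hom_part d" by (simp add: mem_image_iff)
  hence "f \<in> hom_part d" using gl_act_hom_part[of "gl_act h f" d g] by simp
  thus "f \<in> gl_act g ` I \<inter> hom_part d" using f by blast
qed

lemma image_homogeneous:
  assumes "homogeneous_ideal I"
  shows "homogeneous_ideal (gl_act g ` I)"
proof -
  obtain B where B: "B \<subseteq> (\<Union>d. hom_part d)" "I = ideal.span B"
    using assms unfolding homogeneous_ideal_def by blast
  have "gl_act g ` B \<subseteq> (\<Union>d. hom_part d)"
  proof
    fix x assume "x \<in> gl_act g ` B"
    then obtain f d where "f \<in> hom_part d" "x = gl_act g f" using B(1) by blast
    thus "x \<in> (\<Union>d. hom_part d)" using gl_act_hom_part by blast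
  qed
  thus ?thesis unfolding homogeneous_ideal_def B(2) image_span by blast
qed

lemma dim_image:
  assumes "mpoly.subspace W" "W \<subseteq> hom_part d"
  shows "mpoly.dim (gl_act g ` W) = mpoly.dim W"
proof -
  interpret lin: Vector_Spaces.linear mscale mscale "gl_act g" by (rule linear_gl_act)
  obtain B where B: "finite B" "hom_part d \<subseteq> mpoly.span (B :: ('v, 'k) mpoly set)"
    using hom_part_finite_span by blast
  have "x = 0" if "gl_act g x = 0" for x using inv1[of x] that by (simp add: gl.subst_0)
  hence "{x \<in> W. gl_act g x = 0} \<subseteq> mpoly.span {}" by auto
  from mpoly.dim_le_card[OF this] have "mpoly.dim {x \<in> W. gl_act g x = 0} = 0" by simp
  thus ?thesis using lin.rank_nullity[OF assms(1) _ B(1)] assms(2) B(2) by simp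
qed

text \<open>The powers of the irrelevant ideal are stable under substitutions by
  \<open>gl_act_degree_ge\<close>, so the same exponent \<open>k\<close> serves on both
  sides.\<close>

lemma image_saturation: "saturation (gl_act g ` I) = gl_act g ` saturation I"
proof (intro equalityI subsetI)
  fix f assume "f \<in> saturation (gl_act g ` I)"
  then obtain k where k: "\<And>e. e \<in> supported {t. k \<le> tdeg t} \<Longrightarrow> f * e \<in> gl_act g ` I"
    by (auto simp: saturation_def ideal_quotient_def ideal_power_irrelevant)
  have "gl_act h f * e \<in> I" if "e \<in> supported {t. k \<le> tdeg t}" for e
    using k[OF gl_act_degree_ge[OF that, of g]] by (simp add: mem_image_iff gl.subst_mult)
  thus "f \<in> gl_act g ` saturation I"
    unfolding mem_image_iff by (auto simp: saturation_def ideal_quotient_def ideal_power_irrelevant)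
next
  fix f assume "f \<in> gl_act g ` saturation I"
  then obtain k where k: "\<And>e. e \<in> supported {t. k \<le> tdeg t} \<Longrightarrow> gl_act h f * e \<in> I"
    unfolding mem_image_iff by (auto simp: saturation_def ideal_quotient_def ideal_power_irrelevant)
  have "f * e \<in> gl_act g ` I" if "e \<in> supported {t. k \<le> tdeg t}" for e
    using k[OF gl_act_degree_ge[OF that, of h]] by (simp add: mem_image_iff gl.subst_mult)
  thus "f \<in> saturation (gl_act g ` I)"
    by (auto simp: saturation_def ideal_quotient_def ideal_power_irrelevant)
qed

lemma image_subscheme_ideal:
  assumes "J \<in> subscheme_ideals p"
  shows "gl_act g ` J \<in> subscheme_ideals p"
proof -
  have J: "homogeneous_ideal J" "saturation J = J" "has_hilbert_polynomial J p"
    using assms by (auto simp: subscheme_ideals_def)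
  have "mpoly.subspace (J \<inter> hom_part d)" for d
    by (intro mpoly.subspace_inter ideal_subspace_mpoly homogeneous_ideal_ideal[OF J(1)] hom_part_subspace)
  hence "hilbert_function (gl_act g ` J) d = hilbert_function J d" for d
    using dim_image[of "J \<inter> hom_part d" d] by (simp add: hilbert_function_def image_Int_hom_part)
  thus ?thesis using J image_homogeneous[OF J(1)]
    by (simp add: subscheme_ideals_def image_saturation has_hilbert_polynomial_def)
qed

lemma image_hilbert_point:
  assumes "V \<in> hilbert_scheme_points p m"
  shows "gl_act g ` V \<in> hilbert_scheme_points p m"
proof -
  obtain J where J: "V = J \<inter> hom_part m" "J \<in> subscheme_ideals p"
    using assms unfolding hilbert_scheme_points_def by blast
  have "gl_act g ` V = gl_act g ` J \<inter> hom_part m" by (simp add: J(1) image_Int_hom_part)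
  thus ?thesis using image_subscheme_ideal[OF J(2)] unfolding hilbert_scheme_points_def by blast
qed

lemma image_basis_list:
  assumes "is_basis_list bs V"
  shows "is_basis_list (map (gl_act g) bs) (gl_act g ` V)"
proof -
  interpret lin: Vector_Spaces.linear mscale mscale "gl_act g" by (rule linear_gl_act)
  have "mpoly.independent (gl_act g ` set bs)"
    using assms inj by (intro lin.independent_injective_image)
      (auto simp: is_basis_list_def intro: inj_on_subset)
  moreover have "distinct (map (gl_act g) bs)"
    using assms inj by (auto simp: is_basis_list_def distinct_map intro: inj_on_subset)
  moreover have "mpoly.span (gl_act g ` set bs) = gl_act g ` V"
    using assms by (simp add: is_basis_list_def lin.span_image)
  ultimately show ?thesis by (simp add: is_basis_list_def)
qed

end

lemma gl_pair_exists:
  assumes "g \<in> GL"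
  shows "\<exists>h. gl_pair g h"
  using assms unfolding GL_def invertible_def gl_pair_def by blast

section \<open>Polynomial functions of a matrix\<close>

definition matrix_monomial :: "'k::field ^ 'v ^ 'v \<Rightarrow> ('v \<times> 'v::finite) tm \<Rightarrow> 'k" where
  "matrix_monomial g t = (\<Prod>(i, j)\<in>UNIV. vec_nth (vec_nth g i) j ^ Poly_Mapping.lookup t (i, j))"

interpretation ev: substitution "\<lambda>a. a" "matrix_monomial g" "\<lambda>F. eval_at_matrix F g"
  for g :: "'k::field ^ 'v ^ 'v::finite"
  by unfold_locales
    (simp_all add: eval_at_matrix_def matrix_monomial_def lookup_add power_add
      prod.distrib case_prod_unfold)

text \<open>Its closure under sums and products shows that Pluecker coordinates of g(V) are
  polynomial in the entries of g without exhibiting the polynomial.\<close>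

definition matrix_poly :: "('k::field ^ 'v ^ 'v::finite \<Rightarrow> 'k) \<Rightarrow> bool" where
  "matrix_poly h \<longleftrightarrow> (\<exists>F. \<forall>g. h g = eval_at_matrix F g)"

lemma matrix_poly_const: "matrix_poly (\<lambda>g. a)"
  unfolding matrix_poly_def by (rule exI[of _ "const_poly a"]) (simp add: ev.subst_const_poly)

lemma matrix_poly_entry: "matrix_poly (\<lambda>g. vec_nth (vec_nth g i) j)"
  unfolding matrix_poly_def
proof (intro exI allI)
  fix g :: "'a ^ 'b ^ 'b"
  have "matrix_monomial g (tm_of_var (i, j)) = (\<Prod>x\<in>UNIV.
    if x = (i, j) then vec_nth (vec_nth g i) j else 1)"
    unfolding matrix_monomial_def
    by (intro prod.cong refl)
      (simp add: tm_of_var_def lookup_single when_def case_prod_unfold prod_eq_iff)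
  thus "vec_nth (vec_nth g i) j = eval_at_matrix (mono_poly (tm_of_var (i, j))) g"
    by (simp add: ev.subst_mono_poly)
qed

lemma matrix_poly_add: "matrix_poly h \<Longrightarrow> matrix_poly k \<Longrightarrow> matrix_poly (\<lambda>g. h g + k g)"
  unfolding matrix_poly_def by (metis ev.subst_add)

lemma matrix_poly_mult: "matrix_poly h \<Longrightarrow> matrix_poly k \<Longrightarrow> matrix_poly (\<lambda>g. h g * k g)"
  unfolding matrix_poly_def by (metis ev.subst_mult)

lemma matrix_poly_sum: "(\<And>x. x \<in> X \<Longrightarrow> matrix_poly (h x)) \<Longrightarrow> matrix_poly (\<lambda>g. \<Sum>x\<in>X. h x g)"
  by (induction X rule: infinite_finite_induct) (auto intro: matrix_poly_const matrix_poly_add)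

lemma matrix_poly_prod: "(\<And>x. x \<in> X \<Longrightarrow> matrix_poly (h x)) \<Longrightarrow> matrix_poly (\<lambda>g. \<Prod>x\<in>X. h x g)"
  by (induction X rule: infinite_finite_induct) (auto intro: matrix_poly_const matrix_poly_mult)

text \<open>The finite set \<open>T\<close> is the same for all matrices, so coefficients of
  products are finite sums of a fixed shape in the coefficients of the factors.\<close>

definition matrix_poly_family :: "('k::field ^ 'v ^ 'v::finite \<Rightarrow> ('w, 'k) mpoly) \<Rightarrow> bool" where
  "matrix_poly_family H \<longleftrightarrow>
     (\<exists>T. finite T \<and> (\<forall>g. H g \<in> supported T)) \<and> (\<forall>t. matrix_poly (\<lambda>g. coeff_of (H g) t))"

lemma matrix_poly_family_const: "matrix_poly_family (\<lambda>g. f)"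
  unfolding matrix_poly_family_def
  by (auto intro!: matrix_poly_const exI[of _ "Poly_Mapping.keys f"] simp: supported_def)

lemma matrix_poly_family_const_poly:
  assumes "matrix_poly h"
  shows "matrix_poly_family (\<lambda>g. const_poly (h g) :: ('w, 'k::field) mpoly)"
proof -
  have "matrix_poly (\<lambda>g. coeff_of (const_poly (h g) :: ('w, 'k) mpoly) t)" for t
    using assms by (cases "t = 0") (simp_all add: const_poly_def lookup_single matrix_poly_const)
  thus ?thesis
    unfolding matrix_poly_family_def
      by (auto intro!: exI[of _ "{0}"] simp: supported_def const_poly_def)
qed

lemma matrix_poly_family_add:
  assumes "matrix_poly_family H" "matrix_poly_family K"
  shows "matrix_poly_family (\<lambda>g. H g + K g)"
proof -
  obtain S T where "finite S" "\<forall>g. H g \<in> supported S" "finite T" "\<forall>g. K g \<in> supported T"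
    using assms unfolding matrix_poly_family_def by blast
  hence "finite (S \<union> T) \<and> (\<forall>g. H g + K g \<in> supported (S \<union> T))"
    by (simp add: in_supported_iff lookup_add)
  moreover have "matrix_poly (\<lambda>g. coeff_of (H g + K g) t)" for t
    unfolding lookup_add using assms unfolding matrix_poly_family_def
      by (intro matrix_poly_add) auto
  ultimately show ?thesis unfolding matrix_poly_family_def by blast
qed

lemma matrix_poly_family_mult:
  assumes "matrix_poly_family H" "matrix_poly_family K"
  shows "matrix_poly_family (\<lambda>g. H g * K g)"
proof -
  obtain S T where ST: "finite S" "\<And>g. H g \<in> supported S" "finite T" "\<And>g. K g \<in> supported T"
    using assms unfolding matrix_poly_family_def by blast
  have prod: "H g * K g =
    (\<Sum>s\<in>S. \<Sum>t\<in>T. Poly_Mapping.single (s + t) (coeff_of (H g) s * coeff_of (K g) t))" for g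
    by (subst (1) poly_sum_superset[OF ST(1,2), of g], subst (1) poly_sum_superset[OF ST(3,4), of g])
      (simp add: sum_product mscale_def const_poly_def mono_poly_def mult_single)
  let ?U = "(\<lambda>(s, t). s + t) ` (S \<times> T)"
  have "coeff_of (H g * K g) u = 0" if "u \<notin> ?U" for g u
  proof -
    have "s + t \<noteq> u" if "s \<in> S" "t \<in> T" for s t using that \<open>u \<notin> ?U\<close> by force
    thus ?thesis by (simp add: prod lookup_sum lookup_single)
  qed
  hence "finite ?U \<and> (\<forall>g. H g * K g \<in> supported ?U)" using ST by (simp add: in_supported_iff)
  moreover have "matrix_poly (\<lambda>g. coeff_of (H g * K g) u)" for u
  proof -
    have "matrix_poly (\<lambda>g. \<Sum>s\<in>S. \<Sum>t\<in>T. coeff_of (H g) s * coeff_of (K g) t * (if s + t =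
      u then 1 else 0))"
      using assms unfolding matrix_poly_family_def
      by (intro matrix_poly_sum matrix_poly_mult matrix_poly_const) auto
    moreover have "coeff_of (H g * K g) u =
        (\<Sum>s\<in>S. \<Sum>t\<in>T. coeff_of (H g) s * coeff_of (K g) t * (if s + t = u then 1 else 0))" for g
      unfolding prod lookup_sum by (intro sum.cong) (auto simp: lookup_single when_def)
    ultimately show ?thesis by simp
  qed
  ultimately show ?thesis unfolding matrix_poly_family_def by blast
qed

lemma matrix_poly_family_sum:
  "(\<And>x. x \<in> X \<Longrightarrow> matrix_poly_family (H x)) \<Longrightarrow> matrix_poly_family (\<lambda>g. \<Sum>x\<in>X. H x g)"
  by (induction X rule: infinite_finite_induct)
    (auto intro: matrix_poly_family_const matrix_poly_family_add)

lemma matrix_poly_family_prod: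
  "(\<And>x. x \<in> X \<Longrightarrow> matrix_poly_family (H x)) \<Longrightarrow> matrix_poly_family (\<lambda>g. \<Prod>x\<in>X. H x g)"
  by (induction X rule: infinite_finite_induct)
    (auto intro: matrix_poly_family_const matrix_poly_family_mult)

lemma matrix_poly_family_power: "matrix_poly_family H \<Longrightarrow> matrix_poly_family (\<lambda>g. H g ^ k)"
  by (induction k) (auto intro: matrix_poly_family_const matrix_poly_family_mult)

lemma matrix_poly_coeff_gl_act: "matrix_poly (\<lambda>g. coeff_of (gl_act g f) t)"
proof -
  have "matrix_poly_family (\<lambda>g. gl_act g f)"
    unfolding gl_act_def
    by (intro matrix_poly_family_sum matrix_poly_family_mult matrix_poly_family_const
        matrix_poly_family_prod matrix_poly_family_power matrix_poly_family_const_poly matrix_poly_entry)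
  thus ?thesis unfolding matrix_poly_family_def by blast
qed

text \<open>By the Leibniz formula the determinant is a polynomial in coefficients that are
  polynomial in the entries of \<open>g\<close>.\<close>

lemma matrix_poly_plucker_coord:
  assumes "length L = length bs"
  shows "matrix_poly (\<lambda>g. plucker_coord (map (gl_act g) bs) L)"
proof -
  let ?q = "length bs"
  have "plucker_coord (map (gl_act g) bs) L =
      (\<Sum>p \<in> {p. p permutes {0..<?q}}. signof p * (\<Prod>i =
        0..<?q. coeff_of (gl_act g (bs ! i)) (L ! p i)))" for g
  proof -
    have "p i < ?q" if "p permutes {0..<?q}" "i < ?q" for p i
      using permutes_in_image[OF that(1), of i] that(2) by simp
    thus ?thesis
      unfolding plucker_coord_def Determinant.det_def using assms
        by (auto intro!: sum.cong prod.cong)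
  qed
  thus ?thesis
    by (simp only:) (intro matrix_poly_sum matrix_poly_mult matrix_poly_const matrix_poly_prod matrix_poly_coeff_gl_act)
qed

text \<open>The image of one fixed basis of \<open>V\<close> is a basis of every translate, so a
  single polynomial tests all of them.\<close>

lemma zariski_open_plucker:
  fixes V :: "('v::finite, 'k::field) mpoly set"
  assumes V: "V \<in> grassmannian m q"
    and gr: "\<And>g. g \<in> GL \<Longrightarrow> gl_act g ` V \<in> grassmannian m q" and L: "length L = q"
  shows "zariski_open_GL {g \<in> GL. gl_act g ` V \<in> plucker_open m q L}"
proof -
  obtain bs where bs: "is_basis_list bs V" using grassmannian_basis[OF V] by blast
  have len: "length L = length bs"
    using is_basis_list_length[OF bs] V L by (simp add: grassmannian_def)
  obtain F where F: "\<And>g. plucker_coord (map (gl_act g) bs) L = eval_at_matrix F g"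
    using matrix_poly_plucker_coord[OF len] unfolding matrix_poly_def by blast
  have "gl_act g ` V \<in> plucker_open m q L \<longleftrightarrow> eval_at_matrix F g \<noteq> 0" if g: "g \<in> GL" for g
  proof -
    obtain h where "gl_pair g h" using gl_pair_exists[OF g] by blast
    then interpret gl_pair g h .
    show ?thesis
      using plucker_coord_eq_0_iff[OF image_basis_list[OF bs], of L] len gr[OF g] F[of g]
        plucker_open_iff[OF L, of "gl_act g ` V" m] by auto
  qed
  hence "{g \<in> GL. gl_act g ` V \<in> plucker_open m q L} = {g \<in> GL. \<exists>F\<in>{F}. eval_at_matrix F g \<noteq> 0}"
    by auto
  thus ?thesis unfolding zariski_open_GL_def by blast
qed

section \<open>Non-empty open subsets of the general linear group meet\<close>

definition univariate :: "('k::field \<Rightarrow> 'k) \<Rightarrow> bool" where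
  "univariate h \<longleftrightarrow> (\<exists>P. \<forall>s. h s = poly P s)"

lemma univariate_const: "univariate (\<lambda>s. a)"
  unfolding univariate_def by (rule exI[of _ "[:a:]"]) simp

lemma univariate_id: "univariate (\<lambda>s. s)"
  unfolding univariate_def by (rule exI[of _ "[:0, 1:]"]) simp

lemma univariate_add: "univariate h \<Longrightarrow> univariate k \<Longrightarrow> univariate (\<lambda>s. h s + k s)"
  unfolding univariate_def by (metis poly_add)

lemma univariate_mult: "univariate h \<Longrightarrow> univariate k \<Longrightarrow> univariate (\<lambda>s. h s * k s)"
  unfolding univariate_def by (metis poly_mult)

lemma univariate_sum: "(\<And>x. x \<in> X \<Longrightarrow> univariate (h x)) \<Longrightarrow> univariate (\<lambda>s. \<Sum>x\<in>X. h x s)"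
  by (induction X rule: infinite_finite_induct) (auto intro: univariate_const univariate_add)

lemma univariate_prod: "(\<And>x. x \<in> X \<Longrightarrow> univariate (h x)) \<Longrightarrow> univariate (\<lambda>s. \<Prod>x\<in>X. h x s)"
  by (induction X rule: infinite_finite_induct) (auto intro: univariate_const univariate_mult)

lemma univariate_power: "univariate h \<Longrightarrow> univariate (\<lambda>s. h s ^ k)"
  by (induction k) (auto intro: univariate_const univariate_mult)

text \<open>Each function has finitely many zeros, and finitely many finite sets do not exhaust an
  infinite field.\<close>

lemma univariate_avoid:
  fixes h :: "'a \<Rightarrow> 'k::field \<Rightarrow> 'k"
  assumes "infinite (UNIV :: 'k set)" "finite X" "\<And>x. x \<in> X \<Longrightarrow> univariate (h x)"
    "\<And>x. x \<in> X \<Longrightarrow> \<exists>s. h x s \<noteq> 0"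
  shows "\<exists>s. \<forall>x\<in>X. h x s \<noteq> 0"
proof -
  have "\<forall>x\<in>X. \<exists>P. \<forall>s. h x s = poly P s" using assms(3) unfolding univariate_def by blast
  then obtain P where P: "\<And>x s. x \<in> X \<Longrightarrow> h x s = poly (P x) s" by metis
  have "finite {s. h x s = 0}" if "x \<in> X" for x
  proof -
    obtain s where "h x s \<noteq> 0" using assms(4) \<open>x \<in> X\<close> by blast
    hence "P x \<noteq> 0" using P[OF that, of s] by auto
    thus ?thesis using poly_roots_finite[of "P x"] by (simp add: P[OF that])
  qed
  hence "finite (\<Union>x\<in>X. {s. h x s = 0})" using assms(2) by blast
  then obtain s where "s \<notin> (\<Union>x\<in>X. {s. h x s = 0})" using assms(1) by (metis ex_new_if_finite)
  thus ?thesis by blast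
qed

text \<open>Restrict to the line \<open>l\<close> through a matrix of each set: the determinant and
  both defining polynomials become non-zero polynomials in one variable and have a common
  non-zero.\<close>

lemma zariski_open_GL_meet:
  fixes U W :: "('k::field ^ 'v::finite ^ 'v) set"
  assumes inf: "infinite (UNIV :: 'k set)"
    and open': "zariski_open_GL U" "zariski_open_GL W" and ne: "U \<noteq> {}" "W \<noteq> {}"
  shows "U \<inter> W \<noteq> {}"
proof -
  obtain F\<^sub>1 g\<^sub>1 where 1: "g\<^sub>1 \<in> GL" "eval_at_matrix F\<^sub>1 g\<^sub>1 \<noteq> 0"
      "\<And>g. g \<in> GL \<Longrightarrow> eval_at_matrix F\<^sub>1 g \<noteq> 0 \<Longrightarrow> g \<in> U"
    using open'(1) ne(1) unfolding zariski_open_GL_def by blast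
  obtain F\<^sub>2 g\<^sub>2 where 2: "g\<^sub>2 \<in> GL" "eval_at_matrix F\<^sub>2 g\<^sub>2 \<noteq> 0"
      "\<And>g. g \<in> GL \<Longrightarrow> eval_at_matrix F\<^sub>2 g \<noteq> 0 \<Longrightarrow> g \<in> W"
    using open'(2) ne(2) unfolding zariski_open_GL_def by blast
  define l :: "'k \<Rightarrow> 'k ^ 'v ^ 'v" where
    "l s = (\<chi> i j. vec_nth (vec_nth g\<^sub>1 i) j + s * (vec_nth (vec_nth g\<^sub>2 i) j - vec_nth (vec_nth g\<^sub>1 i) j))" for s
  have l0: "l 0 = g\<^sub>1" and l1: "l 1 = g\<^sub>2"
    by (simp_all add: l_def Finite_Cartesian_Product.vec_eq_iff)
  have entry: "univariate (\<lambda>s. vec_nth (vec_nth (l s) i) j)" for i j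
    unfolding l_def by (simp, intro univariate_add univariate_mult univariate_const univariate_id)
  have ev: "univariate (\<lambda>s. eval_at_matrix F (l s))" for F
    unfolding eval_at_matrix_def case_prod_unfold
    by (intro univariate_sum univariate_mult univariate_const univariate_prod univariate_power entry)
  have det: "univariate (\<lambda>s. Determinants.det (l s))"
    unfolding Determinants.det_def
    by (intro univariate_sum univariate_mult univariate_const univariate_prod entry)
  \<comment> \<open>The index enumerates the three functions; they are non-zero at the parameters 0,
    0 and 1 respectively.\<close>
  have "\<exists>s. \<forall>x\<in>{0, 1, 2 :: nat}. (if x = 0 then Determinants.det (l s) else
      if x = 1 then eval_at_matrix F\<^sub>1 (l s) else eval_at_matrix F\<^sub>2 (l s)) \<noteq> 0"
  proof (rule univariate_avoid[OF inf])
    fix x :: nat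
    show "univariate (\<lambda>s. if x = 0 then Determinants.det (l s) else
      if x = 1 then eval_at_matrix F\<^sub>1 (l s) else eval_at_matrix F\<^sub>2 (l s))"
      by (cases "x = 0"; cases "x = 1") (simp_all add: ev det)
    have "Determinants.det (l 0) \<noteq> 0" using 1(1) l0 by (simp add: GL_def invertible_det_nz)
    thus "\<exists>s. (if x = 0 then Determinants.det (l s) else
      if x = 1 then eval_at_matrix F\<^sub>1 (l s) else eval_at_matrix F\<^sub>2 (l s)) \<noteq> 0"
      using 1(2) 2(2) l0 l1 by (metis (full_types))
  qed simp
  then obtain s where s: "Determinants.det (l s) \<noteq> 0" "eval_at_matrix F\<^sub>1 (l s) \<noteq> 0"
    "eval_at_matrix F\<^sub>2 (l s) \<noteq> 0"
    by auto
  have "l s \<in> GL" using s(1) by (simp add: GL_def invertible_det_nz)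
  thus ?thesis using 1(3) 2(3) s by blast
qed

section \<open>The generic initial ideal\<close>

text \<open>Two candidates for the constant value agree because their open sets share a
  matrix.\<close>

lemma generic_initial_ideal_eqI:
  fixes I :: "('v::finite, 'k::field) mpoly set"
  assumes inf: "infinite (UNIV :: 'k set)" and U: "zariski_open_GL U" "U \<noteq> {}"
    "\<And>g. g \<in> U \<Longrightarrow> initial_ideal prec (gl_act g ` I) = J"
  shows "generic_initial_ideal prec I = J"
  unfolding generic_initial_ideal_def
proof (rule the_equality)
  show "\<exists>U. zariski_open_GL U \<and> U \<noteq> {} \<and> (\<forall>g\<in>U. initial_ideal prec (gl_act g ` I) = J)"
    using U by blast
  fix J' assume "\<exists>U. zariski_open_GL U \<and> U \<noteq> {} \<and> (\<forall>g\<in>U. initial_ideal prec (gl_act g ` I) = J')"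
  then obtain W where W: "zariski_open_GL W" "W \<noteq> {}" "\<And>g. g \<in> W \<Longrightarrow>
    initial_ideal prec (gl_act g ` I) = J'"
    by blast
  obtain g where "g \<in> U" "g \<in> W" using zariski_open_GL_meet[OF inf U(1) W(1) U(2) W(2)] by blast
  thus "J' = J" using U(3) W(3) by blast
qed

theorem theorem4p2:
  fixes prec :: "'v::{finite,linorder} tm \<Rightarrow> 'v tm \<Rightarrow> bool"
    and p :: "rat poly"
    and n m r q :: nat
    and V V1 V2 :: "('v, 'k::field) mpoly set"
  assumes "infinite (UNIV :: 'k set)"
    and "CARD('v) = n + 1"
    and "term_order prec"
    and "\<And>i j. i < j \<Longrightarrow> prec (tm_of_var i) (tm_of_var j)"
    and "is_gotzmann_number TYPE(('v, 'k) mpoly) p r"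
    and "r \<le> m"
    and "of_nat q = of_nat ((n + m) choose n) - poly p (of_nat m)"
    and "V \<in> hilbert_scheme_points p m"
    and "V1 = vs (in_wedge prec m q V)"
    and "V2 = vs (gin_wedge prec m q V)"
  shows "has_hilbert_polynomial (ideal.span V1) p \<and>
         has_hilbert_polynomial (ideal.span V2) p \<and>
         ideal.span V1 = initial_ideal prec (ideal.span V) \<and>
         initial_ideal prec (ideal.span V) =
           truncate_ge m (saturation (initial_ideal prec (ideal.span V))) \<and>
         ideal.span V2 = generic_initial_ideal prec (ideal.span V) \<and>
         generic_initial_ideal prec (ideal.span V) =
           truncate_ge m (saturation (generic_initial_ideal prec (ideal.span V)))"
proof -
  interpret ordered_terms prec by unfold_locales (rule assms(3))
  have "\<forall>J\<in>(subscheme_ideals p :: ('v, 'k) mpoly set set). regular_ideal r J"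
    using assms(5) unfolding is_gotzmann_number_def by blast
  note point = initial_ideal_hilbert_point[OF this assms(6,2,7)]
  have orbit: "gl_act g ` V \<in> hilbert_scheme_points p m" if g: "g \<in> GL" for g
  proof -
    obtain h where "gl_pair g h" using gl_pair_exists[OF g] by blast
    then interpret gl_pair g h .
    show ?thesis by (rule image_hilbert_point[OF assms(8)])
  qed
  have span_orbit: "gl_act g ` ideal.span V = ideal.span (gl_act g ` V)" if g: "g \<in> GL" for g
  proof -
    obtain h where "gl_pair g h" using gl_pair_exists[OF g] by blast
    then interpret gl_pair g h .
    show ?thesis by (rule image_span)
  qed
  let ?A = "{L \<in> term_wedges prec m q. plucker_open m q L \<inter> gl_orbit V \<noteq> {}}"
  have open_in: "gl_act g ` V \<in> plucker_open m q (in_wedge prec m q (gl_act g ` V))"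
    and wedge_in: "in_wedge prec m q (gl_act g ` V) \<in> ?A" if "g \<in> GL" for g
  proof -
    note gr = point(1)[OF orbit[OF that]]
    show *: "gl_act g ` V \<in> plucker_open m q (in_wedge prec m q (gl_act g ` V))"
      using plucker_open_lead_terms[OF gr set_in_wedge(1)[OF gr]] set_in_wedge(2)[OF gr]
      by (simp add: term_wedges_def)
    have "gl_act g ` V \<in> gl_orbit V" using that unfolding gl_orbit_def by blast
    thus "in_wedge prec m q (gl_act g ` V) \<in> ?A" using * set_in_wedge(2)[OF gr] by blast
  qed
  have len: "length M = q" if "M \<in> ?A" for M using that by (simp add: term_wedges_def)
  \<comment> \<open>The identity matrix shows that there is at least one candidate.\<close>
  obtain L where L: "L \<in> ?A" "\<forall>M\<in>?A. M \<noteq> L \<longrightarrow> wedge_less prec M L"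
    using max_wedge_exists[of ?A q] finite_term_wedges[of m q] wedge_in[OF mat_1_GL] len by auto
  have gin: "gin_wedge prec m q V = L"
    unfolding gin_wedge_def by (rule max_wedge_eqI[OF L(1) _ len]) (use L(2) in auto)
  define U where "U = {g \<in> GL. gl_act g ` V \<in> plucker_open m q L}"
  \<comment> \<open>The initial wedge of g(V) is a candidate of the orbit, hence not above
    \<open>L\<close>; as g(V) lies in the open set of \<open>L\<close>, it is not below
    \<open>L\<close> either.\<close>
  have in_L: "in_wedge prec m q (gl_act g ` V) = L" if "g \<in> U" for g
  proof (rule ccontr)
    assume ne: "in_wedge prec m q (gl_act g ` V) \<noteq> L"
    have g: "g \<in> GL" "gl_act g ` V \<in> plucker_open m q L" using that by (auto simp: U_def)
    note gr = point(1)[OF orbit[OF g(1)]]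
    have "wedge_less prec (in_wedge prec m q (gl_act g ` V)) L" using L(2) wedge_in[OF g(1)] ne
      by blast
    moreover have "wedge_less prec L (in_wedge prec m q (gl_act g ` V))"
      using lead_terms_maximal[OF g(2) _ set_in_wedge(1)[OF gr] set_in_wedge(2)[OF gr]] L(1) ne
        by auto
    ultimately show False using wedge_less_asym len[OF L(1)] len[OF wedge_in[OF g(1)]] by metis
  qed
  have U_open: "zariski_open_GL U"
    unfolding U_def using zariski_open_plucker[OF point(1)[OF assms(8)] point(1)[OF orbit] len[OF L(1)]] .
  obtain g where g: "g \<in> U" using L(1) unfolding U_def gl_orbit_def by blast
  have U_GL: "g \<in> GL" if "g \<in> U" for g using that by (simp add: U_def)
  \<comment> \<open>The result for the point g(V) identifies its initial ideal with the ideal of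
    \<open>L\<close>, the same for every g in \<open>U\<close>.\<close>
  have init: "initial_ideal prec (gl_act g ` ideal.span V) = ideal.span V2" if "g \<in> U" for g
    using point(3)[OF orbit[OF U_GL[OF that]]]
    unfolding span_orbit[OF U_GL[OF that]] in_L[OF that] assms(10) gin ..
  have gen: "generic_initial_ideal prec (ideal.span V) = ideal.span V2"
    by (rule generic_initial_ideal_eqI[OF assms(1) U_open _ init]) (use g in blast)
  \<comment> \<open>The claims on \<open>V2\<close> are those on the initial ideal of g(V) for a
    single g in \<open>U\<close>.\<close>
  note point_g = point[OF orbit[OF U_GL[OF g]], unfolded span_orbit[OF U_GL[OF g], symmetric] init[OF g] in_L[OF g]]
  show ?thesis
    unfolding gen using point[OF assms(8)] point_g unfolding assms(9,10) gin by blast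
qed

end
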